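(* Let $\sigma>0$ be a constant with $\sigma\ne 1$, let $g\in L^2(\mathbb{R}^N\times\mathbb{R})$, and let $u\in L^2(\mathbb{R}^N\times\mathbb{R})$ be a solution of $$Yu(x,t)-\sigma\Delta_{m_0}u(x,t)=g(x,t),\qquad (x,t)\in\mathbb{R}^N\times\mathbb{R}.$$ Then both $Yu$ and $\Delta_{m_0}u$ belong to $L^2(\mathbb{R}^N\times\mathbb{R})$, and $$\|D_1^{2/3}u\|_2\le C(N,B)\,\|D_0^{2}u\|_2^{1/3}\,\|g\|_2^{2/3},$$ where $C(N,B)$ is a constant depending only on $N$ and $B$.
   Context: Let $N,m_0,m_1$ be integers with $m_0\ge m_1\ge 1$ and $m_0+m_1=N$. Coordinates (a basis) on $\mathbb{R}^N$ are chosen so that the constant real $N\times N$ matrix $B=(b_{ij})$ has the block form $$B=\begin{pmatrix}\mathbb{O}&\mathbb{O}\\ B_1&\mathbb{O}\end{pmatrix},$$ where $B_1$ is an $m_1\times m_0$ matrix of rank $m_1$ and $\mathbb{O}$ denotes zero blocks (of sizes $m_0\times m_0$, $m_0\times m_1$ and $m_1\times m_1$). Write $x=(x^{(0)},x^{(1)})\in\mathbb{R}^N$ with $x^{(0)}\in\mathbb{R}^{m_0}$ and $x^{(1)}\in\mathbb{R}^{m_1}$. The transport operator $Y$ is $$Yu(x,t)=\sum_{i,j=1}^N b_{ij}x_j\,\partial_{x_i}u(x,t)-\partial_t u(x,t).$$ Let $\Delta_{m_0}$ and $\Delta_{m_1}$ denote the Laplacians with respect to the variables $x^{(0)}$ and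 $x^{(1)}$ respectively. Derivatives and the equation are understood in the sense of distributions on $\mathbb{R}^{N+1}=\mathbb{R}^N\times\mathbb{R}$. For a real exponent $r\ge 0$, set $D_0^{r}u=(-\Delta_{m_0})^{r/2}u$ and $D_1^{r}u=(-\Delta_{m_1})^{r/2}u$ (fractional powers defined via the Fourier transform in $x^{(0)}$, respectively $x^{(1)}$); in particular $D_0^2u=-\Delta_{m_0}u$. $\|\cdot\|_2$ is the norm of $L^2(\mathbb{R}^{N+1})$. *)

theory Defs
  imports "HOL-Analysis.Analysis"
begin

section \<open>Square-integrable functions\<close>

text \<open>Elements of \<open>L\<^sup>2\<close> are represented by complex-valued Borel functions; real-valued
  functions are the special case of vanishing imaginary part.\<close>

definition L2 :: "('a::euclidean_space \<Rightarrow> complex) \<Rightarrow> bool" where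
  "L2 f \<longleftrightarrow> f \<in> borel_measurable lborel \<and> integrable lborel (\<lambda>z. (norm (f z))\<^sup>2)"

definition L2norm :: "('a::euclidean_space \<Rightarrow> complex) \<Rightarrow> real" where
  "L2norm f = sqrt (LINT z|lborel. (norm (f z))\<^sup>2)"

section \<open>Test functions and distributions\<close>

definition pdiff :: "'a::euclidean_space \<Rightarrow> ('a \<Rightarrow> complex) \<Rightarrow> 'a \<Rightarrow> complex" where
  "pdiff b f = (\<lambda>z. frechet_derivative f (at z) b)"

text \<open>If every iterated partial derivative is (totally) differentiable, then all of them are
  continuous, so this is \<open>C\<^sup>\<infinity>\<close>.\<close>

definition smooth :: "('a::euclidean_space \<Rightarrow> complex) \<Rightarrow> bool" where
  "smooth f \<longleftrightarrow> (\<forall>bs. set bs \<subseteq> Basis \<longrightarrow> foldr pdiff bs f differentiable_on UNIV)"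

definition test_fun :: "('a::euclidean_space \<Rightarrow> complex) \<Rightarrow> bool" where
  "test_fun \<phi> \<longleftrightarrow> smooth \<phi> \<and> compact (closure {z. \<phi> z \<noteq> 0})"

text \<open>A distribution is represented by its (bilinear) pairing with functions; only its values
  on test functions are meaningful.\<close>

type_synonym 'a distrib = "('a \<Rightarrow> complex) \<Rightarrow> complex"

definition regular :: "('a::euclidean_space \<Rightarrow> complex) \<Rightarrow> 'a distrib" where
  "regular u = (\<lambda>\<phi>. LINT z|lborel. u z * \<phi> z)"

definition dpartial :: "'a::euclidean_space \<Rightarrow> 'a distrib \<Rightarrow> 'a distrib" where
  "dpartial b T = (\<lambda>\<phi>. - T (pdiff b \<phi>))"

definition dmult :: "('a \<Rightarrow> real) \<Rightarrow> 'a distrib \<Rightarrow> 'a distrib" where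
  "dmult a T = (\<lambda>\<phi>. T (\<lambda>z. complex_of_real (a z) * \<phi> z))"

definition eq_distrib :: "'a::euclidean_space distrib \<Rightarrow> 'a distrib \<Rightarrow> bool" where
  "eq_distrib S T \<longleftrightarrow> (\<forall>\<phi>. test_fun \<phi> \<longrightarrow> S \<phi> = T \<phi>)"

definition distrib_in_L2 :: "'a::euclidean_space distrib \<Rightarrow> bool" where
  "distrib_in_L2 T \<longleftrightarrow> (\<exists>f. L2 f \<and> eq_distrib T (regular f))"

section \<open>The operators\<close>

text \<open>\<open>\<real>\<^sup>N\<close> is \<open>real ^ ('m + 'n)\<close> with \<open>m\<^sub>0 = CARD('m)\<close> and \<open>m\<^sub>1 = CARD('n)\<close>: the indices
  \<open>Inl i\<close> belong to \<open>x\<^sup>(\<^sup>0\<^sup>)\<close> and the indices \<open>Inr j\<close> to \<open>x\<^sup>(\<^sup>1\<^sup>)\<close>. Points of space-time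
  are pairs \<open>(x, t)\<close>.\<close>

definition blk0 :: "real ^ ('m::finite + 'n::finite) \<Rightarrow> real ^ 'm" where
  "blk0 x = (\<chi> i. x $ Inl i)"

definition blk1 :: "real ^ ('m::finite + 'n::finite) \<Rightarrow> real ^ 'n" where
  "blk1 x = (\<chi> j. x $ Inr j)"

definition join :: "real ^ 'm::finite \<Rightarrow> real ^ 'n::finite \<Rightarrow> real ^ ('m + 'n)" where
  "join a b = (\<chi> k. case k of Inl i \<Rightarrow> a $ i | Inr j \<Rightarrow> b $ j)"

definition block_matrix :: "real ^ 'm::finite ^ 'n::finite \<Rightarrow> real ^ ('m + 'n) ^ ('m + 'n)" where
  "block_matrix B1 =
     (\<chi> i j. case i of Inl _ \<Rightarrow> 0
                     | Inr k \<Rightarrow> (case j of Inl l \<Rightarrow> B1 $ k $ l | Inr _ \<Rightarrow> 0))"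

definition transport_Y ::
    "real ^ 'k ^ 'k \<Rightarrow> ((real ^ 'k::finite) \<times> real) distrib \<Rightarrow> ((real ^ 'k) \<times> real) distrib" where
  "transport_Y B T = (\<lambda>\<phi>.
     (\<Sum>i\<in>UNIV. \<Sum>j\<in>UNIV. complex_of_real (B $ i $ j) *
        dmult (\<lambda>z. fst z $ j) (dpartial (axis i 1, 0) T) \<phi>)
     - dpartial (0, 1) T \<phi>)"

definition laplacian0 ::
    "((real ^ ('m::finite + 'n::finite)) \<times> real) distrib \<Rightarrow> ((real ^ ('m + 'n)) \<times> real) distrib" where
  "laplacian0 T = (\<lambda>\<phi>. \<Sum>i\<in>UNIV.
     dpartial (axis (Inl i) 1, 0) (dpartial (axis (Inl i) 1, 0) T) \<phi>)"

section \<open>Partial Fourier transforms and fractional derivatives\<close>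

definition fourier0 :: "((real ^ ('m::finite + 'n::finite)) \<times> real \<Rightarrow> complex)
    \<Rightarrow> (real ^ ('m + 'n)) \<times> real \<Rightarrow> complex" where
  "fourier0 \<phi> = (\<lambda>(x, t). LINT y|lborel.
     exp (- \<i> * complex_of_real (y \<bullet> blk0 x)) * \<phi> (join y (blk1 x), t))"

definition fourier1 :: "((real ^ ('m::finite + 'n::finite)) \<times> real \<Rightarrow> complex)
    \<Rightarrow> (real ^ ('m + 'n)) \<times> real \<Rightarrow> complex" where
  "fourier1 \<phi> = (\<lambda>(x, t). LINT y|lborel.
     exp (- \<i> * complex_of_real (y \<bullet> blk1 x)) * \<phi> (join (blk0 x) y, t))"

text \<open>For \<open>u\<close> in \<open>L\<^sup>2\<close> the Fourier integral need not converge, so its transform is taken in the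
  sense of tempered distributions: \<open>\<langle>F u, \<phi>\<rangle> = \<langle>u, F \<phi>\<rangle>\<close>. By Plancherel \<open>F u\<close> is again an
  \<open>L\<^sup>2\<close> function, and it is determined almost everywhere.\<close>

definition L2_transform :: "(('a::euclidean_space \<Rightarrow> complex) \<Rightarrow> 'a \<Rightarrow> complex)
    \<Rightarrow> ('a \<Rightarrow> complex) \<Rightarrow> ('a \<Rightarrow> complex) \<Rightarrow> bool" where
  "L2_transform F u w \<longleftrightarrow> L2 u \<and> L2 w \<and>
     (\<forall>\<phi>. test_fun \<phi> \<longrightarrow> regular w \<phi> = regular u (F \<phi>))"

text \<open>\<open>has_D0 r u v\<close> says that \<open>D\<^sub>0\<^sup>r u\<close> is the \<open>L\<^sup>2\<close> function \<open>v\<close>, i.e.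
  \<open>F\<^sub>0 v = |\<xi>\<^sup>(\<^sup>0\<^sup>)|\<^sup>r F\<^sub>0 u\<close>; likewise for \<open>has_D1\<close>. Such \<open>v\<close> is unique up to null sets.\<close>

definition has_D0 :: "real \<Rightarrow> ((real ^ ('m::finite + 'n::finite)) \<times> real \<Rightarrow> complex)
    \<Rightarrow> ((real ^ ('m + 'n)) \<times> real \<Rightarrow> complex) \<Rightarrow> bool" where
  "has_D0 r u v \<longleftrightarrow> (\<exists>w. L2_transform fourier0 u w \<and>
     L2_transform fourier0 v (\<lambda>z. complex_of_real (norm (blk0 (fst z)) powr r) * w z))"

definition has_D1 :: "real \<Rightarrow> ((real ^ ('m::finite + 'n::finite)) \<times> real \<Rightarrow> complex)
    \<Rightarrow> ((real ^ ('m + 'n)) \<times> real \<Rightarrow> complex) \<Rightarrow> bool" where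
  "has_D1 r u v \<longleftrightarrow> (\<exists>w. L2_transform fourier1 u w \<and>
     L2_transform fourier1 v (\<lambda>z. complex_of_real (norm (blk1 (fst z)) powr r) * w z))"

end

theory Submission
  imports Defs "HOL-Probability.Characteristic_Functions" "HOL-Computational_Algebra.Polynomial"
begin

text \<open>Let \<open>(\<xi>\<^sub>0, \<xi>\<^sub>1, \<tau>)\<close> be the dual variables and \<open>\<eta>\<close> the transpose of \<open>B\<^sub>1\<close> applied to \<open>\<xi>\<^sub>1\<close>.
  Under the full Fourier transform the equation becomes \<open>d/ds U = (\<sigma> |\<xi>\<^sub>0 + s \<eta>|\<^sup>2 - \<i> \<tau>) U - G\<close>
  along the lines \<open>\<xi>\<^sub>0 + s \<eta>\<close>. Hence, for every time \<open>T \<ge> 0\<close>, which may depend on \<open>\<eta>\<close>,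
  \<open>|U| \<le> e\<^bsup>-A(T)\<^esup> |U \<circ> S\<^sub>T| + \<integral>\<^sub>0\<^sup>T e\<^bsup>-A(r)\<^esup> |G \<circ> S\<^sub>r| dr\<close>, where \<open>S\<^sub>r\<close> is the shift of \<open>\<xi>\<^sub>0\<close> by \<open>r \<eta>\<close>
  and \<open>A(r) = \<sigma> \<integral>\<^sub>0\<^sup>r |\<xi>\<^sub>0 + s \<eta>|\<^sup>2 ds\<close>. This is obtained by testing the equation with exponentials
  times a cutoff and letting the cutoff tend to 1.

  For \<open>T = (12 / (\<sigma> |\<eta>|\<^sup>2))\<^bsup>1/3\<^esup>\<close> one has \<open>A(T) \<ge> 1\<close>, so the first term can be absorbed and \<open>U / T\<close> is in \<open>L\<^sup>2\<close>;
  this controls \<open>|\<xi>\<^sub>0|\<^sup>2 U\<close> where \<open>|\<xi>\<^sub>0|\<close> is at most of order \<open>T |\<eta>|\<close>, and elsewhere the weight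
  \<open>e\<^bsup>-A(r)\<^esup>\<close> decays like \<open>e\<^bsup>-c \<sigma> |\<xi>\<^sub>0|\<^sup>2 r\<^esup>\<close>. So \<open>\<Delta>u\<close>, and with it \<open>Yu\<close>, is in \<open>L\<^sup>2\<close>.

  For \<open>T = 2 \<epsilon> |\<eta>|\<^bsup>-2/3\<^esup>\<close> one drops \<open>A \<ge> 0\<close>. One of \<open>\<xi>\<^sub>0\<close>, \<open>\<xi>\<^sub>0 + T \<eta>\<close> has length at least \<open>T |\<eta>| / 2\<close>, whence
  \<open>\<parallel>|\<eta>|\<^bsup>2/3\<^esup> U\<parallel>\<^sup>2 \<le> C (\<epsilon>\<^sup>-\<^sup>4 \<parallel>|\<xi>\<^sub>0|\<^sup>2 U\<parallel>\<^sup>2 + \<epsilon>\<^sup>2 \<parallel>G\<parallel>\<^sup>2)\<close> with \<open>C\<close> absolute. Optimising in \<open>\<epsilon>\<close>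
  gives the estimate; the rank condition enters through \<open>|\<eta>| \<ge> \<kappa> |\<xi>\<^sub>1|\<close>.\<close>

section \<open>Square-integrable functions\<close>

text \<open>The constant may depend on B but not on \<sigma>, which forces two passes. Any use of
  the damping A brings in \<sigma>, so the first pass serves finiteness only; the second drops A and
  yields a bound free of \<sigma>, informative because the first has made its right-hand side
  finite. The exponents come from the geometry: in time T a frequency moves by T|eta|, so T
  |eta|^(2/3) = const is the choice for which |xi_0|^2 at one of the two ends is at least of order
  |eta|^(2/3), while the factor T^2 in front of |G|^2 is offset by the squared weight |eta|^(4/3).

  Since u is only in L2 and the equation holds weakly, U is a class of functions without derivatives
  along lines. A cutoff makes the transform differentiable along lines and the differential equation
  exact; the inequality between moduli then survives limits in local L1, because the shear preserves
  measure. The fractional powers are defined by partial transforms while the characteristics live in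
  all frequencies; Plancherel in the remaining variables identifies the weighted norms.\<close>

lemma borel_measurable_cnj[measurable]:
  "f \<in> borel_measurable M \<Longrightarrow> (\<lambda>z. cnj (f z)) \<in> borel_measurable M"
  by (rule measurable_compose[of f M borel cnj])
     (auto intro!: borel_measurable_continuous_onI continuous_intros)

text \<open>The squared norm is kept in \<open>ennreal\<close> as well: Tonelli, Fatou and monotone
  convergence then apply before finiteness is known, whereas \<open>L2norm\<close> takes the value 0
  when the square is not integrable.\<close>

definition nsq :: "('a::euclidean_space \<Rightarrow> complex) \<Rightarrow> ennreal" where
  "nsq f = (\<integral>\<^sup>+z. ennreal ((norm (f z))\<^sup>2) \<partial>lborel)"

lemma L2_iff: "L2 f \<longleftrightarrow> f \<in> borel_measurable borel \<and> nsq f < \<infinity>"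
  unfolding L2_def nsq_def by (auto simp: integrable_iff_bounded)

lemma L2_measurable[measurable_dest]: "L2 f \<Longrightarrow> f \<in> borel_measurable borel"
  by (simp add: L2_iff)

lemma L2_integrable_sq: "L2 f \<Longrightarrow> integrable lborel (\<lambda>z. (norm (f z))\<^sup>2)"
  by (simp add: L2_def)

lemma L2norm_nonneg[simp]: "0 \<le> L2norm f"
  by (simp add: L2norm_def)

lemma L2norm_sq: "(L2norm f)\<^sup>2 = (LINT z|lborel. (norm (f z))\<^sup>2)"
  by (simp add: L2norm_def)

lemma nsq_L2norm: "L2 f \<Longrightarrow> nsq f = ennreal ((L2norm f)\<^sup>2)"
  unfolding nsq_def L2norm_sq by (intro nn_integral_eq_integral L2_integrable_sq) auto

lemma L2norm_nsq: "f \<in> borel_measurable borel \<Longrightarrow> L2norm f = sqrt (enn2real (nsq f))"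
  unfolding L2norm_def nsq_def by (subst integral_eq_nn_integral) auto

lemma nsq_cong_AE: "AE z in lborel. f z = g z \<Longrightarrow> nsq f = nsq g"
  unfolding nsq_def by (intro nn_integral_cong_AE) auto

lemma L2norm_cong_AE:
  assumes "L2 f" "L2 g" "AE z in lborel. f z = g z" shows "L2norm f = L2norm g"
  using nsq_cong_AE[OF assms(3)] assms(1,2) by (simp add: L2norm_nsq L2_measurable)

lemma nsq_mono: "(\<And>z. norm (f z) \<le> norm (g z)) \<Longrightarrow> nsq f \<le> nsq g"
  unfolding nsq_def by (intro nn_integral_mono ennreal_leI power_mono) auto

lemma L2_bound:
  assumes "L2 g" "f \<in> borel_measurable borel" "\<And>z. norm (f z) \<le> norm (g z)"
  shows "L2 f"
  using assms nsq_mono[of f g] by (auto simp: L2_iff)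

lemma L2_zero[simp]: "L2 (\<lambda>z. 0)"
  by (simp add: L2_def)

lemma L2_add:
  assumes [measurable]: "L2 f" "L2 g" shows "L2 (\<lambda>z. f z + g z)"
proof -
  have "(norm (f z + g z))\<^sup>2 \<le> 2 * (norm (f z))\<^sup>2 + 2 * (norm (g z))\<^sup>2" for z
  proof -
    have "(norm (f z + g z))\<^sup>2 \<le> (norm (f z) + norm (g z))\<^sup>2"
      by (intro power_mono norm_triangle_ineq) auto
    also have "\<dots> \<le> 2 * (norm (f z))\<^sup>2 + 2 * (norm (g z))\<^sup>2"
      using sum_squares_bound[of "norm (f z)" "norm (g z)"] by (simp add: power2_sum)
    finally show ?thesis .
  qed
  then have "AE z in lborel. norm ((norm (f z + g z))\<^sup>2) \<le> norm (2 * (norm (f z))\<^sup>2 + 2 * (norm (g z))\<^sup>2)"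
    by simp
  moreover have "integrable lborel (\<lambda>z. 2 * (norm (f z))\<^sup>2 + 2 * (norm (g z))\<^sup>2)"
    by (simp add: assms L2_integrable_sq)
  ultimately have "integrable lborel (\<lambda>z. (norm (f z + g z))\<^sup>2)"
    by (rule Bochner_Integration.integrable_bound[rotated 2]) measurable
  then show ?thesis by (simp add: L2_def)
qed

lemma L2_cmult: "L2 f \<Longrightarrow> L2 (\<lambda>z. c * f z)"
  by (auto simp: L2_def norm_mult power_mult_distrib)

lemma L2_minus: "L2 f \<Longrightarrow> L2 (\<lambda>z. - f z)"
  using L2_cmult[of f "-1"] by simp

lemma L2_diff: "L2 f \<Longrightarrow> L2 g \<Longrightarrow> L2 (\<lambda>z. f z - g z)"
  using L2_add[OF _ L2_minus, of f g] by simp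

lemma L2_cnj: "L2 f \<Longrightarrow> L2 (\<lambda>z. cnj (f z))"
  by (auto simp: L2_def)

lemma L2_mult_bounded:
  assumes [measurable]: "L2 f" "m \<in> borel_measurable borel" and "\<And>z. norm (m z) \<le> M"
  shows "L2 (\<lambda>z. m z * f z)"
proof (rule L2_bound)
  show "L2 (\<lambda>z. of_real M * f z)" by (intro L2_cmult assms)
  show "norm (m z * f z) \<le> norm (of_real M * f z)" for z
    unfolding norm_mult using assms(3)[of z] order_trans[OF norm_ge_zero assms(3)[of z]]
    by (intro mult_right_mono) auto
qed measurable

lemma L2norm_cmult: "L2norm (\<lambda>z. c * f z) = norm c * L2norm f"
  by (simp add: L2norm_def norm_mult power_mult_distrib real_sqrt_mult)

lemma L2norm_diff_commute: "L2norm (\<lambda>z. f z - g z) = L2norm (\<lambda>z. g z - f z)"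
  by (simp add: L2norm_def norm_minus_commute)

lemma L2_integrable_mult:
  assumes [measurable]: "L2 f" "L2 g" shows "integrable lborel (\<lambda>z. f z * g z)"
proof (rule Bochner_Integration.integrable_bound)
  show "integrable lborel (\<lambda>z. (norm (f z))\<^sup>2 + (norm (g z))\<^sup>2)"
    by (intro Bochner_Integration.integrable_add L2_integrable_sq assms)
  have "norm (f z) * norm (g z) \<le> (norm (f z))\<^sup>2 + (norm (g z))\<^sup>2" for z
    using sum_squares_bound[of "norm (f z)" "norm (g z)"]
      mult_nonneg_nonneg[OF norm_ge_zero[of "f z"] norm_ge_zero[of "g z"]] by linarith
  then show "AE z in lborel. norm (f z * g z) \<le> norm ((norm (f z))\<^sup>2 + (norm (g z))\<^sup>2)"
    by (auto simp: norm_mult)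
qed measurable

lemma L2_Cauchy_Schwarz:
  assumes [measurable]: "L2 f" "L2 g"
  shows "(LINT z|lborel. norm (f z) * norm (g z)) \<le> L2norm f * L2norm g"
proof -
  have i: "integrable lborel (\<lambda>z. norm (f z) * norm (g z))"
    using integrable_norm[OF L2_integrable_mult[OF assms]] by (simp add: norm_mult)
  have "(\<integral>\<^sup>+z. ennreal (norm (f z)) * ennreal (norm (g z)) \<partial>lborel)\<^sup>2
    \<le> (\<integral>\<^sup>+z. (ennreal (norm (f z)))\<^sup>2 \<partial>lborel) * (\<integral>\<^sup>+z. (ennreal (norm (g z)))\<^sup>2 \<partial>lborel)"
    by (intro Cauchy_Schwarz_nn_integral) measurable
  also have "\<dots> = nsq f * nsq g" by (simp add: nsq_def ennreal_power)
  also have "\<dots> = ennreal ((L2norm f * L2norm g)\<^sup>2)"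
    by (simp add: nsq_L2norm assms ennreal_mult power_mult_distrib)
  also have "(\<integral>\<^sup>+z. ennreal (norm (f z)) * ennreal (norm (g z)) \<partial>lborel) =
     ennreal (LINT z|lborel. norm (f z) * norm (g z))"
    by (subst nn_integral_eq_integral[OF i, symmetric]) (auto simp: ennreal_mult)
  finally have "(LINT z|lborel. norm (f z) * norm (g z))\<^sup>2 \<le> (L2norm f * L2norm g)\<^sup>2"
    by (subst (asm) ennreal_power) auto
  then show ?thesis by (rule power2_le_imp_le) simp
qed

lemma L2_Cauchy_Schwarz_norm:
  assumes "L2 f" "L2 g" shows "norm (LINT z|lborel. f z * g z) \<le> L2norm f * L2norm g"
  using integral_norm_bound[of lborel "\<lambda>z. f z * g z"] L2_Cauchy_Schwarz[OF assms]
  by (simp add: norm_mult)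

lemma L2norm_triangle:
  assumes [measurable]: "L2 f" "L2 g"
  shows "L2norm (\<lambda>z. f z + g z) \<le> L2norm f + L2norm g"
proof (rule power2_le_imp_le)
  have i: "integrable lborel (\<lambda>z. norm (f z) * norm (g z))"
    using integrable_norm[OF L2_integrable_mult[OF assms]] by (simp add: norm_mult)
  have "(L2norm (\<lambda>z. f z + g z))\<^sup>2 \<le>
      (LINT z|lborel. (norm (f z))\<^sup>2 + (norm (g z))\<^sup>2 + 2 * (norm (f z) * norm (g z)))"
    unfolding L2norm_sq
  proof (intro integral_mono)
    fix z show "(norm (f z + g z))\<^sup>2 \<le> (norm (f z))\<^sup>2 + (norm (g z))\<^sup>2 + 2 * (norm (f z) * norm (g z))"
      using power_mono[OF norm_triangle_ineq[of "f z" "g z"], of 2] by (simp add: power2_sum)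
  qed (auto intro!: L2_integrable_sq L2_add assms i)
  also have "\<dots> = (L2norm f)\<^sup>2 + (L2norm g)\<^sup>2 + 2 * (LINT z|lborel. norm (f z) * norm (g z))"
    unfolding L2norm_sq using i by (simp add: L2_integrable_sq assms)
  also have "\<dots> \<le> (L2norm f + L2norm g)\<^sup>2"
    using L2_Cauchy_Schwarz[OF assms] by (simp add: power2_sum)
  finally show "(L2norm (\<lambda>z. f z + g z))\<^sup>2 \<le> (L2norm f + L2norm g)\<^sup>2" .
qed simp

lemma L2norm_triangle_diff:
  assumes "L2 f" "L2 g" shows "L2norm f \<le> L2norm g + L2norm (\<lambda>z. f z - g z)"
  using L2norm_triangle[OF assms(2) L2_diff[OF assms]] by simp

lemma L2norm_tendsto:
  assumes "\<And>n. L2 (f n)" "L2 g" "(\<lambda>n. L2norm (\<lambda>z. f n z - g z)) \<longlonglongrightarrow> 0"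
  shows "(\<lambda>n. L2norm (f n)) \<longlonglongrightarrow> L2norm g"
proof -
  have "norm (L2norm (f n) - L2norm g) \<le> L2norm (\<lambda>z. f n z - g z)" for n
    using L2norm_triangle_diff[OF assms(1)[of n] assms(2)] L2norm_triangle_diff[OF assms(2) assms(1)[of n]]
    by (simp add: L2norm_diff_commute[of g])
  then have "(\<lambda>n. L2norm (f n) - L2norm g) \<longlonglongrightarrow> 0"
    by (intro Lim_null_comparison[OF _ assms(3)] always_eventually allI) simp
  then show ?thesis by (simp add: LIM_zero_iff)
qed

lemma L2_integral_tendsto:
  assumes "\<And>n. L2 (f n)" "L2 g" "L2 h" "(\<lambda>n. L2norm (\<lambda>z. f n z - g z)) \<longlonglongrightarrow> 0"
  shows "(\<lambda>n. LINT z|lborel. f n z * h z) \<longlonglongrightarrow> (LINT z|lborel. g z * h z)"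
proof -
  have "norm ((LINT z|lborel. f n z * h z) - (LINT z|lborel. g z * h z))
      \<le> L2norm (\<lambda>z. f n z - g z) * L2norm h" for n
  proof -
    have "(LINT z|lborel. f n z * h z) - (LINT z|lborel. g z * h z)
       = (LINT z|lborel. (f n z - g z) * h z)"
      using assms by (subst Bochner_Integration.integral_diff[symmetric])
        (auto intro!: L2_integrable_mult simp: algebra_simps)
    then show ?thesis using L2_Cauchy_Schwarz_norm[OF L2_diff[OF assms(1)[of n] assms(2)] assms(3)]
      by simp
  qed
  then have "\<forall>\<^sub>F n in sequentially. norm ((LINT z|lborel. f n z * h z) - (LINT z|lborel. g z * h z))
      \<le> L2norm (\<lambda>z. f n z - g z) * L2norm h"
    by (intro always_eventually allI)
  then have "(\<lambda>n. (LINT z|lborel. f n z * h z) - (LINT z|lborel. g z * h z)) \<longlonglongrightarrow> 0"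
    by (rule Lim_null_comparison) (rule tendsto_mult_left_zero[OF assms(4)])
  then show ?thesis by (simp add: LIM_zero_iff)
qed

lemma L2norm_dominated_tendsto:
  fixes g :: "'a::euclidean_space \<Rightarrow> complex"
  assumes "L2 g" and [measurable]: "\<And>n. f n \<in> borel_measurable borel" "h \<in> borel_measurable borel"
    and "AE z in lborel. (\<lambda>n. f n z) \<longlonglongrightarrow> h z" "\<And>n z. norm (f n z - h z) \<le> norm (g z)"
  shows "(\<lambda>n. L2norm (\<lambda>z. f n z - h z)) \<longlonglongrightarrow> 0"
proof -
  have "(\<lambda>n. LINT z|lborel. (norm (f n z - h z))\<^sup>2) \<longlonglongrightarrow> (LINT z::'a|lborel. (0::real))"
  proof (rule integral_dominated_convergence[where w="\<lambda>z. (norm (g z))\<^sup>2"])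
    show "integrable lborel (\<lambda>z. (norm (g z))\<^sup>2)" by (intro L2_integrable_sq assms)
    show "AE z in lborel. (\<lambda>n. (norm (f n z - h z))\<^sup>2) \<longlonglongrightarrow> 0"
      using assms(4)
    proof eventually_elim
      case (elim z)
      then have "(\<lambda>n. (norm (f n z - h z))\<^sup>2) \<longlonglongrightarrow> (norm (h z - h z))\<^sup>2"
        by (intro tendsto_intros)
      then show ?case by simp
    qed
    show "AE z in lborel. norm ((norm (f n z - h z))\<^sup>2) \<le> (norm (g z))\<^sup>2" for n
      using assms(5) by (auto intro!: power_mono)
  qed auto
  then have "(\<lambda>n. sqrt (LINT z|lborel. (norm (f n z - h z))\<^sup>2)) \<longlonglongrightarrow> sqrt 0"
    by (intro tendsto_real_sqrt) simp
  then show ?thesis by (simp add: L2norm_def)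
qed

text \<open>A subsequence with \<open>\<parallel>f\<^bsub>r (k+1)\<^esub> - f\<^bsub>r k\<^esub>\<parallel>\<^sup>2 \<le> 16\<^sup>-\<^sup>k\<close> satisfies
  \<open>\<Sum>k. 4\<^sup>k |f\<^bsub>r (k+1)\<^esub> - f\<^bsub>r k\<^esub>|\<^sup>2 < \<infinity>\<close> almost everywhere, hence converges there; no norm of an infinite sum is needed.\<close>

lemma L2_complete:
  assumes f: "\<And>n. L2 (f n)"
    and C: "\<And>e. 0 < e \<Longrightarrow> \<exists>N. \<forall>m\<ge>N. \<forall>n\<ge>N. L2norm (\<lambda>z. f m z - f n z) \<le> e"
  shows "\<exists>g. L2 g \<and> (\<lambda>n. L2norm (\<lambda>z. f n z - g z)) \<longlonglongrightarrow> 0"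
proof -
  have [measurable]: "f n \<in> borel_measurable borel" for n using f by (simp add: L2_iff)
  have "\<forall>k. \<exists>N. \<forall>m\<ge>N. \<forall>n\<ge>N. L2norm (\<lambda>z. f m z - f n z) \<le> (1/4)^k"
    using C by simp
  then obtain N where N: "\<And>k m n. m \<ge> N k \<Longrightarrow> n \<ge> N k \<Longrightarrow> L2norm (\<lambda>z. f m z - f n z) \<le> (1/4)^k"
    by metis
  \<comment> \<open>The sum puts both \<open>r k\<close> and \<open>r (Suc k)\<close> beyond
    \<open>N k\<close>; the summand \<open>k\<close> forces \<open>r\<close> to infinity even if all
    \<open>N i\<close> vanish.\<close>
  define r where "r k = k + (\<Sum>i\<le>k. N i)" for k
  have rN: "r k \<ge> N k" and r_ge: "r k \<ge> k" and rS: "r (Suc k) \<ge> N k" for k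
    using member_le_sum[of k "{..k}" N] by (auto simp: r_def)
  define d where "d k z = f (r (Suc k)) z - f (r k) z" for k z
  have dL: "L2 (d k)" for k unfolding d_def by (intro L2_diff f)
  have [measurable]: "d k \<in> borel_measurable borel" for k using dL by (simp add: L2_iff)
  have "nsq (d k) \<le> ennreal ((1/16)^k)" for k
  proof -
    have "(L2norm (d k))\<^sup>2 \<le> ((1/4)^k)\<^sup>2"
      using N[OF rS rN] unfolding d_def by (intro power_mono) auto
    also have "((1/4)^k)\<^sup>2 = (1/16::real)^k"
      by (simp add: power2_eq_square flip: power_mult_distrib)
    finally show ?thesis using dL by (simp add: nsq_L2norm ennreal_leI)
  qed
  then have d16: "(\<integral>\<^sup>+z. ennreal (4^k * (norm (d k z))\<^sup>2) \<partial>lborel) \<le> ennreal ((1/4)^k)" for k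
  proof -
    have "(\<integral>\<^sup>+z. ennreal (4^k * (norm (d k z))\<^sup>2) \<partial>lborel) = ennreal (4^k) * nsq (d k)"
      unfolding nsq_def by (subst nn_integral_cmult[symmetric]) (auto simp: ennreal_mult)
    also have "\<dots> \<le> ennreal (4^k) * ennreal ((1/16)^k)"
      by (intro mult_left_mono \<open>nsq (d k) \<le> _\<close>) auto
    also have "\<dots> = ennreal ((1/4)^k)"
      by (simp add: ennreal_mult[symmetric] flip: power_mult_distrib)
    finally show ?thesis .
  qed
  have "(\<integral>\<^sup>+z. (\<Sum>k. ennreal (4^k * (norm (d k z))\<^sup>2)) \<partial>lborel)
      = (\<Sum>k. (\<integral>\<^sup>+z. ennreal (4^k * (norm (d k z))\<^sup>2) \<partial>lborel))"
    by (intro nn_integral_suminf) auto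
  also have "\<dots> \<le> (\<Sum>k. ennreal ((1/4)^k))" by (intro suminf_le d16) auto
  also have "\<dots> < \<infinity>"
    by (subst suminf_ennreal2) (auto intro!: summable_geometric)
  finally have "AE z in lborel. (\<Sum>k. ennreal (4^k * (norm (d k z))\<^sup>2)) \<noteq> \<infinity>"
    by (intro nn_integral_noteq_infinite) auto
  then have conv: "AE z in lborel. convergent (\<lambda>k. f (r k) z)"
  proof eventually_elim
    case (elim z)
    define S where "S = enn2real (\<Sum>k. ennreal (4^k * (norm (d k z))\<^sup>2))"
    have Seq: "(\<Sum>k. ennreal (4^k * (norm (d k z))\<^sup>2)) = ennreal S"
      unfolding S_def using elim by (intro ennreal_enn2real[symmetric]) (auto simp: top.not_eq_extremum)
    have S0: "0 \<le> S" unfolding S_def by (rule enn2real_nonneg)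
    have "e k \<le> (\<Sum>k. e k)" for e :: "nat \<Rightarrow> ennreal" and k
      using sum_le_suminf[OF summableI, of "{k}" e] by simp
    from this[of "\<lambda>k. ennreal (4^k * (norm (d k z))\<^sup>2)"]
    have "ennreal (4^k * (norm (d k z))\<^sup>2) \<le> ennreal S" for k
      unfolding Seq .
    then have S: "4^k * (norm (d k z))\<^sup>2 \<le> S" for k
      using ennreal_le_iff[OF S0] by blast
    \<comment> \<open>Each term of the convergent series is at most its sum \<open>S\<close>; the
      root of the factor 4^k leaves the summable sequence 2^(-k).\<close>
    have bd: "norm (d k z) \<le> sqrt S * (1/2)^k" for k
    proof -
      have "(norm (d k z))\<^sup>2 \<le> S * (1/4)^k"
        using S[of k] by (simp add: field_simps)
      then have "norm (d k z) \<le> sqrt (S * (1/4)^k)" by (rule real_le_rsqrt)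
      also have "\<dots> = sqrt S * (1/2)^k"
        by (simp add: real_sqrt_mult real_sqrt_power real_sqrt_divide)
      finally show ?thesis .
    qed
    have "summable (\<lambda>k. d k z)"
      by (rule summable_comparison_test'[where g="\<lambda>k. sqrt S * (1/2)^k" and N=0])
         (use bd in \<open>auto intro!: summable_mult summable_geometric\<close>)
    then have "convergent (\<lambda>n. \<Sum>k<n. d k z)" by (simp add: summable_iff_convergent)
    moreover have "(\<Sum>k<n. d k z) = f (r n) z - f (r 0) z" for n
      unfolding d_def by (rule sum_lessThan_telescope)
    ultimately have "convergent (\<lambda>n. (f (r n) z - f (r 0) z) + f (r 0) z)"
      by (intro convergent_add) (auto simp: convergent_const)
    then show ?case by simp
  qed
  define g where "g z = lim (\<lambda>k. f (r k) z)" for z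
  have [measurable]: "g \<in> borel_measurable borel"
    unfolding g_def by (rule borel_measurable_lim_metric) auto
  have lim: "AE z in lborel. (\<lambda>k. f (r k) z) \<longlonglongrightarrow> g z"
    using conv by eventually_elim (simp add: g_def convergent_LIMSEQ_iff)
  \<comment> \<open>Fatou along the subsequence turns the Cauchy bound into a bound on the distance
    to \<open>g\<close>, for every late index of the original sequence and not only along the
    subsequence.\<close>
  have est: "nsq (\<lambda>z. f n z - g z) \<le> ennreal (e\<^sup>2)"
    if "\<forall>m\<ge>M. \<forall>n\<ge>M. L2norm (\<lambda>z. f m z - f n z) \<le> e" "n \<ge> M" for M e n
  proof -
    have "nsq (\<lambda>z. f n z - g z) = (\<integral>\<^sup>+z. liminf (\<lambda>k. ennreal ((norm (f n z - f (r k) z))\<^sup>2)) \<partial>lborel)"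
      unfolding nsq_def
    proof (intro nn_integral_cong_AE)
      show "AE z in lborel. ennreal ((norm (f n z - g z))\<^sup>2) = liminf (\<lambda>k. ennreal ((norm (f n z - f (r k) z))\<^sup>2))"
        using lim
      proof eventually_elim
        case (elim z)
        then have "(\<lambda>k. ennreal ((norm (f n z - f (r k) z))\<^sup>2)) \<longlonglongrightarrow> ennreal ((norm (f n z - g z))\<^sup>2)"
          by (intro tendsto_intros)
        from lim_imp_Liminf[OF trivial_limit_sequentially this] show ?case by (rule sym)
      qed
    qed
    also have "\<dots> \<le> liminf (\<lambda>k. nsq (\<lambda>z. f n z - f (r k) z))"
      unfolding nsq_def by (intro nn_integral_liminf) auto
    also have "\<dots> \<le> ennreal (e\<^sup>2)"
    proof (rule Liminf_le)
      have "nsq (\<lambda>z. f n z - f (r k) z) \<le> ennreal (e\<^sup>2)" if "k \<ge> M" for k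
      proof -
        have "L2norm (\<lambda>z. f n z - f (r k) z) \<le> e" using \<open>n \<ge> M\<close> that r_ge[of k] \<open>\<forall>m\<ge>M. _\<close> by auto
        then have "(L2norm (\<lambda>z. f n z - f (r k) z))\<^sup>2 \<le> e\<^sup>2" by (intro power_mono) auto
        then show ?thesis by (simp add: nsq_L2norm L2_diff f ennreal_leI)
      qed
      then show "\<forall>\<^sub>F k in sequentially. nsq (\<lambda>z. f n z - f (r k) z) \<le> ennreal (e\<^sup>2)"
        by (auto simp: eventually_sequentially)
    qed simp
    finally show ?thesis .
  qed
  obtain M1 where M1: "\<forall>m\<ge>M1. \<forall>n\<ge>M1. L2norm (\<lambda>z. f m z - f n z) \<le> 1" using C[of 1] by auto
  have "L2 (\<lambda>z. f M1 z - g z)"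
    using est[OF M1, of M1] by (auto simp: L2_iff intro: le_less_trans)
  from L2_diff[OF f[of M1] this] have gL: "L2 g" by simp
  have "(\<lambda>n. L2norm (\<lambda>z. f n z - g z)) \<longlonglongrightarrow> 0"
  proof (rule LIMSEQ_I)
    fix e :: real assume "0 < e"
    then obtain M where M: "\<forall>m\<ge>M. \<forall>n\<ge>M. L2norm (\<lambda>z. f m z - f n z) \<le> e/2" using C[of "e/2"] by auto
    have "norm (L2norm (\<lambda>z. f n z - g z) - 0) < e" if "n \<ge> M" for n
    proof -
      have "(L2norm (\<lambda>z. f n z - g z))\<^sup>2 \<le> (e/2)\<^sup>2"
        using est[OF M that] by (simp add: nsq_L2norm L2_diff f gL)
      then have "L2norm (\<lambda>z. f n z - g z) \<le> e/2"
        by (rule power2_le_imp_le) (use \<open>0 < e\<close> in simp)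
      then show ?thesis using \<open>0 < e\<close> by simp
    qed
    then show "\<exists>no. \<forall>n\<ge>no. norm (L2norm (\<lambda>z. f n z - g z) - 0) < e" by blast
  qed
  with gL show ?thesis by blast
qed

section \<open>Bounded functions with bounded support\<close>

text \<open>The dense class on which all transforms are absolutely convergent integrals. It is
  closed under multipliers bounded on the support and under restriction to slices, contains the test
  functions, and is reached from L2 by mere truncation.\<close>

definition bcs :: "('a::euclidean_space \<Rightarrow> complex) \<Rightarrow> bool" where
  "bcs f \<longleftrightarrow> f \<in> borel_measurable borel \<and> (\<exists>M. \<forall>z. norm (f z) \<le> M) \<and> (\<exists>R. \<forall>z. f z \<noteq> 0 \<longrightarrow> norm z \<le> R)"

lemma bcsE:
  assumes "bcs f"
  obtains M where "0 < M" "\<And>z. norm (f z) \<le> M" "\<And>z. f z \<noteq> 0 \<Longrightarrow> norm z \<le> M"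
proof -
  from assms obtain M R where *: "\<And>z. norm (f z) \<le> M" "\<And>z. f z \<noteq> 0 \<Longrightarrow> norm z \<le> R"
    unfolding bcs_def by blast
  show ?thesis by (rule that[of "max 1 (max M R)"]) (use * in \<open>auto simp: le_max_iff_disj\<close>)
qed

lemma bcs_measurable[measurable_dest]: "bcs f \<Longrightarrow> f \<in> borel_measurable borel"
  by (simp add: bcs_def)

lemma bcsI:
  assumes "f \<in> borel_measurable borel" "\<And>z. norm (f z) \<le> M" "\<And>z. f z \<noteq> 0 \<Longrightarrow> norm z \<le> R"
  shows "bcs f"
  using assms unfolding bcs_def by blast

lemma bcs_zero: "bcs (\<lambda>z. 0)"
  by (rule bcsI[where M=0]) auto

lemma integrable_indicator_cball[simp]: "integrable lborel (indicator (cball (a::'a::euclidean_space) r) :: 'a \<Rightarrow> real)"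
  using emeasure_lborel_cball_finite[of a r] by (simp add: integrable_indicator_iff)

lemma bcs_integrable:
  assumes [measurable]: "bcs f" shows "integrable lborel f"
proof -
  obtain M where M: "0 < M" "\<And>z. norm (f z) \<le> M" "\<And>z. f z \<noteq> 0 \<Longrightarrow> norm z \<le> M"
    using bcsE[OF assms] by metis
  show ?thesis
  proof (rule Bochner_Integration.integrable_bound)
    show "integrable lborel (\<lambda>z. M * indicator (cball 0 M) z)" by simp
    have "norm (f z) \<le> norm (M * indicator (cball 0 M) z)" for z
      using M(2)[of z] M(3)[of z] M(1) by (cases "f z = 0") auto
    then show "AE z in lborel. norm (f z) \<le> norm (M * indicator (cball 0 M) z)" by auto
  qed measurable
qed

lemma bcs_mult_bounded:
  assumes [measurable]: "bcs f" "m \<in> borel_measurable borel" and "\<And>z. f z \<noteq> 0 \<Longrightarrow> norm (m z) \<le> M"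
  shows "bcs (\<lambda>z. m z * f z)"
proof -
  obtain K where K: "0 < K" "\<And>z. norm (f z) \<le> K" "\<And>z. f z \<noteq> 0 \<Longrightarrow> norm z \<le> K"
    using bcsE[OF \<open>bcs f\<close>] by metis
  show ?thesis
  proof (rule bcsI)
    have "norm (m z) * norm (f z) \<le> \<bar>M\<bar> * K" for z
      using K(1) K(2)[of z] assms(3)[of z] by (cases "f z = 0") (auto intro!: mult_mono)
    then show "norm (m z * f z) \<le> \<bar>M\<bar> * K" for z by (simp add: norm_mult)
    show "m z * f z \<noteq> 0 \<Longrightarrow> norm z \<le> K" for z using K by auto
  qed measurable
qed

lemma bcs_mult:
  assumes "bcs f" "bcs g" shows "bcs (\<lambda>z. f z * g z)"
proof -
  obtain M where "\<And>z. norm (f z) \<le> M" using bcsE[OF assms(1)] by metis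
  then show ?thesis by (intro bcs_mult_bounded assms bcs_measurable)
qed

lemma bcs_L2: "bcs f \<Longrightarrow> L2 f"
proof -
  assume f: "bcs f"
  have "integrable lborel (\<lambda>z. norm (f z * f z))"
    using bcs_integrable[OF bcs_mult[OF f f]] by simp
  then show "L2 f" using f by (simp add: L2_def norm_mult power2_eq_square bcs_measurable)
qed

lemma bcs_cmult: "bcs f \<Longrightarrow> bcs (\<lambda>z. c * f z)"
  by (rule bcs_mult_bounded[where m="\<lambda>_. c" and M="norm c"]) auto

lemma bcs_add:
  assumes "bcs f" "bcs g" shows "bcs (\<lambda>z. f z + g z)"
proof -
  obtain K where K: "\<And>z. norm (f z) \<le> K" "\<And>z. f z \<noteq> 0 \<Longrightarrow> norm z \<le> K"
    using bcsE[OF assms(1)] by metis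
  obtain M where M: "\<And>z. norm (g z) \<le> M" "\<And>z. g z \<noteq> 0 \<Longrightarrow> norm z \<le> M"
    using bcsE[OF assms(2)] by metis
  show ?thesis
  proof (rule bcsI)
    show "(\<lambda>z. f z + g z) \<in> borel_measurable borel"
      using assms by (intro borel_measurable_add bcs_measurable)
    show "norm (f z + g z) \<le> K + M" for z
      using K(1) M(1) by (rule norm_triangle_mono)
    show "norm z \<le> max K M" if "f z + g z \<noteq> 0" for z
      using that K(2)[of z] M(2)[of z] by (cases "f z = 0") (auto simp: le_max_iff_disj)
  qed
qed

lemma bcs_cnj: "bcs f \<Longrightarrow> bcs (\<lambda>z. cnj (f z))"
  unfolding bcs_def by auto

lemma bcs_diff: "bcs f \<Longrightarrow> bcs g \<Longrightarrow> bcs (\<lambda>z. f z - g z)"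
  using bcs_add[OF _ bcs_cmult[where c="-1"], of f g] by simp

lemma bcs_sum: "(\<And>i. i \<in> I \<Longrightarrow> bcs (f i)) \<Longrightarrow> bcs (\<lambda>z. \<Sum>i\<in>I. f i z)"
  by (induction I rule: infinite_finite_induct) (auto intro!: bcs_add bcs_zero)

section \<open>Approximation in L2 by truncation\<close>

definition truncate :: "nat \<Rightarrow> ('a::euclidean_space \<Rightarrow> complex) \<Rightarrow> 'a \<Rightarrow> complex" where
  "truncate n f = (\<lambda>z. if norm z \<le> real n \<and> norm (f z) \<le> real n then f z else 0)"

lemma truncate_measurable[measurable]:
  assumes [measurable]: "f \<in> borel_measurable borel" shows "truncate n f \<in> borel_measurable borel"
  unfolding truncate_def by measurable

lemma bcs_truncate: "f \<in> borel_measurable borel \<Longrightarrow> bcs (truncate n f)"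
  by (rule bcsI[where M="real n" and R="real n"]) (auto simp: truncate_measurable, auto simp: truncate_def split: if_splits)

lemma truncate_eq: "norm z \<le> real n \<Longrightarrow> norm (f z) \<le> real n \<Longrightarrow> truncate n f z = f z"
  by (simp add: truncate_def)

lemma eventually_truncate_eq: "\<forall>\<^sub>F n in sequentially. truncate n f z = f z"
proof -
  obtain N :: nat where "max (norm z) (norm (f z)) \<le> real N" using real_arch_simple by blast
  then show ?thesis
    by (auto simp: eventually_sequentially intro!: exI[of _ N] truncate_eq)
qed

lemma truncate_tendsto_L2:
  assumes "L2 f" shows "(\<lambda>n. L2norm (\<lambda>z. truncate n f z - f z)) \<longlonglongrightarrow> 0"
proof (rule L2norm_dominated_tendsto[OF assms])
  show "AE z in lborel. (\<lambda>n. truncate n f z) \<longlonglongrightarrow> f z"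
    using eventually_truncate_eq[of f] by (intro AE_I2 tendsto_eventually) auto
  show "norm (truncate n f z - f z) \<le> norm (f z)" for n z
    by (simp add: truncate_def)
qed (use assms in \<open>auto simp: truncate_measurable L2_iff\<close>)

text \<open>The truncations of the conjugate of \<open>w\<close> are admissible test functions, and
  in the limit the pairing becomes the squared norm of \<open>w\<close>.\<close>

lemma L2_zero_AE:
  assumes w: "L2 w" and 0: "\<And>\<phi>. bcs \<phi> \<Longrightarrow> (LINT z|lborel. w z * \<phi> z) = 0"
  shows "AE z in lborel. w z = 0"
proof -
  have "(\<lambda>n. LINT z|lborel. truncate n w z * cnj (w z)) \<longlonglongrightarrow> (LINT z|lborel. w z * cnj (w z))"
    by (intro L2_integral_tendsto w L2_cnj bcs_L2 bcs_truncate truncate_tendsto_L2 L2_measurable)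
  moreover have "(LINT z|lborel. truncate n w z * cnj (w z)) = 0" for n
  proof -
    have "truncate n w z * cnj (w z) = w z * cnj (truncate n w z)" for z
      by (simp add: truncate_def)
    then show ?thesis
      using 0[OF bcs_cnj[OF bcs_truncate[OF L2_measurable[OF w], of n]]] by simp
  qed
  ultimately have "(LINT z|lborel. w z * cnj (w z)) = 0" by (simp add: LIMSEQ_const_iff)
  then have "(LINT z|lborel. (norm (w z))\<^sup>2) = 0"
    by (simp add: complex_norm_square[symmetric] flip: of_real_power)
  then have "AE z in lborel. (norm (w z))\<^sup>2 = 0"
    by (subst (asm) integral_nonneg_eq_0_iff_AE) (auto intro: L2_integrable_sq[OF w])
  then show ?thesis by simp
qed

section \<open>Extending a symmetric isometry to square-integrable functions\<close>

text \<open>The free scalar \<open>k\<close> is what allows equality of norms to be polarised to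
  equality of inner products in \<open>ext_inner\<close>.\<close>

lemma L2norm_add_cmult_sq:
  assumes "L2 f" "L2 g"
  shows "(L2norm (\<lambda>z. f z + k * g z))\<^sup>2 =
    (L2norm f)\<^sup>2 + (norm k)\<^sup>2 * (L2norm g)\<^sup>2 + 2 * Re (cnj k * (LINT z|lborel. f z * cnj (g z)))"
proof -
  have i: "integrable lborel (\<lambda>z. f z * cnj (g z))"
    by (intro L2_integrable_mult L2_cnj assms)
  have "(norm (f z + k * g z))\<^sup>2 =
      (norm (f z))\<^sup>2 + (norm k)\<^sup>2 * (norm (g z))\<^sup>2 + 2 * Re (cnj k * (f z * cnj (g z)))" for z
    by (simp add: cmod_power2) (simp add: power2_eq_square algebra_simps)
  then have "(L2norm (\<lambda>z. f z + k * g z))\<^sup>2 =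
     (LINT z|lborel. (norm (f z))\<^sup>2 + (norm k)\<^sup>2 * (norm (g z))\<^sup>2 + 2 * Re (cnj k * (f z * cnj (g z))))"
    by (simp only: L2norm_sq)
  also have "\<dots> = (LINT z|lborel. (norm (f z))\<^sup>2 + (norm k)\<^sup>2 * (norm (g z))\<^sup>2)
      + (LINT z|lborel. 2 * Re (cnj k * (f z * cnj (g z))))"
    using i assms by (intro Bochner_Integration.integral_add) (simp_all add: L2_integrable_sq del: complex_cnj_mult times_complex.sel)
  also have "(LINT z|lborel. (norm (f z))\<^sup>2 + (norm k)\<^sup>2 * (norm (g z))\<^sup>2) = (L2norm f)\<^sup>2 + (norm k)\<^sup>2 * (L2norm g)\<^sup>2"
    using assms by (simp add: L2_integrable_sq L2norm_sq)
  also have "(LINT z|lborel. 2 * Re (cnj k * (f z * cnj (g z)))) = 2 * (LINT z|lborel. Re (cnj k * (f z * cnj (g z))))"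
    by (rule integral_mult_right_zero)
  also have "(LINT z|lborel. Re (cnj k * (f z * cnj (g z)))) = Re (LINT z|lborel. cnj k * (f z * cnj (g z)))"
    using i by (intro integral_Re) simp
  finally show ?thesis by (simp only: integral_mult_right_zero)
qed

text \<open>Covers the full and the partial Fourier transforms at once; \<open>c\<close> is then a
  power of 2 pi. \<open>T_sym\<close> is bilinear, without conjugation, because this is the pairing
  by which transforms of distributions are defined.\<close>

locale L2_isometry =
  fixes T :: "('a::euclidean_space \<Rightarrow> complex) \<Rightarrow> 'a \<Rightarrow> complex" and c :: real
  assumes c_pos: "0 < c"
    and T_L2: "bcs f \<Longrightarrow> L2 (T f)"
    and T_norm: "bcs f \<Longrightarrow> L2norm (T f) = sqrt c * L2norm f"
    and T_lin: "bcs f \<Longrightarrow> bcs g \<Longrightarrow> T (\<lambda>z. f z + k * g z) = (\<lambda>z. T f z + k * T g z)"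
    and T_sym: "bcs f \<Longrightarrow> bcs g \<Longrightarrow> (LINT z|lborel. T f z * g z) = (LINT z|lborel. f z * T g z)"
begin

text \<open>Same duality as in \<open>L2_transform\<close>, but against every function in
  \<open>bcs\<close> rather than test functions only. The larger class gives uniqueness through
  \<open>L2_zero_AE\<close>, and \<open>ext_L2_transform\<close> returns to test functions at the
  end.\<close>

definition ext :: "('a \<Rightarrow> complex) \<Rightarrow> ('a \<Rightarrow> complex) \<Rightarrow> bool" where
  "ext u w \<longleftrightarrow> L2 u \<and> L2 w \<and>
     (\<forall>\<phi>. bcs \<phi> \<longrightarrow> (LINT z|lborel. w z * \<phi> z) = (LINT z|lborel. u z * T \<phi> z))"

lemma extD:
  assumes "ext u w"
  shows "L2 u" "L2 w" "bcs \<phi> \<Longrightarrow> (LINT z|lborel. w z * \<phi> z) = (LINT z|lborel. u z * T \<phi> z)"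
  using assms by (auto simp: ext_def)

lemma ext_bcs: "bcs f \<Longrightarrow> ext f (T f)"
  unfolding ext_def using T_sym by (auto intro: bcs_L2 T_L2)

lemma ext_add_cmult:
  assumes "ext u w" "ext u' w'" shows "ext (\<lambda>z. u z + k * u' z) (\<lambda>z. w z + k * w' z)"
  unfolding ext_def
proof (intro conjI allI impI)
  note L = extD[OF assms(1)] extD[OF assms(2)]
  show "L2 (\<lambda>z. u z + k * u' z)" "L2 (\<lambda>z. w z + k * w' z)"
    by (intro L2_add L2_cmult L)+
  fix \<phi> :: "'a \<Rightarrow> complex" assume \<phi>: "bcs \<phi>"
  have *: "(LINT z|lborel. (a z + k * b z) * h z) = (LINT z|lborel. a z * h z) + k * (LINT z|lborel. b z * h z)"
    if "L2 a" "L2 b" "L2 h" for a b h :: "'a \<Rightarrow> complex"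
    using that by (simp add: distrib_right mult.assoc L2_integrable_mult)
  show "(LINT z|lborel. (w z + k * w' z) * \<phi> z) = (LINT z|lborel. (u z + k * u' z) * T \<phi> z)"
    using L \<phi> by (simp add: * bcs_L2 T_L2)
qed

lemma ext_diff: "ext u w \<Longrightarrow> ext u' w' \<Longrightarrow> ext (\<lambda>z. u z - u' z) (\<lambda>z. w z - w' z)"
  using ext_add_cmult[of u w u' w' "-1"] by simp

lemma T_diff: "bcs f \<Longrightarrow> bcs g \<Longrightarrow> T (\<lambda>z. f z - g z) = (\<lambda>z. T f z - T g z)"
  using T_lin[of f g "-1"] by simp

lemma ext_unique:
  assumes "ext u w" "ext u w'" shows "AE z in lborel. w z = w' z"
proof -
  note e = ext_diff[OF assms]
  have "AE z in lborel. w z - w' z = 0"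
    by (rule L2_zero_AE[OF extD(2)[OF e]]) (use extD(3)[OF e] in simp)
  then show ?thesis by simp
qed

text \<open>The isometry turns the Cauchy sequence of truncations of \<open>u\<close> into a Cauchy
  sequence of transforms; \<open>T_sym\<close> identifies its limit with the object defined by
  duality.\<close>

lemma ext_exists_lim:
  assumes u: "L2 u"
  shows "\<exists>w. ext u w \<and> (\<lambda>n. L2norm (\<lambda>z. T (truncate n u) z - w z)) \<longlonglongrightarrow> 0"
proof -
  have b: "bcs (truncate n u)" for n by (rule bcs_truncate[OF L2_measurable[OF u]])
  note lim = truncate_tendsto_L2[OF u]
  have "\<exists>w. L2 w \<and> (\<lambda>n. L2norm (\<lambda>z. T (truncate n u) z - w z)) \<longlonglongrightarrow> 0"
  proof (rule L2_complete)
    show "L2 (T (truncate n u))" for n by (intro T_L2 b)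
    fix e :: real assume "0 < e"
    then have "0 < e / (2 * sqrt c)" using c_pos by simp
    from LIMSEQ_D[OF lim this]
    obtain N where N: "\<And>n. n \<ge> N \<Longrightarrow> L2norm (\<lambda>z. truncate n u z - u z) < e / (2 * sqrt c)" by auto
    have "L2norm (\<lambda>z. T (truncate m u) z - T (truncate n u) z) \<le> e" if "m \<ge> N" "n \<ge> N" for m n
    proof -
      have "L2norm (\<lambda>z. T (truncate m u) z - T (truncate n u) z)
         = sqrt c * L2norm (\<lambda>z. truncate m u z - truncate n u z)"
        using T_norm[OF bcs_diff[OF b b, of m n]] by (simp add: T_diff b)
      also have "L2norm (\<lambda>z. truncate m u z - truncate n u z)
          \<le> L2norm (\<lambda>z. truncate m u z - u z) + L2norm (\<lambda>z. u z - truncate n u z)"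
        using L2norm_triangle[of "\<lambda>z. truncate m u z - u z" "\<lambda>z. u z - truncate n u z"]
        by (simp add: L2_diff bcs_L2 b u)
      also have "\<dots> \<le> e / (2 * sqrt c) + e / (2 * sqrt c)"
        using N[OF that(1)] N[OF that(2)] by (simp add: L2norm_diff_commute[of u])
      finally show ?thesis using c_pos by (simp add: field_simps)
    qed
    then show "\<exists>N. \<forall>m\<ge>N. \<forall>n\<ge>N. L2norm (\<lambda>z. T (truncate m u) z - T (truncate n u) z) \<le> e" by blast
  qed
  then obtain w where w: "L2 w" "(\<lambda>n. L2norm (\<lambda>z. T (truncate n u) z - w z)) \<longlonglongrightarrow> 0" by blast
  have "(LINT z|lborel. w z * \<phi> z) = (LINT z|lborel. u z * T \<phi> z)" if \<phi>: "bcs \<phi>" for \<phi>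
  proof (rule LIMSEQ_unique)
    show "(\<lambda>n. LINT z|lborel. T (truncate n u) z * \<phi> z) \<longlonglongrightarrow> (LINT z|lborel. w z * \<phi> z)"
      by (rule L2_integral_tendsto[OF T_L2[OF b] w(1) bcs_L2[OF \<phi>] w(2)])
    show "(\<lambda>n. LINT z|lborel. T (truncate n u) z * \<phi> z) \<longlonglongrightarrow> (LINT z|lborel. u z * T \<phi> z)"
      unfolding T_sym[OF b \<phi>]
      by (rule L2_integral_tendsto[OF bcs_L2[OF b] u T_L2[OF \<phi>] lim])
  qed
  then show ?thesis using u w by (auto simp: ext_def)
qed

lemma ext_exists: "L2 u \<Longrightarrow> \<exists>w. ext u w"
  using ext_exists_lim by blast

text \<open>Uniqueness transfers the convergence from the limit that was constructed to an arbitrary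
  representative \<open>w\<close>.\<close>

lemma ext_tendsto:
  assumes "ext u w" shows "(\<lambda>n. L2norm (\<lambda>z. T (truncate n u) z - w z)) \<longlonglongrightarrow> 0"
proof -
  have b: "bcs (truncate n u)" for n by (rule bcs_truncate[OF L2_measurable[OF extD(1)[OF assms]]])
  obtain w' where w': "ext u w'" "(\<lambda>n. L2norm (\<lambda>z. T (truncate n u) z - w' z)) \<longlonglongrightarrow> 0"
    using ext_exists_lim[OF extD(1)[OF assms]] by blast
  have "L2norm (\<lambda>z. T (truncate n u) z - w' z) = L2norm (\<lambda>z. T (truncate n u) z - w z)" for n
  proof (rule L2norm_cong_AE)
    show "L2 (\<lambda>z. T (truncate n u) z - w' z)" "L2 (\<lambda>z. T (truncate n u) z - w z)"
      by (intro L2_diff T_L2 b extD(2)[OF w'(1)] extD(2)[OF assms])+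
    show "AE z in lborel. T (truncate n u) z - w' z = T (truncate n u) z - w z"
      using ext_unique[OF w'(1) assms] by eventually_elim simp
  qed
  then show ?thesis using w'(2) by simp
qed

lemma ext_norm:
  assumes "ext u w" shows "L2norm w = sqrt c * L2norm u"
proof (rule LIMSEQ_unique)
  have u: "L2 u" by (rule extD(1)[OF assms])
  have b: "bcs (truncate n u)" for n by (rule bcs_truncate[OF L2_measurable[OF u]])
  show "(\<lambda>n. L2norm (T (truncate n u))) \<longlonglongrightarrow> L2norm w"
    by (rule L2norm_tendsto[OF T_L2[OF b] extD(2)[OF assms] ext_tendsto[OF assms]])
  show "(\<lambda>n. L2norm (T (truncate n u))) \<longlonglongrightarrow> sqrt c * L2norm u"
    unfolding T_norm[OF b]
    by (intro tendsto_mult tendsto_const L2norm_tendsto bcs_L2 b u truncate_tendsto_L2)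
qed

text \<open>Polarisation: comparing the norms of \<open>w + k * w'\<close> and
  \<open>u + k * u'\<close> for k = 1 gives the real part, and for k = i the imaginary part.\<close>

lemma ext_inner:
  assumes "ext u w" "ext u' w'"
  shows "(LINT z|lborel. w z * cnj (w' z)) = of_real c * (LINT z|lborel. u z * cnj (u' z))"
proof -
  have *: "Re (cnj k * (LINT z|lborel. w z * cnj (w' z))) = c * Re (cnj k * (LINT z|lborel. u z * cnj (u' z)))"
    for k
  proof -
    have "(L2norm (\<lambda>z. w z + k * w' z))\<^sup>2 = c * (L2norm (\<lambda>z. u z + k * u' z))\<^sup>2"
      using ext_norm[OF ext_add_cmult[OF assms, of k]] c_pos by (simp add: power_mult_distrib)
    moreover have "(L2norm w)\<^sup>2 = c * (L2norm u)\<^sup>2" "(L2norm w')\<^sup>2 = c * (L2norm u')\<^sup>2"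
      using ext_norm[OF assms(1)] ext_norm[OF assms(2)] c_pos by (simp_all add: power_mult_distrib)
    moreover have "R = c * R'" if "A + n * B + 2 * R = c * (A' + n * B' + 2 * R')" "A = c * A'" "B = c * B'"
      for A B R A' B' R' n :: real
      using that by (simp add: algebra_simps)
    ultimately show ?thesis
      unfolding L2norm_add_cmult_sq[OF extD(2)[OF assms(1)] extD(2)[OF assms(2)]]
        L2norm_add_cmult_sq[OF extD(1)[OF assms(1)] extD(1)[OF assms(2)]] by blast
  qed
  show ?thesis
    using *[of 1] *[of \<i>] by (simp add: complex_eq_iff)
qed

text \<open>A weak inversion formula: by \<open>ext_inner\<close>, conjugating before and after
  \<open>T\<close> and dividing by \<open>c\<close> acts as the inverse of \<open>T\<close>. This is
  how a pairing with \<open>u\<close> is rewritten as one with its transform.\<close>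

lemma ext_inverse:
  assumes "ext u w" "bcs \<phi>"
  shows "(LINT z|lborel. u z * \<phi> z) = (LINT z|lborel. w z * cnj (T (\<lambda>z. cnj (\<phi> z)) z)) / of_real c"
  using ext_inner[OF assms(1) ext_bcs[OF bcs_cnj[OF assms(2)]]] c_pos by simp

text \<open>The preimage of \<open>w\<close> is the conjugate of the transform of the conjugate of
  \<open>w\<close>, divided by \<open>c\<close>; its duality relation is \<open>ext_inner\<close>
  read backwards.\<close>

lemma ext_surj:
  assumes w: "L2 w" shows "\<exists>u. ext u w"
proof -
  obtain w' where w': "ext (\<lambda>z. cnj (w z)) w'" using ext_exists[OF L2_cnj[OF w]] by blast
  have "(LINT z|lborel. w z * \<phi> z) = (LINT z|lborel. (1 / of_real c * cnj (w' z)) * T \<phi> z)" if "bcs \<phi>" for \<phi>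
  proof -
    have "cnj (LINT z|lborel. w' z * cnj (T \<phi> z)) = cnj (of_real c * (LINT z|lborel. cnj (w z) * cnj (\<phi> z)))"
      using ext_inner[OF w' ext_bcs[OF that]] by simp
    then have "(LINT z|lborel. cnj (w' z) * T \<phi> z) = of_real c * (LINT z|lborel. w z * \<phi> z)"
      by (simp flip: Bochner_Integration.integral_cnj)
    then show ?thesis using c_pos by (simp add: mult.assoc)
  qed
  then have "ext (\<lambda>z. 1 / of_real c * cnj (w' z)) w"
    unfolding ext_def using w L2_cmult[OF L2_cnj[OF extD(2)[OF w']], of "1 / of_real c"] by blast
  then show ?thesis by blast
qed

end

section \<open>The Fourier transform on a Euclidean space\<close>

lemma borel_measurable_fst_snd[measurable (raw)]:
  fixes f :: "'c \<Rightarrow> 'a::second_countable_topology \<times> 'b::second_countable_topology"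
  assumes "f \<in> borel_measurable M"
  shows "(\<lambda>x. fst (f x)) \<in> borel_measurable M" "(\<lambda>x. snd (f x)) \<in> borel_measurable M"
  by (rule measurable_compose[OF assms], rule borel_measurable_continuous_onI, intro continuous_intros)+

definition fourier :: "('a::euclidean_space \<Rightarrow> complex) \<Rightarrow> 'a \<Rightarrow> complex" where
  "fourier f \<xi> = (LINT y|lborel. exp (- \<i> * complex_of_real (y \<bullet> \<xi>)) * f y)"

lemma norm_exp_ii[simp]: "norm (exp (- \<i> * complex_of_real r)) = 1" "norm (exp (\<i> * complex_of_real r)) = 1"
  by (simp_all add: norm_exp_eq_Re)

lemma norm_exp_ii'[simp]: "norm (exp (- (\<i> * complex_of_real r))) = 1"
  by (simp add: norm_exp_eq_Re)

lemma integrable_exp_mult: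
  assumes "integrable lborel f" and [measurable]: "k \<in> borel_measurable borel"
  shows "integrable lborel (\<lambda>y::'a::euclidean_space. exp (\<i> * complex_of_real (k y)) * f y)"
    and "integrable lborel (\<lambda>y::'a::euclidean_space. exp (- \<i> * complex_of_real (k y)) * f y)"
proof -
  have [measurable]: "f \<in> borel_measurable borel" using assms(1) by auto
  show "integrable lborel (\<lambda>y. exp (\<i> * complex_of_real (k y)) * f y)"
    by (rule Bochner_Integration.integrable_bound[OF assms(1)]) (auto simp: norm_mult)
  show "integrable lborel (\<lambda>y. exp (- \<i> * complex_of_real (k y)) * f y)"
    by (rule Bochner_Integration.integrable_bound[OF assms(1)]) (auto simp: norm_mult)
qed

lemma fourier_measurable[measurable]:
  assumes [measurable]: "f \<in> borel_measurable borel"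
  shows "fourier f \<in> borel_measurable (borel :: 'a::euclidean_space measure)"
proof -
  have "(\<lambda>\<xi>. LINT y|lborel. exp (- \<i> * complex_of_real (y \<bullet> \<xi>)) * f y) \<in> borel_measurable borel"
    by (rule lborel.borel_measurable_lebesgue_integral) measurable
  then show ?thesis unfolding fourier_def[abs_def] .
qed

lemma fourier_bound: "norm (fourier f \<xi>) \<le> (LINT y|lborel. norm (f y))"
  unfolding fourier_def
  by (rule order_trans[OF integral_norm_bound]) (simp add: norm_mult)

lemma fourier_add_cmult:
  assumes "integrable lborel f" "integrable lborel g"
  shows "fourier (\<lambda>z. f z + k * g z) = (\<lambda>z. fourier f z + k * fourier g z)"
proof
  fix z :: 'a
  have "(LINT y|lborel. exp (- \<i> * complex_of_real (y \<bullet> z)) * (f y + k * g y)) =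
    (LINT y|lborel. exp (- \<i> * complex_of_real (y \<bullet> z)) * f y + k * (exp (- \<i> * complex_of_real (y \<bullet> z)) * g y))"
    by (simp add: algebra_simps)
  also have "\<dots> = fourier f z + k * fourier g z"
    unfolding fourier_def using integrable_exp_mult(2)[OF assms(1), of "\<lambda>y. y \<bullet> z"]
      integrable_exp_mult(2)[OF assms(2), of "\<lambda>y. y \<bullet> z"]
    by (subst Bochner_Integration.integral_add) auto
  finally show "fourier (\<lambda>z. f z + k * g z) z = fourier f z + k * fourier g z"
    unfolding fourier_def .
qed

lemma fourier_diff:
  assumes "integrable lborel f" "integrable lborel g"
  shows "fourier (\<lambda>z. f z - g z) = (\<lambda>z. fourier f z - fourier g z)"
  using fourier_add_cmult[OF assms, of "-1"] by simp

lemma integrable_kernel: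
  fixes f :: "'a::euclidean_space \<Rightarrow> complex" and g :: "'b::euclidean_space \<Rightarrow> complex"
  assumes f: "integrable lborel f" and g: "integrable lborel g"
    and [measurable]: "(\<lambda>p. k (fst p) (snd p)) \<in> borel_measurable (borel :: ('a \<times> 'b) measure)"
    and k: "\<And>x y. norm (k x y) \<le> 1"
  shows "integrable (lborel \<Otimes>\<^sub>M lborel) (\<lambda>(x, y). k x y * (f x * g y))"
proof (rule lborel_pair.Fubini_integrable)
  have [measurable]: "f \<in> borel_measurable borel" "g \<in> borel_measurable borel" using f g by auto
  show m: "(\<lambda>(x, y). k x y * (f x * g y)) \<in> borel_measurable (lborel \<Otimes>\<^sub>M lborel)"
    unfolding lborel_prod split_beta' by measurable
  have [measurable]: "(\<lambda>y. k x y) \<in> borel_measurable borel" for x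
    using measurable_compose[OF measurable_Pair[of "\<lambda>_. x" borel borel "\<lambda>y. y"] assms(3)[unfolded borel_prod[symmetric]]]
    by simp
  have gk: "integrable lborel (\<lambda>y. k x y * (f x * g y))" for x
  proof (rule Bochner_Integration.integrable_bound)
    show "integrable lborel (\<lambda>y. f x * g y)" using g by simp
    show "AE y in lborel. norm (k x y * (f x * g y)) \<le> norm (f x * g y)"
      by (simp add: norm_mult k mult_left_le_one_le)
  qed measurable
  then show "AE x in lborel. integrable lborel (\<lambda>y. case (x, y) of (x, y) \<Rightarrow> k x y * (f x * g y))"
    by simp
  show "integrable lborel (\<lambda>x. LINT y|lborel. norm (case (x, y) of (x, y) \<Rightarrow> k x y * (f x * g y)))"
  proof (rule Bochner_Integration.integrable_bound)
    show "integrable lborel (\<lambda>x. norm (f x) * (LINT y|lborel. norm (g y)))"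
      using f by simp
    have "(LINT y|lborel. norm (k x y * (f x * g y))) \<le> (LINT y|lborel. norm (f x * g y))" for x
    proof (rule integral_mono)
      show "integrable lborel (\<lambda>y. norm (k x y * (f x * g y)))" using gk by (rule integrable_norm)
      show "norm (k x y * (f x * g y)) \<le> norm (f x * g y)" for y
        by (simp add: norm_mult k mult_left_le_one_le)
    qed (use g in simp)
    then show "AE x in lborel. norm (LINT y|lborel. norm (case (x, y) of (x, y) \<Rightarrow> k x y * (f x * g y)))
       \<le> norm (norm (f x) * (LINT y|lborel. norm (g y)))"
      by (auto simp: norm_mult Bochner_Integration.integral_nonneg_AE)
    show "(\<lambda>x. LINT y|lborel. norm (case (x, y) of (x, y) \<Rightarrow> k x y * (f x * g y))) \<in> borel_measurable lborel"
      by (rule lborel.borel_measurable_lebesgue_integral) (use m in \<open>simp add: split_beta'\<close>)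
  qed
qed

text \<open>Both exp (-i x.y) and exp (i x.y) are kernels of modulus one, so the same exchange
  serves the symmetry of the transform, the Gaussian convolution and Plancherel's identity.\<close>

lemma kernel_Fubini:
  fixes f :: "'a::euclidean_space \<Rightarrow> complex" and g :: "'b::euclidean_space \<Rightarrow> complex"
  assumes "integrable lborel f" "integrable lborel g"
    and "(\<lambda>p. k (fst p) (snd p)) \<in> borel_measurable (borel :: ('a \<times> 'b) measure)"
    and "\<And>x y. norm (k x y) \<le> 1"
  shows "(LINT x|lborel. f x * (LINT y|lborel. k x y * g y)) = (LINT y|lborel. (LINT x|lborel. k x y * f x) * g y)"
proof -
  have "(LINT x|lborel. f x * (LINT y|lborel. k x y * g y)) = (LINT x|lborel. (LINT y|lborel. k x y * (f x * g y)))"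
    by (subst integral_mult_right_zero[symmetric]) (simp add: mult_ac)
  also have "\<dots> = (LINT y|lborel. (LINT x|lborel. k x y * (f x * g y)))"
    by (rule lborel_pair.Fubini_integral[symmetric]) (rule integrable_kernel[OF assms])
  also have "\<dots> = (LINT y|lborel. (LINT x|lborel. k x y * f x) * g y)"
    by (subst integral_mult_left_zero[symmetric]) (simp add: mult_ac)
  finally show ?thesis .
qed

lemma fourier_symmetric:
  assumes "integrable lborel f" "integrable lborel g"
  shows "(LINT z|lborel. fourier f z * g z) = (LINT z|lborel. f z * fourier g z)"
proof -
  have "(LINT x|lborel. f x * (LINT y|lborel. exp (- \<i> * complex_of_real (y \<bullet> x)) * g y)) =
    (LINT y|lborel. (LINT x|lborel. exp (- \<i> * complex_of_real (y \<bullet> x)) * f x) * g y)"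
    by (rule kernel_Fubini[OF assms]) auto
  then show ?thesis by (simp add: fourier_def inner_commute)
qed

lemma gauss_1d:
  assumes e: "0 < (e::real)"
  shows "integrable lborel (\<lambda>x. exp (\<i> * complex_of_real (v * x)) * complex_of_real (exp (- e * x\<^sup>2 / 2)))" (is ?I)
    and "(LINT x|lborel. exp (\<i> * complex_of_real (v * x)) * complex_of_real (exp (- e * x\<^sup>2 / 2)))
      = complex_of_real (sqrt (2 * pi / e) * exp (- v\<^sup>2 / (2 * e)))" (is "?L = _")
proof -
  define s where "s = sqrt e"
  have s: "0 < s" "s\<^sup>2 = e" using e by (auto simp: s_def)
  \<comment> \<open>For e = 1 the formula is the characteristic function of the standard normal law;
    the general case follows by the substitution x -> s x with s = sqrt e.\<close>
  have nd: "std_normal_density x = exp (- x\<^sup>2 / 2) / sqrt (2 * pi)" for x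
    by (simp add: normal_density_def)
  define F where "F x = exp (\<i> * complex_of_real ((v / s) * x)) * complex_of_real (exp (- x\<^sup>2 / 2))" for x
  have "integrable lborel (\<lambda>x. std_normal_density x)" by (rule integrable_normal_density) simp
  then have "integrable lborel (\<lambda>x. sqrt (2*pi) * std_normal_density x)" by simp
  then have "integrable lborel (\<lambda>x::real. exp (- x\<^sup>2 / 2))" by (simp add: nd)
  then have "integrable lborel (\<lambda>x::real. complex_of_real (exp (- x\<^sup>2 / 2)))"
    by (rule integrable_of_real)
  then have Fi: "integrable lborel F" unfolding F_def by (rule integrable_exp_mult) simp
  have "char std_normal_distribution (v / s) = complex_of_real (exp (- ((v / s)\<^sup>2) / 2))"
    by (simp add: char_std_normal_distribution)
  moreover have "char std_normal_distribution (v / s) = (LINT x|lborel. std_normal_density x *\<^sub>R exp (\<i> * complex_of_real (v / s * x)))"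
    unfolding char_def by (subst integral_density) (auto simp: normal_density_nonneg)
  moreover have "(LINT x|lborel. std_normal_density x *\<^sub>R exp (\<i> * complex_of_real (v / s * x))) = (LINT x|lborel. F x) / complex_of_real (sqrt (2*pi))"
    by (subst Bochner_Integration.integral_divide_zero[symmetric])
       (intro Bochner_Integration.integral_cong refl, simp add: F_def nd scaleR_conv_of_real field_simps)
  ultimately have F: "(LINT x|lborel. F x) = complex_of_real (sqrt (2*pi) * exp (- ((v / s)\<^sup>2) / 2))"
    by (simp add: field_simps)
  have Fs: "F (s * x) = exp (\<i> * complex_of_real (v * x)) * complex_of_real (exp (- e * x\<^sup>2 / 2))" for x
    using s by (simp add: F_def power_mult_distrib)
  show ?I using lborel_integrable_real_affine[OF Fi, of s 0] s(1) by (simp add: Fs)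
  have "(LINT x|lborel. F x) = \<bar>s\<bar> *\<^sub>R (LINT x|lborel. F (0 + s * x))"
    by (rule lborel_integral_real_affine) (use s in simp)
  then have "?L = (LINT x|lborel. F x) / complex_of_real s"
    using s(1) by (simp add: Fs scaleR_conv_of_real)
  also have "\<dots> = complex_of_real (sqrt (2 * pi / e) * exp (- v\<^sup>2 / (2 * e)))"
    unfolding F using s by (simp add: s_def real_sqrt_divide power_divide real_sqrt_mult)
  finally show "?L = complex_of_real (sqrt (2 * pi / e) * exp (- v\<^sup>2 / (2 * e)))" .
qed

definition gauss :: "real \<Rightarrow> 'a::euclidean_space \<Rightarrow> real" where
  "gauss e x = exp (- e * (norm x)\<^sup>2 / 2)"

lemma norm_sq_Basis: "(norm x)\<^sup>2 = (\<Sum>b\<in>Basis. (x \<bullet> b)\<^sup>2)"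
  unfolding power2_norm_eq_inner by (subst euclidean_inner) (simp add: power2_eq_square)

lemma gauss_prod:
  "exp (\<i> * complex_of_real (v \<bullet> x)) * complex_of_real (gauss e x) =
   (\<Prod>b\<in>Basis. exp (\<i> * complex_of_real ((v \<bullet> b) * (x \<bullet> b))) * complex_of_real (exp (- e * (x \<bullet> b)\<^sup>2 / 2)))"
proof -
  have "exp (\<i> * complex_of_real (v \<bullet> x)) = (\<Prod>b\<in>Basis. exp (\<i> * complex_of_real ((v \<bullet> b) * (x \<bullet> b))))"
    by (subst euclidean_inner[of v x]) (simp add: exp_sum sum_distrib_left)
  moreover have "gauss e x = (\<Prod>b\<in>Basis. exp (- e * (x \<bullet> b)\<^sup>2 / 2))"
    unfolding gauss_def norm_sq_Basis sum_distrib_left sum_divide_distrib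
    by (rule exp_sum) simp
  ultimately show ?thesis by (simp add: prod.distrib)
qed

text \<open>Lebesgue measure is a product measure in orthonormal coordinates and the Gaussian times
  an exponential factorises accordingly, so the integral is a product of one-dimensional
  ones.\<close>

lemma gauss_fourier:
  fixes v :: "'a::euclidean_space"
  assumes e: "0 < e"
  shows "integrable lborel (\<lambda>x. exp (\<i> * complex_of_real (v \<bullet> x)) * complex_of_real (gauss e x))" (is ?I)
    and "(LINT x|lborel. exp (\<i> * complex_of_real (v \<bullet> x)) * complex_of_real (gauss e x))
      = complex_of_real (sqrt (2 * pi / e) ^ DIM('a) * exp (- (norm v)\<^sup>2 / (2 * e)))" (is "?L = _")
proof -
  let ?f = "\<lambda>b x. exp (\<i> * complex_of_real ((v \<bullet> b) * x)) * complex_of_real (exp (- e * x\<^sup>2 / 2))"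
  interpret product_sigma_finite "\<lambda>b::'a. lborel :: real measure" by standard
  have [measurable]: "(\<lambda>f. \<Sum>b\<in>Basis. f b *\<^sub>R b) \<in> borel_measurable (Pi\<^sub>M Basis (\<lambda>b::'a. lborel :: real measure))"
    by measurable
  have [measurable]: "(\<lambda>x. \<Prod>b\<in>Basis. ?f b (x \<bullet> b)) \<in> borel_measurable borel" by measurable
  have eq: "(\<Prod>b\<in>Basis. ?f b ((\<Sum>b\<in>Basis. f b *\<^sub>R b) \<bullet> b)) = (\<Prod>b\<in>Basis. ?f b (f b))" for f
    by (intro prod.cong refl) simp
  have i: "integrable (Pi\<^sub>M Basis (\<lambda>b::'a. lborel :: real measure)) (\<lambda>f. \<Prod>b\<in>Basis. ?f b (f b))"
    by (rule product_integrable_prod) (simp, rule gauss_1d(1)[OF e])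
  have "integrable (distr (Pi\<^sub>M Basis (\<lambda>b::'a. lborel)) borel (\<lambda>f. \<Sum>b\<in>Basis. f b *\<^sub>R b)) (\<lambda>x. \<Prod>b\<in>Basis. ?f b (x \<bullet> b))"
    by (subst integrable_distr_eq) (use i in \<open>simp_all add: eq\<close>)
  then show ?I unfolding gauss_prod lborel_eq[where 'a='a, symmetric] .
  have "?L = (LINT x|(distr (Pi\<^sub>M Basis (\<lambda>b::'a. lborel)) borel (\<lambda>f. \<Sum>b\<in>Basis. f b *\<^sub>R b)). (\<Prod>b\<in>Basis. ?f b (x \<bullet> b)))"
    unfolding gauss_prod lborel_eq[where 'a='a, symmetric] ..
  also have "\<dots> = (LINT f|(Pi\<^sub>M Basis (\<lambda>b::'a. lborel)). (\<Prod>b\<in>Basis. ?f b (f b)))"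
    by (subst integral_distr) (simp_all add: eq)
  also have "\<dots> = (\<Prod>b\<in>Basis. (LINT x|lborel. ?f b x))"
    by (rule product_integral_prod) (simp, rule gauss_1d(1)[OF e])
  also have "\<dots> = (\<Prod>b\<in>Basis. complex_of_real (sqrt (2 * pi / e) * exp (- (v \<bullet> b)\<^sup>2 / (2 * e))))"
    by (simp only: gauss_1d(2)[OF e])
  also have "\<dots> = complex_of_real (sqrt (2 * pi / e) ^ DIM('a) * (\<Prod>b\<in>Basis. exp (- (v \<bullet> b)\<^sup>2 / (2 * e))))"
    by (simp add: prod.distrib)
  also have "(\<Prod>b\<in>Basis. exp (- (v \<bullet> b)\<^sup>2 / (2 * e))) = exp (- (norm v)\<^sup>2 / (2 * e))"
    unfolding norm_sq_Basis sum_negf[symmetric] sum_divide_distrib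
    by (rule exp_sum[symmetric]) simp
  finally show "?L = complex_of_real (sqrt (2 * pi / e) ^ DIM('a) * exp (- (norm v)\<^sup>2 / (2 * e)))" .
qed

lemma gauss_integrable:
  assumes "0 < e" shows "integrable lborel (gauss e :: 'a::euclidean_space \<Rightarrow> real)"
    "integrable lborel (\<lambda>x::'a. complex_of_real (gauss e x))"
  using gauss_fourier(1)[OF assms, of "0::'a"] by (simp_all add: complex_of_real_integrable_eq)

lemma gauss_measurable[measurable]: "gauss e \<in> borel_measurable borel"
  unfolding gauss_def[abs_def] by measurable

lemma lborel_integral_affine:
  fixes f :: "'a::euclidean_space \<Rightarrow> complex"
  assumes [measurable]: "f \<in> borel_measurable borel" and d: "0 < d"
  shows "(LINT y|lborel. f y) = of_real (d ^ DIM('a)) * (LINT s|lborel. f (t + d *\<^sub>R s))"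
proof -
  have "(LINT y|lborel. f y) = (LINT y|(density (distr lborel borel (\<lambda>x. t + d *\<^sub>R x)) (\<lambda>_. ennreal (\<bar>d\<bar>^DIM('a)))). f y)"
    using lborel_affine[of d t] d by simp
  also have "\<dots> = (LINT y|(distr lborel borel (\<lambda>x. t + d *\<^sub>R x)). (d ^ DIM('a)) *\<^sub>R f y)"
    using d by (subst integral_density) auto
  also have "\<dots> = (LINT s|lborel. (d ^ DIM('a)) *\<^sub>R f (t + d *\<^sub>R s))"
    by (subst integral_distr) auto
  finally show ?thesis by (simp add: scaleR_conv_of_real)
qed

text \<open>Fourier inversion damped by a Gaussian: Fubini moves the transform onto the kernel,
  which becomes a Gaussian of width d about x, and y = x + d s normalises it. As d tends to 0 this
  is an approximate identity.\<close>

lemma gauss_convolution: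
  fixes f :: "'a::euclidean_space \<Rightarrow> complex"
  assumes f: "integrable lborel f" and d: "0 < d"
  shows "(LINT \<xi>|lborel. exp (\<i> * complex_of_real (x \<bullet> \<xi>)) * (fourier f \<xi> * gauss (d\<^sup>2) \<xi>))
    = of_real (sqrt (2*pi) ^ DIM('a)) * (LINT s|lborel. f (x + d *\<^sub>R s) * of_real (gauss 1 s))"
proof -
  have [measurable]: "f \<in> borel_measurable borel" using f by auto
  have d2: "0 < d\<^sup>2" using d by simp
  define h where "h \<xi> = exp (\<i> * complex_of_real (x \<bullet> \<xi>)) * complex_of_real (gauss (d\<^sup>2) \<xi>)" for \<xi>
  have h: "integrable lborel h" unfolding h_def by (rule gauss_fourier(1)[OF d2])
  have *: "(LINT \<xi>|lborel. exp (- \<i> * complex_of_real (y \<bullet> \<xi>)) * h \<xi>) =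
      of_real (sqrt (2 * pi / d\<^sup>2) ^ DIM('a) * exp (- (norm (x - y))\<^sup>2 / (2 * d\<^sup>2)))" for y
  proof -
    have "(LINT \<xi>|lborel. exp (- \<i> * complex_of_real (y \<bullet> \<xi>)) * h \<xi>) =
      (LINT \<xi>|lborel. exp (\<i> * complex_of_real ((x - y) \<bullet> \<xi>)) * complex_of_real (gauss (d\<^sup>2) \<xi>))"
      unfolding h_def mult.assoc[symmetric] exp_add[symmetric]
      by (simp add: inner_diff_left algebra_simps)
    then show ?thesis by (simp only: gauss_fourier(2)[OF d2])
  qed
  have "(LINT \<xi>|lborel. exp (\<i> * complex_of_real (x \<bullet> \<xi>)) * (fourier f \<xi> * gauss (d\<^sup>2) \<xi>))
     = (LINT \<xi>|lborel. h \<xi> * (LINT y|lborel. exp (- \<i> * complex_of_real (y \<bullet> \<xi>)) * f y))"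
    by (simp add: h_def fourier_def mult_ac)
  also have "\<dots> = (LINT y|lborel. (LINT \<xi>|lborel. exp (- \<i> * complex_of_real (y \<bullet> \<xi>)) * h \<xi>) * f y)"
    by (rule kernel_Fubini[OF h f]) auto
  also have "\<dots> = (LINT y|lborel. of_real (sqrt (2 * pi / d\<^sup>2) ^ DIM('a) * exp (- (norm (x - y))\<^sup>2 / (2 * d\<^sup>2))) * f y)"
    by (simp only: *)
  also have "\<dots> = of_real (d ^ DIM('a)) * (LINT s|lborel. of_real (sqrt (2 * pi / d\<^sup>2) ^ DIM('a) *
      exp (- (norm (x - (x + d *\<^sub>R s)))\<^sup>2 / (2 * d\<^sup>2))) * f (x + d *\<^sub>R s))"
    by (rule lborel_integral_affine[OF _ d]) measurable
  also have "\<dots> = (LINT s|lborel. of_real (sqrt (2*pi) ^ DIM('a)) * (f (x + d *\<^sub>R s) * of_real (gauss 1 s)))"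
  proof (subst integral_mult_right_zero[symmetric], intro Bochner_Integration.integral_cong refl)
    fix s :: 'a
    have A: "d ^ DIM('a) * sqrt (2 * pi / d\<^sup>2) ^ DIM('a) = sqrt (2*pi) ^ DIM('a)"
      using d by (simp add: real_sqrt_divide flip: power_mult_distrib)
    have B: "exp (- (norm (x - (x + d *\<^sub>R s)))\<^sup>2 / (2 * d\<^sup>2)) = gauss 1 s"
      using d by (simp add: gauss_def power_mult_distrib)
    show "of_real (d ^ DIM('a)) * (of_real (sqrt (2 * pi / d\<^sup>2) ^ DIM('a) *
      exp (- (norm (x - (x + d *\<^sub>R s)))\<^sup>2 / (2 * d\<^sup>2))) * f (x + d *\<^sub>R s)) =
      of_real (sqrt (2*pi) ^ DIM('a)) * (f (x + d *\<^sub>R s) * of_real (gauss 1 s))"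
      unfolding A[symmetric] B[symmetric] of_real_mult by (simp only: mult_ac)
  qed
  finally show ?thesis by simp
qed

text \<open>The integral of |fourier f|^2 against a wide Gaussian is the pairing of f with a
  Gaussian average of itself. The width tends to infinity on the frequency side, where monotone
  convergence gives the norm of the transform, and to 0 on the other, where continuity of f gives
  the norm of f.\<close>

lemma plancherel_continuous:
  fixes f :: "'a::euclidean_space \<Rightarrow> complex"
  assumes f: "bcs f" and cont: "continuous_on UNIV f"
  shows "nsq (fourier f) = ennreal ((2*pi) ^ DIM('a)) * nsq f"
proof -
  let ?c = "sqrt (2*pi) ^ DIM('a)"
  have [measurable]: "f \<in> borel_measurable borel" using f by (rule bcs_measurable)
  have fi: "integrable lborel f" by (rule bcs_integrable[OF f])
  obtain M where M: "0 < M" "\<And>z. norm (f z) \<le> M" using bcsE[OF f] by metis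
  define K where "K = (LINT y|lborel. norm (f y))"
  define d where "d n = 1 / real (Suc n)" for n
  have d: "0 < d n" for n by (simp add: d_def)
  have d0: "d \<longlonglongrightarrow> 0" unfolding d_def by (rule LIMSEQ_Suc[OF lim_1_over_n])
  define J where "J n x = (LINT s|lborel. f (x + d n *\<^sub>R s) * of_real (gauss 1 s))" for n x
  have g1: "(LINT s::'a|lborel. complex_of_real (gauss 1 s)) = of_real ?c"
    using gauss_fourier(2)[of 1 "0::'a"] by simp
  have g1r: "(LINT s::'a|lborel. gauss 1 s) = ?c"
    using g1 by (simp only: integral_complex_of_real of_real_eq_iff)
  have Jlim: "(\<lambda>n. J n x) \<longlonglongrightarrow> of_real ?c * f x" for x
  proof -
    have "(\<lambda>n. J n x) \<longlonglongrightarrow> (LINT s::'a|lborel. f x * complex_of_real (gauss 1 s))"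
      unfolding J_def
    proof (rule integral_dominated_convergence[where w="\<lambda>s. M * gauss 1 s"])
      show "integrable lborel (\<lambda>s::'a. M * gauss 1 s)" using gauss_integrable(1)[where 'a='a, of 1] by simp
      show "AE s in lborel. (\<lambda>n. f (x + d n *\<^sub>R s) * of_real (gauss 1 s)) \<longlonglongrightarrow> f x * complex_of_real (gauss 1 s)"
      proof (intro AE_I2 tendsto_mult tendsto_const)
        fix s :: 'a
        have "(\<lambda>n. x + d n *\<^sub>R s) \<longlonglongrightarrow> x + 0 *\<^sub>R s" by (intro tendsto_intros d0)
        then show "(\<lambda>n. f (x + d n *\<^sub>R s)) \<longlonglongrightarrow> f x"
          using continuous_on_tendsto_compose[OF cont] by simp
      qed
      show "AE s in lborel. norm (f (x + d n *\<^sub>R s) * of_real (gauss 1 s)) \<le> M * gauss 1 s" for n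
        using M by (auto simp: norm_mult gauss_def intro!: mult_right_mono)
    qed auto
    then show ?thesis by (simp add: g1r mult.commute)
  qed
  have Jbd: "norm (J n x) \<le> M * ?c" for n x
  proof -
    have le: "norm (f (x + d n *\<^sub>R s) * of_real (gauss 1 s)) \<le> M * gauss 1 s" for s
      using M by (auto simp: norm_mult gauss_def intro!: mult_right_mono)
    have i: "integrable lborel (\<lambda>s::'a. M * gauss 1 s)" using gauss_integrable(1)[where 'a='a, of 1] by simp
    have "integrable lborel (\<lambda>s. norm (f (x + d n *\<^sub>R s) * of_real (gauss 1 s)))"
      by (rule Bochner_Integration.integrable_bound[OF i])
         (measurable, use le M(1) in \<open>auto simp: gauss_def\<close>)
    then have "(LINT s|lborel. norm (f (x + d n *\<^sub>R s) * of_real (gauss 1 s))) \<le> (LINT s::'a|lborel. M * gauss 1 s)"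
      by (rule integral_mono[OF _ i]) (rule le)
    then have "norm (J n x) \<le> (LINT s::'a|lborel. M * gauss 1 s)"
      unfolding J_def by (rule order_trans[OF integral_norm_bound])
    then show ?thesis by (simp add: g1r)
  qed
  have [measurable]: "J n \<in> borel_measurable borel" for n
    unfolding J_def[abs_def] by (rule lborel.borel_measurable_lebesgue_integral) measurable
  define I where "I n = (LINT \<xi>|lborel. (norm (fourier f \<xi>))\<^sup>2 * gauss ((d n)\<^sup>2) \<xi>)" for n
  have i1: "integrable lborel (\<lambda>\<xi>. fourier f \<xi> * complex_of_real (gauss ((d n)\<^sup>2) \<xi>))" for n
  proof (rule Bochner_Integration.integrable_bound)
    show "integrable lborel (\<lambda>\<xi>::'a. K * gauss ((d n)\<^sup>2) \<xi>)"
      using gauss_integrable(1)[where 'a='a, of "(d n)\<^sup>2"] d[of n] by simp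
    have "norm (fourier f \<xi>) \<le> \<bar>K\<bar>" for \<xi>
      using fourier_bound[of f \<xi>] unfolding K_def by linarith
    then show "AE \<xi> in lborel. norm (fourier f \<xi> * complex_of_real (gauss ((d n)\<^sup>2) \<xi>)) \<le> norm (K * gauss ((d n)\<^sup>2) \<xi>)"
      by (auto simp: norm_mult gauss_def abs_mult)
  qed measurable
  have i2: "integrable lborel (\<lambda>\<xi>. (norm (fourier f \<xi>))\<^sup>2 * gauss ((d n)\<^sup>2) \<xi>)" for n
  proof (rule Bochner_Integration.integrable_bound)
    show "integrable lborel (\<lambda>\<xi>::'a. K\<^sup>2 * gauss ((d n)\<^sup>2) \<xi>)"
      using gauss_integrable(1)[where 'a='a, of "(d n)\<^sup>2"] d[of n] by simp
    show "AE \<xi> in lborel. norm ((norm (fourier f \<xi>))\<^sup>2 * gauss ((d n)\<^sup>2) \<xi>) \<le> norm (K\<^sup>2 * gauss ((d n)\<^sup>2) \<xi>)"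
      using fourier_bound[of f] by (auto simp: gauss_def K_def intro!: mult_right_mono power_mono)
  qed measurable
  \<comment> \<open>One factor of |fourier f|^2 is opened as an integral of the conjugate of
    \<open>f\<close>; Fubini then leaves the damped inversion formula for the other factor.\<close>
  have I_eq: "complex_of_real (I n) = of_real ?c * (LINT x|lborel. J n x * cnj (f x))" for n
  proof -
    have "complex_of_real (I n) = (LINT \<xi>|lborel. complex_of_real ((norm (fourier f \<xi>))\<^sup>2 * gauss ((d n)\<^sup>2) \<xi>))"
      unfolding I_def by (rule integral_complex_of_real[symmetric])
    also have "\<dots> = (LINT \<xi>|lborel. (fourier f \<xi> * of_real (gauss ((d n)\<^sup>2) \<xi>)) *
        (LINT x|lborel. exp (\<i> * complex_of_real (x \<bullet> \<xi>)) * cnj (f x)))"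
    proof (intro Bochner_Integration.integral_cong refl)
      fix \<xi> :: 'a
      have "(LINT x|lborel. exp (\<i> * complex_of_real (x \<bullet> \<xi>)) * cnj (f x)) = cnj (fourier f \<xi>)"
        unfolding fourier_def by (simp add: exp_cnj flip: Bochner_Integration.integral_cnj)
      then show "complex_of_real ((norm (fourier f \<xi>))\<^sup>2 * gauss ((d n)\<^sup>2) \<xi>) = (fourier f \<xi> * of_real (gauss ((d n)\<^sup>2) \<xi>)) *
        (LINT x|lborel. exp (\<i> * complex_of_real (x \<bullet> \<xi>)) * cnj (f x))"
        by (simp add: complex_norm_square flip: of_real_power)
    qed
    also have "\<dots> = (LINT x|lborel. (LINT \<xi>|lborel. exp (\<i> * complex_of_real (x \<bullet> \<xi>)) * (fourier f \<xi> * of_real (gauss ((d n)\<^sup>2) \<xi>))) * cnj (f x))"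
      by (rule kernel_Fubini[OF i1]) (use fi in auto)
    also have "\<dots> = (LINT x|lborel. of_real ?c * (J n x * cnj (f x)))"
      by (simp only: gauss_convolution[OF fi d] J_def mult.assoc)
    finally show ?thesis by simp
  qed
  have "(\<lambda>n. LINT x|lborel. J n x * cnj (f x)) \<longlonglongrightarrow> (LINT x|lborel. (of_real ?c * f x) * cnj (f x))"
  proof (rule integral_dominated_convergence[where w="\<lambda>x. M * ?c * norm (f x)"])
    show "integrable lborel (\<lambda>x. M * ?c * norm (f x))" using fi by simp
    show "AE x in lborel. (\<lambda>n. J n x * cnj (f x)) \<longlonglongrightarrow> (of_real ?c * f x) * cnj (f x)"
      by (intro AE_I2 tendsto_mult Jlim tendsto_const)
    show "AE x in lborel. norm (J n x * cnj (f x)) \<le> M * ?c * norm (f x)" for n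
      using Jbd[of n] by (auto simp: norm_mult intro!: mult_right_mono)
  qed measurable
  also have "(LINT x|lborel. (of_real ?c * f x) * cnj (f x)) = of_real (?c * (L2norm f)\<^sup>2)"
  proof -
    have "(LINT x|lborel. (of_real ?c * f x) * cnj (f x)) = (LINT x|lborel. complex_of_real (?c * (norm (f x))\<^sup>2))"
      by (simp add: mult.assoc flip: complex_norm_square)
    also have "\<dots> = of_real (LINT x|lborel. ?c * (norm (f x))\<^sup>2)" by (rule integral_complex_of_real)
    finally show ?thesis by (simp add: L2norm_sq)
  qed
  finally have Ilim: "(\<lambda>n. complex_of_real (I n)) \<longlonglongrightarrow> of_real ?c * of_real (?c * (L2norm f)\<^sup>2)"
    unfolding I_eq by (intro tendsto_mult tendsto_const)
  have "(\<lambda>n. complex_of_real (I n)) \<longlonglongrightarrow> complex_of_real ((2*pi) ^ DIM('a) * (L2norm f)\<^sup>2)"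
  proof -
    have "?c * ?c = (2*pi) ^ DIM('a)" by (subst power_mult_distrib[symmetric]) simp
    then show ?thesis using Ilim
      by (simp only: of_real_mult[symmetric] mult.assoc[symmetric])
  qed
  then have "I \<longlonglongrightarrow> (2*pi) ^ DIM('a) * (L2norm f)\<^sup>2" by (simp only: tendsto_of_real_iff)
  then have "(\<lambda>n. ennreal (I n)) \<longlonglongrightarrow> ennreal ((2*pi) ^ DIM('a) * (L2norm f)\<^sup>2)"
    by (rule tendsto_ennrealI)
  moreover have "(\<lambda>n. ennreal (I n)) \<longlonglongrightarrow> nsq (fourier f)"
  proof -
    have "ennreal (I n) = (\<integral>\<^sup>+\<xi>. ennreal ((norm (fourier f \<xi>))\<^sup>2 * gauss ((d n)\<^sup>2) \<xi>) \<partial>lborel)" for n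
      unfolding I_def by (rule nn_integral_eq_integral[symmetric, OF i2]) (auto simp: gauss_def)
    moreover have "(\<lambda>n. \<integral>\<^sup>+\<xi>. ennreal ((norm (fourier f \<xi>))\<^sup>2 * gauss ((d n)\<^sup>2) \<xi>) \<partial>lborel) \<longlonglongrightarrow> nsq (fourier f)"
      unfolding nsq_def
    proof (rule nn_integral_LIMSEQ)
      \<comment> \<open>The Gaussians increase to 1 as d decreases, so monotone convergence applies
        before the transform is known to be square-integrable.\<close>
      show "incseq (\<lambda>n \<xi>. ennreal ((norm (fourier f \<xi>))\<^sup>2 * gauss ((d n)\<^sup>2) \<xi>))"
      proof (rule incseq_SucI, rule le_funI)
        fix n and \<xi> :: 'a
        have "(d (Suc n))\<^sup>2 \<le> (d n)\<^sup>2" by (intro power_mono) (auto simp: d_def field_simps)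
        then have "(d (Suc n))\<^sup>2 * (norm \<xi>)\<^sup>2 \<le> (d n)\<^sup>2 * (norm \<xi>)\<^sup>2" by (rule mult_right_mono) simp
        then show "ennreal ((norm (fourier f \<xi>))\<^sup>2 * gauss ((d n)\<^sup>2) \<xi>) \<le> ennreal ((norm (fourier f \<xi>))\<^sup>2 * gauss ((d (Suc n))\<^sup>2) \<xi>)"
          by (intro ennreal_leI mult_left_mono) (auto simp: gauss_def)
      qed
      fix \<xi> :: 'a
      have "(\<lambda>n. (norm (fourier f \<xi>))\<^sup>2 * gauss ((d n)\<^sup>2) \<xi>) \<longlonglongrightarrow> (norm (fourier f \<xi>))\<^sup>2 * gauss (0\<^sup>2) \<xi>"
        unfolding gauss_def by (intro tendsto_intros d0) simp
      then show "(\<lambda>n. ennreal ((norm (fourier f \<xi>))\<^sup>2 * gauss ((d n)\<^sup>2) \<xi>)) \<longlonglongrightarrow> ennreal ((norm (fourier f \<xi>))\<^sup>2)"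
        by (intro tendsto_ennrealI) (simp add: gauss_def)
    qed measurable
    ultimately show ?thesis by simp
  qed
  ultimately have "nsq (fourier f) = ennreal ((2*pi) ^ DIM('a) * (L2norm f)\<^sup>2)"
    using LIMSEQ_unique by blast
  then show ?thesis by (simp add: nsq_L2norm bcs_L2 f ennreal_mult)
qed

text \<open>Measurability yields continuous functions converging almost everywhere, but without
  control; bounds and supports uniform in \<open>n\<close> are imposed so that dominated convergence
  applies.\<close>

lemma bcs_continuous_approx:
  fixes f :: "'a::euclidean_space \<Rightarrow> complex"
  assumes f: "bcs f"
  obtains g M where "0 < M" "\<And>n. continuous_on UNIV (g n)" "\<And>n z. norm (g n z :: complex) \<le> M"
    "\<And>n z. g n z \<noteq> 0 \<Longrightarrow> norm z \<le> M" "AE z in lborel. (\<lambda>n. g n z) \<longlonglongrightarrow> f z"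
    "\<And>z. norm (f z) \<le> M" "\<And>z. f z \<noteq> 0 \<Longrightarrow> norm z \<le> M"
proof -
  obtain M where M: "0 < M" "\<And>z. norm (f z) \<le> M" "\<And>z. f z \<noteq> 0 \<Longrightarrow> norm z \<le> M"
    using bcsE[OF f] by metis
  have "f \<in> borel_measurable lebesgue"
    using bcs_measurable[OF f] by (simp add: measurable_completion)
  then have "f measurable_on UNIV" by (intro lebesgue_measurable_imp_measurable_on) auto
  then obtain N g where N: "negligible N" and g: "\<And>n. continuous_on UNIV (g n)"
      "\<And>x. x \<notin> N \<Longrightarrow> (\<lambda>n. g n x) \<longlonglongrightarrow> f x"
    unfolding measurable_on_def by auto
  \<comment> \<open>The nearest-point projection onto the ball of radius M is continuous and fixes
    the values of \<open>f\<close>, so it bounds the approximants without moving their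
    limit.\<close>
  define P where "P = closest_point (cball (0::complex) M)"
  have Pc: "continuous_on UNIV P" unfolding P_def
    using M(1) by (intro continuous_on_closest_point) auto
  have Pb: "norm (P w) \<le> M" for w
    using closest_point_in_set[of "cball (0::complex) M" w] M(1) by (auto simp: P_def)
  have Pid: "P w = w" if "norm w \<le> M" for w
    unfolding P_def using that by (intro closest_point_self) simp
  \<comment> \<open>Equal to 1 on the ball that carries \<open>f\<close> and 0 outside a larger one;
    off the first ball the limit is a multiple of P 0 = 0.\<close>
  define cut where "cut z = max 0 (min 1 (M + 1 - norm z))" for z :: 'a
  have cut: "0 \<le> cut z" "cut z \<le> 1" "norm z \<le> M \<Longrightarrow> cut z = 1" "cut z \<noteq> 0 \<Longrightarrow> norm z \<le> M + 1" for z
    by (auto simp: cut_def max_def min_def split: if_splits)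
  show thesis
  proof (rule that[of "M + 1" "\<lambda>n z. of_real (cut z) * P (g n z)"])
    show "0 < M + 1" using M by simp
    show "continuous_on UNIV (\<lambda>z. of_real (cut z) * P (g n z))" for n
      unfolding cut_def
      by (intro continuous_intros continuous_on_compose2[OF Pc g(1)]) auto
    show "norm (of_real (cut z) * P (g n z)) \<le> M + 1" for n z
      using mult_mono[OF cut(2)[of z] Pb[of "g n z"]] cut(1)[of z] M(1) by (simp add: norm_mult)
    show "of_real (cut z) * P (g n z) \<noteq> 0 \<Longrightarrow> norm z \<le> M + 1" for n z using cut(4)[of z] by auto
    show "norm (f z) \<le> M + 1" for z using M(2)[of z] by simp
    show "f z \<noteq> 0 \<Longrightarrow> norm z \<le> M + 1" for z using M(3)[of z] by simp
    have "AE z in lebesgue. z \<notin> N"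
      using N by (auto simp: negligible_iff_null_sets intro: AE_not_in)
    then have "AE z in lebesgue. (\<lambda>n. of_real (cut z) * P (g n z)) \<longlonglongrightarrow> f z"
    proof eventually_elim
      case (elim z)
      then have "(\<lambda>n. of_real (cut z) * P (g n z)) \<longlonglongrightarrow> of_real (cut z) * P (f z)"
        by (intro tendsto_mult tendsto_const continuous_on_tendsto_compose[OF Pc g(2)]) auto
      moreover have "of_real (cut z) * P (f z) = f z"
        using M(3)[of z] Pid[OF M(2)[of z]] cut(3)[of z] by (cases "f z = 0") auto
      ultimately show ?case by simp
    qed
    then show "AE z in lborel. (\<lambda>n. of_real (cut z) * P (g n z)) \<longlonglongrightarrow> f z"
      by (simp add: AE_completion_iff)
  qed
qed

theorem plancherel:
  fixes f :: "'a::euclidean_space \<Rightarrow> complex"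
  assumes f: "bcs f"
  shows "L2 (fourier f)" "L2norm (fourier f) = sqrt ((2*pi) ^ DIM('a)) * L2norm f"
    "nsq (fourier f) = ennreal ((2*pi) ^ DIM('a)) * nsq f"
proof -
  let ?c = "(2*pi) ^ DIM('a)"
  \<comment> \<open>Fatou alone gives one inequality. It already makes the transform continuous for
    \<open>L2norm\<close>, after which the equality for continuous functions passes to the
    limit.\<close>
  have le: "nsq (fourier f) \<le> ennreal ?c * nsq f" if f: "bcs f" for f :: "'a \<Rightarrow> complex"
  proof -
    obtain g M where g: "0 < M" "\<And>n. continuous_on UNIV (g n)" "\<And>n z. norm (g n z :: complex) \<le> M"
      "\<And>n z. g n z \<noteq> 0 \<Longrightarrow> norm z \<le> M" "AE z in lborel. (\<lambda>n. g n z) \<longlonglongrightarrow> f z"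
      "\<And>z. norm (f z) \<le> M" "\<And>z. f z \<noteq> 0 \<Longrightarrow> norm z \<le> M"
      by (rule bcs_continuous_approx[OF f]) blast
    have [measurable]: "g n \<in> borel_measurable borel" for n by (rule borel_measurable_continuous_onI[OF g(2)])
    have [measurable]: "f \<in> borel_measurable borel" by (rule bcs_measurable[OF f])
    have gb: "bcs (g n)" for n by (rule bcsI[where M=M and R=M]) (use g in auto)
    have lim: "(\<lambda>n. fourier (g n) \<xi>) \<longlonglongrightarrow> fourier f \<xi>" for \<xi>
      unfolding fourier_def
    proof (rule integral_dominated_convergence[where w="\<lambda>z. M * indicator (cball 0 M) z"])
      show "AE y in lborel. (\<lambda>n. exp (- \<i> * complex_of_real (y \<bullet> \<xi>)) * g n y) \<longlonglongrightarrow> exp (- \<i> * complex_of_real (y \<bullet> \<xi>)) * f y"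
        using g(5) by eventually_elim (intro tendsto_intros)
      have "norm (g n y) \<le> M * indicator (cball 0 M) y" for n y
        using g(3)[of n y] g(4)[of n y] by (cases "g n y = 0") (use g(1) in auto)
      then show "AE y in lborel. norm (exp (- \<i> * complex_of_real (y \<bullet> \<xi>)) * g n y) \<le> M * indicator (cball 0 M) y" for n
        by (simp add: norm_mult)
    qed auto
    have L: "(\<lambda>n. L2norm (\<lambda>z. g n z - f z)) \<longlonglongrightarrow> 0"
    proof (rule L2norm_dominated_tendsto)
      show "L2 (\<lambda>z::'a. complex_of_real (2 * M * indicator (cball 0 M) z))"
        by (intro bcs_L2 bcsI[where M="2*M" and R=M])
           (use g(1) in \<open>auto split: split_indicator_asm simp: indicator_def\<close>)
      show "norm (g n z - f z) \<le> norm (complex_of_real (2 * M * indicator (cball 0 M) z))" for n z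
      proof (cases "z \<in> cball 0 M")
        case True
        then show ?thesis using norm_triangle_ineq4[of "g n z" "f z"] g(3)[of n z] g(6)[of z] g(1) by simp
      next
        case False
        then have "g n z = 0" "f z = 0" using g(4,7) by auto
        then show ?thesis by simp
      qed
    qed (use g in auto)
    then have nf: "(\<lambda>n. L2norm (g n)) \<longlonglongrightarrow> L2norm f"
      by (intro L2norm_tendsto bcs_L2 gb f)
    have "nsq (fourier f) = (\<integral>\<^sup>+\<xi>. liminf (\<lambda>n. ennreal ((norm (fourier (g n) \<xi>))\<^sup>2)) \<partial>lborel)"
      unfolding nsq_def
    proof (rule nn_integral_cong)
      fix \<xi>
      have "(\<lambda>n. ennreal ((norm (fourier (g n) \<xi>))\<^sup>2)) \<longlonglongrightarrow> ennreal ((norm (fourier f \<xi>))\<^sup>2)"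
        by (intro tendsto_intros lim)
      from lim_imp_Liminf[OF trivial_limit_sequentially this]
      show "ennreal ((norm (fourier f \<xi>))\<^sup>2) = liminf (\<lambda>n. ennreal ((norm (fourier (g n) \<xi>))\<^sup>2))" by (rule sym)
    qed
    also have "\<dots> \<le> liminf (\<lambda>n. nsq (fourier (g n)))"
      unfolding nsq_def by (intro nn_integral_liminf) auto
    also have "(\<lambda>n. nsq (fourier (g n))) = (\<lambda>n. ennreal (?c * (L2norm (g n))\<^sup>2))"
      by (simp add: plancherel_continuous gb g(2) nsq_L2norm bcs_L2 ennreal_mult)
    also have "liminf \<dots> = ennreal (?c * (L2norm f)\<^sup>2)"
      by (intro lim_imp_Liminf tendsto_intros nf) simp
    finally show ?thesis by (simp add: nsq_L2norm bcs_L2 f ennreal_mult)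
  qed
  have L2F: "L2 (fourier f)" if f: "bcs f" for f :: "'a \<Rightarrow> complex"
    using le[OF f] bcs_L2[OF f] by (auto simp: L2_iff bcs_measurable f fourier_measurable ennreal_mult_less_top intro: le_less_trans)
  have le2: "L2norm (fourier f) \<le> sqrt ?c * L2norm f" if f: "bcs f" for f :: "'a \<Rightarrow> complex"
  proof -
    have "ennreal ((L2norm (fourier f))\<^sup>2) \<le> ennreal (?c * (L2norm f)\<^sup>2)"
      using le[OF f] by (simp add: nsq_L2norm bcs_L2 f L2F ennreal_mult)
    then have "(L2norm (fourier f))\<^sup>2 \<le> ?c * (L2norm f)\<^sup>2" by simp
    also have "\<dots> = (sqrt ?c * L2norm f)\<^sup>2" by (simp add: power_mult_distrib)
    finally show ?thesis by (rule power2_le_imp_le) simp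
  qed
  show "L2 (fourier f)" by (rule L2F[OF f])
  obtain g M where g: "0 < M" "\<And>n. continuous_on UNIV (g n)" "\<And>n z. norm (g n z :: complex) \<le> M"
    "\<And>n z. g n z \<noteq> 0 \<Longrightarrow> norm z \<le> M" "AE z in lborel. (\<lambda>n. g n z) \<longlonglongrightarrow> f z"
    "\<And>z. norm (f z) \<le> M" "\<And>z. f z \<noteq> 0 \<Longrightarrow> norm z \<le> M"
    by (rule bcs_continuous_approx[OF f]) blast
  have [measurable]: "g n \<in> borel_measurable borel" for n by (rule borel_measurable_continuous_onI[OF g(2)])
  have [measurable]: "f \<in> borel_measurable borel" by (rule bcs_measurable[OF f])
  have gb: "bcs (g n)" for n by (rule bcsI[where M=M and R=M]) (use g in auto)
  have L: "(\<lambda>n. L2norm (\<lambda>z. g n z - f z)) \<longlonglongrightarrow> 0"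
  proof (rule L2norm_dominated_tendsto)
    show "L2 (\<lambda>z::'a. complex_of_real (2 * M * indicator (cball 0 M) z))"
      by (intro bcs_L2 bcsI[where M="2*M" and R=M])
         (use g(1) in \<open>auto split: split_indicator_asm simp: indicator_def\<close>)
    show "norm (g n z - f z) \<le> norm (complex_of_real (2 * M * indicator (cball 0 M) z))" for n z
    proof (cases "z \<in> cball 0 M")
      case True
      then show ?thesis using norm_triangle_ineq4[of "g n z" "f z"] g(3)[of n z] g(6)[of z] g(1) by simp
    next
      case False
      then have "g n z = 0" "f z = 0" using g(4,7) by auto
      then show ?thesis by simp
    qed
  qed (use g in auto)
  have l1: "(\<lambda>n. sqrt ?c * L2norm (g n)) \<longlonglongrightarrow> sqrt ?c * L2norm f"
    by (intro tendsto_mult tendsto_const L2norm_tendsto bcs_L2 gb f L)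
  have l2: "sqrt ?c * L2norm (g n) = L2norm (fourier (g n))" for n
  proof -
    have "ennreal ((L2norm (fourier (g n)))\<^sup>2) = ennreal (?c * (L2norm (g n))\<^sup>2)"
      using plancherel_continuous[OF gb g(2)] by (simp add: nsq_L2norm bcs_L2 gb L2F ennreal_mult)
    then have "(L2norm (fourier (g n)))\<^sup>2 = ?c * (L2norm (g n))\<^sup>2" by simp
    also have "\<dots> = (sqrt ?c * L2norm (g n))\<^sup>2" by (simp add: power_mult_distrib)
    finally show ?thesis by simp
  qed
  have l3: "(\<lambda>n. L2norm (fourier (g n))) \<longlonglongrightarrow> L2norm (fourier f)"
  proof (intro L2norm_tendsto L2F gb f)
    have "L2norm (\<lambda>z. fourier (g n) z - fourier f z) \<le> sqrt ?c * L2norm (\<lambda>z. g n z - f z)" for n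
      using le2[OF bcs_diff[OF gb f, of n]] by (simp add: fourier_diff bcs_integrable gb f)
    then have "\<forall>\<^sub>F n in sequentially. norm (L2norm (\<lambda>z. fourier (g n) z - fourier f z)) \<le> sqrt ?c * L2norm (\<lambda>z. g n z - f z)"
      by simp
    then show "(\<lambda>n. L2norm (\<lambda>z. fourier (g n) z - fourier f z)) \<longlonglongrightarrow> 0"
      by (rule Lim_null_comparison) (rule tendsto_mult_right_zero[OF L])
  qed
  show eq: "L2norm (fourier f) = sqrt ?c * L2norm f"
    by (rule LIMSEQ_unique[OF l3 l1[unfolded l2]])
  then show "nsq (fourier f) = ennreal ?c * nsq f"
    by (simp add: nsq_L2norm L2F bcs_L2 f power_mult_distrib ennreal_mult)
qed

section \<open>Partial Fourier transforms\<close>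

lemma L2_isometry_fourier:
  "L2_isometry (fourier :: ('a::euclidean_space \<Rightarrow> complex) \<Rightarrow> _) ((2*pi) ^ DIM('a))"
  by unfold_locales
     (auto simp: plancherel fourier_add_cmult fourier_symmetric bcs_integrable)

interpretation fourier: L2_isometry "fourier :: ('a::euclidean_space \<Rightarrow> complex) \<Rightarrow> _" "(2*pi) ^ DIM('a)"
  by (rule L2_isometry_fourier)

text \<open>A relabelling of coordinates that puts the block to be transformed first; the second
  component collects all other variables. It is instantiated twice, with x^(0) and with x^(1) as the
  first block. Preservation of \<open>Basis\<close> makes it a permutation of coordinates, hence
  measure preserving.\<close>

locale splitting =
  fixes \<iota> :: "'x::euclidean_space \<times> 'y::euclidean_space \<Rightarrow> 'z::euclidean_space" and \<pi> :: "'z \<Rightarrow> 'x \<times> 'y"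
  assumes linear_\<iota>: "linear \<iota>" and \<pi>_\<iota>[simp]: "\<pi> (\<iota> p) = p" and \<iota>_\<pi>[simp]: "\<iota> (\<pi> z) = z"
    and \<iota>_inner: "\<iota> p \<bullet> \<iota> q = p \<bullet> q" and \<iota>_Basis: "\<iota> ` Basis = Basis"
begin

lemma \<iota>_measurable[measurable]: "\<iota> \<in> borel_measurable borel"
  by (intro borel_measurable_continuous_onI linear_continuous_on linear_conv_bounded_linear[THEN iffD1] linear_\<iota>)

lemma inj_\<iota>: "inj \<iota>"
  by (metis \<pi>_\<iota> injI)

lemma linear_\<pi>: "linear \<pi>"
proof (rule linearI)
  fix a b :: 'z and r :: real
  show "\<pi> (a + b) = \<pi> a + \<pi> b"
    by (metis \<pi>_\<iota> \<iota>_\<pi> linear_add[OF linear_\<iota>])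
  show "\<pi> (r *\<^sub>R a) = r *\<^sub>R \<pi> a"
    by (metis \<pi>_\<iota> \<iota>_\<pi> linear_cmul[OF linear_\<iota>])
qed

lemma \<pi>_measurable[measurable]: "\<pi> \<in> borel_measurable borel"
  by (intro borel_measurable_continuous_onI linear_continuous_on linear_conv_bounded_linear[THEN iffD1] linear_\<pi>)

lemma \<pi>_inner: "\<pi> a \<bullet> \<pi> b = a \<bullet> b"
  using \<iota>_inner[of "\<pi> a" "\<pi> b"] by simp

lemma norm_\<iota>[simp]: "norm (\<iota> p) = norm p"
  by (simp add: norm_eq_sqrt_inner \<iota>_inner)

lemma norm_\<pi>[simp]: "norm (\<pi> z) = norm z"
  by (simp add: norm_eq_sqrt_inner \<pi>_inner)

lemma norm_snd_\<pi>: "norm (snd (\<pi> z)) \<le> norm z"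
  using norm_snd_le[of "snd (\<pi> z)" "fst (\<pi> z)"] by simp

text \<open>Lebesgue measure is determined by its values on boxes, and a bijection between the bases
  carries boxes to boxes with the same side lengths.\<close>

lemma lborel_\<iota>: "distr lborel borel \<iota> = (lborel :: 'z measure)"
proof (rule lborel_eqI[symmetric])
  fix l u :: 'z assume le: "\<And>b. b \<in> Basis \<Longrightarrow> l \<bullet> b \<le> u \<bullet> b"
  have in_B: "\<iota> b \<in> Basis" if "b \<in> Basis" for b using \<iota>_Basis that by blast
  have i: "\<pi> v \<bullet> b = v \<bullet> \<iota> b" for v b using \<iota>_inner[of "\<pi> v" b] by simp
  have "p \<in> \<iota> -` box l u \<longleftrightarrow> p \<in> box (\<pi> l) (\<pi> u)" for p
    unfolding vimage_eq mem_box \<iota>_Basis[symmetric] by (auto simp: i \<iota>_inner)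
  then have "\<iota> -` box l u = box (\<pi> l) (\<pi> u)" by blast
  then have "emeasure (distr lborel borel \<iota>) (box l u) = emeasure lborel (box (\<pi> l) (\<pi> u))"
    by (subst emeasure_distr) auto
  also have "\<dots> = (\<Prod>b\<in>Basis. (\<pi> u - \<pi> l) \<bullet> b)"
    by (rule emeasure_lborel_box) (simp add: i le in_B)
  also have "(\<Prod>b\<in>Basis. (\<pi> u - \<pi> l) \<bullet> b) = (\<Prod>b\<in>Basis. (u - l) \<bullet> \<iota> b)"
    by (simp add: i inner_diff_left)
  also have "\<dots> = (\<Prod>c\<in>\<iota> ` Basis. (u - l) \<bullet> c)"
    by (subst prod.reindex) (auto intro: inj_on_subset[OF inj_\<iota>])
  finally show "emeasure (distr lborel borel \<iota>) (box l u) = ennreal (\<Prod>b\<in>Basis. (u - l) \<bullet> b)"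
    unfolding \<iota>_Basis .
qed simp

lemma nn_integral_\<iota>:
  assumes [measurable]: "f \<in> borel_measurable borel"
  shows "(\<integral>\<^sup>+z. f z \<partial>lborel) = (\<integral>\<^sup>+y. (\<integral>\<^sup>+x. f (\<iota> (x, y)) \<partial>lborel) \<partial>lborel)"
    and "(\<integral>\<^sup>+z. f z \<partial>lborel) = (\<integral>\<^sup>+x. (\<integral>\<^sup>+y. f (\<iota> (x, y)) \<partial>lborel) \<partial>lborel)"
proof -
  have *: "(\<integral>\<^sup>+z. f z \<partial>lborel) = (\<integral>\<^sup>+p. f (\<iota> p) \<partial>(lborel \<Otimes>\<^sub>M lborel))"
    unfolding lborel_prod by (subst lborel_\<iota>[symmetric], subst nn_integral_distr) auto
  have m: "(\<lambda>p. f (\<iota> p)) \<in> borel_measurable (lborel \<Otimes>\<^sub>M lborel)"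
    unfolding lborel_prod by measurable
  show "(\<integral>\<^sup>+z. f z \<partial>lborel) = (\<integral>\<^sup>+x. (\<integral>\<^sup>+y. f (\<iota> (x, y)) \<partial>lborel) \<partial>lborel)"
    unfolding * using lborel.nn_integral_fst[OF m] by simp
  show "(\<integral>\<^sup>+z. f z \<partial>lborel) = (\<integral>\<^sup>+y. (\<integral>\<^sup>+x. f (\<iota> (x, y)) \<partial>lborel) \<partial>lborel)"
    unfolding * using lborel_pair.nn_integral_snd[OF m] by simp
qed

lemma integral_\<iota>:
  fixes f :: "'z \<Rightarrow> complex"
  assumes f: "integrable lborel f"
  shows "(LINT z|lborel. f z) = (LINT y|lborel. (LINT x|lborel. f (\<iota> (x, y))))"
proof -
  have [measurable]: "f \<in> borel_measurable borel" using f by auto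
  have i: "integrable (lborel \<Otimes>\<^sub>M lborel) (\<lambda>(x, y). f (\<iota> (x, y)))"
    unfolding lborel_prod using f by (subst (asm) lborel_\<iota>[symmetric], subst (asm) integrable_distr_eq) (auto simp: split_beta')
  have "(LINT z|lborel. f z) = (LINT p|(lborel \<Otimes>\<^sub>M lborel). f (\<iota> p))"
    unfolding lborel_prod by (subst lborel_\<iota>[symmetric], subst integral_distr) auto
  also have "\<dots> = (LINT y|lborel. (LINT x|lborel. f (\<iota> (x, y))))"
    using lborel_pair.integral_snd[OF i] by (simp add: split_beta')
  finally show ?thesis .
qed

lemma slice_measurable:
  assumes [measurable]: "f \<in> borel_measurable borel"
  shows "(\<lambda>x. f (\<iota> (x, y))) \<in> borel_measurable borel" "(\<lambda>y. f (\<iota> (x, y))) \<in> borel_measurable borel"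
  using measurable_compose[OF _ measurable_compose[OF \<iota>_measurable assms]]
  by (auto intro!: borel_measurable_continuous_onI continuous_intros)

lemma bcs_slice:
  assumes f: "bcs f" shows "bcs (\<lambda>x. f (\<iota> (x, y)))"
proof -
  obtain M where M: "0 < M" "\<And>z. norm (f z) \<le> M" "\<And>z. f z \<noteq> 0 \<Longrightarrow> norm z \<le> M"
    using bcsE[OF f] by metis
  show ?thesis
  proof (rule bcsI)
    show "(\<lambda>x. f (\<iota> (x, y))) \<in> borel_measurable borel" by (intro slice_measurable bcs_measurable f)
    show "norm (f (\<iota> (x, y))) \<le> M" for x by (rule M(2))
    show "norm x \<le> M" if "f (\<iota> (x, y)) \<noteq> 0" for x
      using M(3)[OF that] norm_fst_le[of x y] by simp
  qed
qed

definition partial :: "('z \<Rightarrow> complex) \<Rightarrow> 'z \<Rightarrow> complex" where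
  "partial f z = fourier (\<lambda>x. f (\<iota> (x, snd (\<pi> z)))) (fst (\<pi> z))"

lemma partial_\<iota>: "partial f (\<iota> (\<xi>, y)) = fourier (\<lambda>x. f (\<iota> (x, y))) \<xi>"
  by (simp add: partial_def)

lemma \<iota>_Pair_measurable[measurable (raw)]:
  assumes "f \<in> borel_measurable M" "g \<in> borel_measurable M"
  shows "(\<lambda>x. \<iota> (f x, g x)) \<in> borel_measurable M"
  using borel_measurable_Pair[OF assms] by measurable

lemma partial_measurable[measurable]:
  assumes [measurable]: "f \<in> borel_measurable borel" shows "partial f \<in> borel_measurable borel"
proof -
  have "(\<lambda>z. LINT x|lborel. exp (- \<i> * complex_of_real (x \<bullet> fst (\<pi> z))) * f (\<iota> (x, snd (\<pi> z)))) \<in> borel_measurable borel"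
    by (rule lborel.borel_measurable_lebesgue_integral) measurable
  then show ?thesis unfolding partial_def[abs_def] fourier_def .
qed

lemma nsq_partial:
  assumes f: "bcs f" shows "nsq (partial f) = ennreal ((2*pi) ^ DIM('x)) * nsq f"
proof -
  have [measurable]: "f \<in> borel_measurable borel" by (rule bcs_measurable[OF f])
  have "nsq (partial f) = (\<integral>\<^sup>+y. nsq (fourier (\<lambda>x. f (\<iota> (x, y)))) \<partial>lborel)"
    unfolding nsq_def by (subst nn_integral_\<iota>(1)) (auto simp: partial_\<iota>)
  also have "\<dots> = (\<integral>\<^sup>+y. ennreal ((2*pi) ^ DIM('x)) * nsq (\<lambda>x. f (\<iota> (x, y))) \<partial>lborel)"
    by (simp only: plancherel(3)[OF bcs_slice[OF f]])
  also have "\<dots> = ennreal ((2*pi) ^ DIM('x)) * (\<integral>\<^sup>+y. nsq (\<lambda>x. f (\<iota> (x, y))) \<partial>lborel)"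
    unfolding nsq_def by (intro nn_integral_cmult) measurable
  also have "(\<integral>\<^sup>+y. nsq (\<lambda>x. f (\<iota> (x, y))) \<partial>lborel) = nsq f"
    unfolding nsq_def by (rule nn_integral_\<iota>(1)[symmetric]) measurable
  finally show ?thesis .
qed

lemma L2_partial: "bcs f \<Longrightarrow> L2 (partial f)"
  using nsq_partial[of f] bcs_L2[of f]
  by (auto simp: L2_iff bcs_measurable partial_measurable ennreal_mult_less_top)

text \<open>Plancherel and symmetry hold on each slice, where \<open>f\<close> is again in
  \<open>bcs\<close>; integrating over the slices gives them for the partial transform.\<close>

lemma L2_isometry_partial: "L2_isometry partial ((2*pi) ^ DIM('x))"
proof
  show "0 < (2*pi) ^ DIM('x)" by simp
  fix f g :: "'z \<Rightarrow> complex" assume f: "bcs f"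
  show "L2 (partial f)" by (rule L2_partial[OF f])
  have "(L2norm (partial f))\<^sup>2 = (2*pi) ^ DIM('x) * (L2norm f)\<^sup>2"
    using nsq_partial[OF f] by (simp add: nsq_L2norm L2_partial bcs_L2 f flip: ennreal_mult)
  then have "(L2norm (partial f))\<^sup>2 = (sqrt ((2*pi) ^ DIM('x)) * L2norm f)\<^sup>2"
    by (simp add: power_mult_distrib)
  then show "L2norm (partial f) = sqrt ((2*pi) ^ DIM('x)) * L2norm f"
    by (rule power2_eq_imp_eq) auto
  assume g: "bcs g"
  show "partial (\<lambda>z. f z + k * g z) = (\<lambda>z. partial f z + k * partial g z)" for k
    unfolding partial_def
    by (simp add: fourier_add_cmult[OF bcs_integrable[OF bcs_slice[OF f]] bcs_integrable[OF bcs_slice[OF g]]])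
  have "(LINT z|lborel. partial f z * g z) =
     (LINT y|lborel. (LINT x|lborel. fourier (\<lambda>x. f (\<iota> (x, y))) x * g (\<iota> (x, y))))"
    by (subst integral_\<iota>[OF L2_integrable_mult[OF L2_partial[OF f] bcs_L2[OF g]]]) (simp add: partial_\<iota>)
  also have "\<dots> = (LINT y|lborel. (LINT x|lborel. f (\<iota> (x, y)) * fourier (\<lambda>x. g (\<iota> (x, y))) x))"
    by (simp only: fourier_symmetric[OF bcs_integrable[OF bcs_slice[OF f]] bcs_integrable[OF bcs_slice[OF g]]])
  also have "\<dots> = (LINT z|lborel. f z * partial g z)"
    by (subst integral_\<iota>[OF L2_integrable_mult[OF bcs_L2[OF f] L2_partial[OF g]]]) (simp add: partial_\<iota>)
  finally show "(LINT z|lborel. partial f z * g z) = (LINT z|lborel. f z * partial g z)" .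
qed

end

sublocale splitting \<subseteq> partial: L2_isometry partial "(2*pi) ^ DIM('x)"
  by (rule L2_isometry_partial)

section \<open>Weighted norms of partial and full transforms\<close>

context splitting
begin

text \<open>Lets Plancherel be applied once more, in the remaining variables: the partial transform
  is bounded because \<open>u\<close> is bounded with bounded support in the first block.\<close>

lemma bcs_partial_slice:
  assumes u: "bcs u" shows "bcs (\<lambda>y. partial u (\<iota> (\<xi>, y)))"
proof -
  obtain M where M: "0 < M" "\<And>z. norm (u z) \<le> M" "\<And>z. u z \<noteq> 0 \<Longrightarrow> norm z \<le> M"
    using bcsE[OF u] by metis
  show ?thesis
  proof (rule bcsI)
    show "(\<lambda>y. partial u (\<iota> (\<xi>, y))) \<in> borel_measurable borel"
      by (intro slice_measurable partial_measurable bcs_measurable u)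
    show "norm (partial u (\<iota> (\<xi>, y))) \<le> (LINT x|lborel. M * indicator (cball (0::'x) M) x)" for y
    proof -
      have "norm (partial u (\<iota> (\<xi>, y))) \<le> (LINT x|lborel. norm (u (\<iota> (x, y))))"
        unfolding partial_\<iota> by (rule fourier_bound)
      also have "\<dots> \<le> (LINT x|lborel. M * indicator (cball (0::'x) M) x)"
      proof (rule integral_mono)
        show "integrable lborel (\<lambda>x. norm (u (\<iota> (x, y))))"
          by (intro integrable_norm bcs_integrable bcs_slice u)
        show "norm (u (\<iota> (x, y))) \<le> M * indicator (cball (0::'x) M) x" for x
          using M(2)[of "\<iota> (x, y)"] M(3)[of "\<iota> (x, y)"] norm_fst_le[of x y] M(1)
          by (cases "u (\<iota> (x, y)) = 0") auto
      qed simp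
      finally show ?thesis .
    qed
    show "norm y \<le> M" if "partial u (\<iota> (\<xi>, y)) \<noteq> 0" for y
    proof (rule ccontr)
      assume "\<not> norm y \<le> M"
      then have "u (\<iota> (x, y)) = 0" for x
        using M(3)[of "\<iota> (x, y)"] norm_snd_le[of y x] by fastforce
      with that show False by (simp add: partial_\<iota> fourier_def)
    qed
  qed
qed

text \<open>The exponential factorises over the two blocks, so Fubini performs the full transform in
  two stages.\<close>

lemma fourier_eq_fourier_partial:
  assumes u: "bcs u"
  shows "fourier u (\<iota> (\<xi>, \<eta>)) = fourier (\<lambda>y. partial u (\<iota> (\<xi>, y))) \<eta>"
proof -
  have "fourier u (\<iota> (\<xi>, \<eta>)) =
     (LINT y|lborel. (LINT x|lborel. exp (- \<i> * complex_of_real (\<iota> (x, y) \<bullet> \<iota> (\<xi>, \<eta>))) * u (\<iota> (x, y))))"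
    unfolding fourier_def
    by (rule integral_\<iota>) (intro integrable_exp_mult(2) bcs_integrable u, measurable)
  also have "\<dots> = (LINT y|lborel. (LINT x|lborel. exp (- \<i> * complex_of_real (y \<bullet> \<eta>)) * (exp (- \<i> * complex_of_real (x \<bullet> \<xi>)) * u (\<iota> (x, y)))))"
  proof -
    have "exp (- \<i> * complex_of_real (\<iota> (x, y) \<bullet> \<iota> (\<xi>, \<eta>))) =
        exp (- \<i> * complex_of_real (y \<bullet> \<eta>)) * exp (- \<i> * complex_of_real (x \<bullet> \<xi>))" for x y
      unfolding exp_add[symmetric] by (rule arg_cong[where f=exp]) (simp add: \<iota>_inner algebra_simps)
    then show ?thesis by (simp only: mult.assoc)
  qed
  finally show ?thesis by (simp add: partial_\<iota> fourier_def)
qed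

text \<open>The weight depends on the transformed block only, so it is constant on slices in the
  remaining variables and factors out of Plancherel there.\<close>

lemma nsq_weight_bcs:
  assumes u: "bcs u" and [measurable]: "m \<in> borel_measurable borel"
  shows "nsq (\<lambda>z. complex_of_real (m (fst (\<pi> z))) * fourier u z) =
    ennreal ((2*pi) ^ DIM('y)) * nsq (\<lambda>z. complex_of_real (m (fst (\<pi> z))) * partial u z)"
proof -
  have [measurable]: "u \<in> borel_measurable borel" by (rule bcs_measurable[OF u])
  have *: "nsq (\<lambda>z. complex_of_real (m (fst (\<pi> z))) * h z) =
     (\<integral>\<^sup>+x. ennreal ((m x)\<^sup>2) * nsq (\<lambda>y. h (\<iota> (x, y))) \<partial>lborel)"
    if [measurable]: "h \<in> borel_measurable borel" for h
  proof -
    have "nsq (\<lambda>z. complex_of_real (m (fst (\<pi> z))) * h z) =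
      (\<integral>\<^sup>+x. (\<integral>\<^sup>+y. ennreal ((norm (complex_of_real (m (fst (\<pi> (\<iota> (x, y))))) * h (\<iota> (x, y))))\<^sup>2) \<partial>lborel) \<partial>lborel)"
      unfolding nsq_def by (rule nn_integral_\<iota>(2)) measurable
    also have "\<dots> = (\<integral>\<^sup>+x. (\<integral>\<^sup>+y. ennreal ((m x)\<^sup>2) * ennreal ((norm (h (\<iota> (x, y))))\<^sup>2) \<partial>lborel) \<partial>lborel)"
      by (simp add: norm_mult power_mult_distrib ennreal_mult)
    also have "\<dots> = (\<integral>\<^sup>+x. ennreal ((m x)\<^sup>2) * nsq (\<lambda>y. h (\<iota> (x, y))) \<partial>lborel)"
      unfolding nsq_def by (intro nn_integral_cong nn_integral_cmult) measurable
    finally show ?thesis .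
  qed
  have **: "nsq (\<lambda>y. fourier u (\<iota> (x, y))) = ennreal ((2*pi) ^ DIM('y)) * nsq (\<lambda>y. partial u (\<iota> (x, y)))" for x
    unfolding fourier_eq_fourier_partial[OF u] by (rule plancherel(3)[OF bcs_partial_slice[OF u]])
  have "nsq (\<lambda>z. complex_of_real (m (fst (\<pi> z))) * fourier u z) =
     (\<integral>\<^sup>+x. ennreal ((2*pi) ^ DIM('y)) * (ennreal ((m x)\<^sup>2) * nsq (\<lambda>y. partial u (\<iota> (x, y)))) \<partial>lborel)"
    by (subst *) (measurable, simp only: ** mult.left_commute)
  also have "\<dots> = ennreal ((2*pi) ^ DIM('y)) * (\<integral>\<^sup>+x. (ennreal ((m x)\<^sup>2) * nsq (\<lambda>y. partial u (\<iota> (x, y)))) \<partial>lborel)"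
    unfolding nsq_def by (intro nn_integral_cmult) measurable
  finally show ?thesis by (simp add: * partial_measurable)
qed

text \<open>A bounded weight acts continuously on L2, so the identity passes from the truncations of
  \<open>u\<close> to \<open>u\<close>.\<close>

lemma nsq_weight_bounded:
  assumes w: "partial.ext u w" and W: "fourier.ext u W"
    and [measurable]: "m \<in> borel_measurable borel" and K: "\<And>x. \<bar>m x\<bar> \<le> K"
  shows "nsq (\<lambda>z. complex_of_real (m (fst (\<pi> z))) * W z) =
    ennreal ((2*pi) ^ DIM('y)) * nsq (\<lambda>z. complex_of_real (m (fst (\<pi> z))) * w z)"
proof -
  note u = partial.extD(1)[OF w]
  have b: "bcs (truncate n u)" for n by (rule bcs_truncate[OF L2_measurable[OF u]])
  let ?m = "\<lambda>z. complex_of_real (m (fst (\<pi> z)))"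
  have [measurable]: "?m \<in> borel_measurable borel" by measurable
  have mL: "L2 (\<lambda>z. ?m z * h z)" if "L2 h" for h
    by (rule L2_mult_bounded[OF that, where M=K]) (use K in auto)
  have lim: "(\<lambda>n. L2norm (\<lambda>z. ?m z * h n z)) \<longlonglongrightarrow> L2norm (\<lambda>z. ?m z * h' z)"
    if h: "\<And>n. L2 (h n)" "L2 h'" "(\<lambda>n. L2norm (\<lambda>z. h n z - h' z)) \<longlonglongrightarrow> 0" for h h'
  proof (intro L2norm_tendsto mL h)
    have "L2norm (\<lambda>z. ?m z * h n z - ?m z * h' z) \<le> K * L2norm (\<lambda>z. h n z - h' z)" for n
    proof -
      have "(L2norm (\<lambda>z. ?m z * (h n z - h' z)))\<^sup>2 \<le> (L2norm (\<lambda>z. of_real K * (h n z - h' z)))\<^sup>2"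
        unfolding L2norm_sq
      proof (rule integral_mono)
        show "(norm (?m z * (h n z - h' z)))\<^sup>2 \<le> (norm (of_real K * (h n z - h' z)))\<^sup>2" for z
          unfolding norm_mult using order_trans[OF K abs_ge_self]
          by (intro power_mono mult_right_mono) auto
      qed (intro L2_integrable_sq mL L2_cmult L2_diff h)+
      then have "L2norm (\<lambda>z. ?m z * (h n z - h' z)) \<le> L2norm (\<lambda>z. of_real K * (h n z - h' z))"
        by (rule power2_le_imp_le) simp
      also have "\<dots> = K * L2norm (\<lambda>z. h n z - h' z)"
        unfolding L2norm_cmult using order_trans[OF abs_ge_zero K] by simp
      finally show ?thesis by (simp add: right_diff_distrib)
    qed
    then have "\<forall>\<^sub>F n in sequentially. norm (L2norm (\<lambda>z. ?m z * h n z - ?m z * h' z)) \<le> K * L2norm (\<lambda>z. h n z - h' z)"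
      by simp
    then show "(\<lambda>n. L2norm (\<lambda>z. ?m z * h n z - ?m z * h' z)) \<longlonglongrightarrow> 0"
      by (rule Lim_null_comparison) (rule tendsto_mult_right_zero[OF h(3)])
  qed
  have l1: "(\<lambda>n. ennreal ((L2norm (\<lambda>z. ?m z * fourier (truncate n u) z))\<^sup>2)) \<longlonglongrightarrow> ennreal ((L2norm (\<lambda>z. ?m z * W z))\<^sup>2)"
    by (intro tendsto_ennrealI tendsto_power lim fourier.T_L2 b fourier.extD(2)[OF W] fourier.ext_tendsto[OF W])
  have l2: "(\<lambda>n. ennreal ((2*pi) ^ DIM('y) * (L2norm (\<lambda>z. ?m z * partial (truncate n u) z))\<^sup>2))
     \<longlonglongrightarrow> ennreal ((2*pi) ^ DIM('y) * (L2norm (\<lambda>z. ?m z * w z))\<^sup>2)"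
    by (intro tendsto_ennrealI tendsto_mult tendsto_const tendsto_power lim partial.T_L2 b partial.extD(2)[OF w] partial.ext_tendsto[OF w])
  have "ennreal ((L2norm (\<lambda>z. ?m z * fourier (truncate n u) z))\<^sup>2) =
     ennreal ((2*pi) ^ DIM('y) * (L2norm (\<lambda>z. ?m z * partial (truncate n u) z))\<^sup>2)" for n
    using nsq_weight_bcs[OF b assms(3)]
    by (simp add: nsq_L2norm mL fourier.T_L2 partial.T_L2 b ennreal_mult)
  then have "ennreal ((L2norm (\<lambda>z. ?m z * W z))\<^sup>2) = ennreal ((2*pi) ^ DIM('y) * (L2norm (\<lambda>z. ?m z * w z))\<^sup>2)"
    by (intro LIMSEQ_unique[OF l1]) (simp only: l2)
  then show ?thesis
    by (simp add: nsq_L2norm mL fourier.extD(2)[OF W] partial.extD(2)[OF w] ennreal_mult)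
qed

text \<open>The bridge between the two pictures: estimates are proved for the full transform
  \<open>W\<close>, fractional derivatives are defined by the partial transform \<open>w\<close>.
  Cutting the weight at height n and monotone convergence remove the boundedness, so the identity
  can decide whether a weighted transform is in L2 at all.\<close>

lemma nsq_weight:
  assumes w: "partial.ext u w" and W: "fourier.ext u W" and [measurable]: "m \<in> borel_measurable borel"
  shows "nsq (\<lambda>z. complex_of_real (m (fst (\<pi> z))) * W z) =
    ennreal ((2*pi) ^ DIM('y)) * nsq (\<lambda>z. complex_of_real (m (fst (\<pi> z))) * w z)"
proof -
  define t where "t n x = (if \<bar>m x\<bar> \<le> real n then m x else 0)" for n x
  have [measurable]: "t n \<in> borel_measurable borel" for n unfolding t_def by measurable
  have [measurable]: "w \<in> borel_measurable borel" "W \<in> borel_measurable borel"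
    using partial.extD(2)[OF w] fourier.extD(2)[OF W] by (auto simp: L2_iff)
  have lim: "(\<lambda>n. nsq (\<lambda>z. complex_of_real (t n (fst (\<pi> z))) * h z)) \<longlonglongrightarrow> nsq (\<lambda>z. complex_of_real (m (fst (\<pi> z))) * h z)"
    if [measurable]: "h \<in> borel_measurable borel" for h
    unfolding nsq_def
  proof (rule nn_integral_LIMSEQ)
    show "incseq (\<lambda>n z. ennreal ((norm (complex_of_real (t n (fst (\<pi> z))) * h z))\<^sup>2))"
      by (rule incseq_SucI, rule le_funI) (auto simp: t_def norm_mult)
    fix z
    obtain N :: nat where N: "\<bar>m (fst (\<pi> z))\<bar> \<le> real N" using real_arch_simple by blast
    then have "\<forall>\<^sub>F n in sequentially. ennreal ((norm (complex_of_real (t n (fst (\<pi> z))) * h z))\<^sup>2) = ennreal ((norm (complex_of_real (m (fst (\<pi> z))) * h z))\<^sup>2)"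
      unfolding eventually_sequentially by (intro exI[of _ N]) (auto simp: t_def)
    then show "(\<lambda>n. ennreal ((norm (complex_of_real (t n (fst (\<pi> z))) * h z))\<^sup>2)) \<longlonglongrightarrow> ennreal ((norm (complex_of_real (m (fst (\<pi> z))) * h z))\<^sup>2)"
      by (rule tendsto_eventually)
  qed measurable
  have "nsq (\<lambda>z. complex_of_real (t n (fst (\<pi> z))) * W z) =
    ennreal ((2*pi) ^ DIM('y)) * nsq (\<lambda>z. complex_of_real (t n (fst (\<pi> z))) * w z)" for n
    by (rule nsq_weight_bounded[OF w W, where K="real n"]) (auto simp: t_def)
  then have "(\<lambda>n. nsq (\<lambda>z. complex_of_real (t n (fst (\<pi> z))) * W z)) \<longlonglongrightarrow> ennreal ((2*pi) ^ DIM('y)) * nsq (\<lambda>z. complex_of_real (m (fst (\<pi> z))) * w z)"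
    using lim[of w] by (auto intro!: ennreal_tendsto_cmult)
  then show ?thesis using lim[of W] LIMSEQ_unique by auto
qed

end

section \<open>Test functions\<close>

lemma pdiff_eq: "(f has_derivative f') (at z) \<Longrightarrow> pdiff b f z = f' b"
  unfolding pdiff_def by (simp add: frechet_derivative_at[symmetric])

text \<open>Iterated derivatives never leave a set that is closed under derivatives, so explicit
  formulas for them are avoided; the smoothness proofs below only have to exhibit a suitable
  set.\<close>

lemma smooth_coinduct:
  assumes "f \<in> S" "\<And>g z. g \<in> S \<Longrightarrow> g differentiable (at z)"
    and "\<And>g b. g \<in> S \<Longrightarrow> b \<in> Basis \<Longrightarrow> pdiff b g \<in> S"
  shows "smooth f"
proof -
  have "foldr pdiff bs f \<in> S" if "set bs \<subseteq> Basis" for bs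
    using that by (induction bs) (auto intro: assms)
  then show ?thesis
    unfolding smooth_def differentiable_on_def using assms(2) by (auto intro: differentiable_at_withinI)
qed

lemma smooth_differentiable: "smooth f \<Longrightarrow> f differentiable (at z)"
  unfolding smooth_def differentiable_on_def by (drule spec[of _ "[]"]) auto

lemma smooth_pdiff:
  assumes "smooth f" "b \<in> Basis" shows "smooth (pdiff b f)"
  unfolding smooth_def
proof (intro allI impI)
  fix bs :: "'a list" assume "set bs \<subseteq> Basis"
  then have "set (bs @ [b]) \<subseteq> Basis" using assms(2) by simp
  then have "foldr pdiff (bs @ [b]) f differentiable_on UNIV" using assms(1) unfolding smooth_def by blast
  then show "foldr pdiff bs (pdiff b f) differentiable_on UNIV" by simp
qed

lemma smooth_has_derivative: "smooth f \<Longrightarrow> (f has_derivative (\<lambda>v. pdiff v f z)) (at z)"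
  unfolding pdiff_def using smooth_differentiable frechet_derivative_works by blast

lemma smooth_continuous: "smooth f \<Longrightarrow> continuous_on UNIV f"
  by (auto intro!: continuous_at_imp_continuous_on differentiable_imp_continuous_within smooth_differentiable)

lemma smooth_measurable: "smooth f \<Longrightarrow> f \<in> borel_measurable borel"
  by (intro borel_measurable_continuous_onI smooth_continuous)

lemma pdiff_mult:
  assumes "f differentiable (at z)" "g differentiable (at z)"
  shows "pdiff b (\<lambda>z. f z * g z) z = f z * pdiff b g z + pdiff b f z * g z"
proof (rule pdiff_eq)
  show "((\<lambda>z. f z * g z) has_derivative (\<lambda>b. f z * pdiff b g z + pdiff b f z * g z)) (at z)"
    unfolding pdiff_def using assms[unfolded frechet_derivative_works] by (rule has_derivative_mult)
qed

lemma pdiff_add: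
  assumes "f differentiable (at z)" "g differentiable (at z)"
  shows "pdiff b (\<lambda>z. f z + g z) z = pdiff b f z + pdiff b g z"
proof (rule pdiff_eq)
  show "((\<lambda>z. f z + g z) has_derivative (\<lambda>b. pdiff b f z + pdiff b g z)) (at z)"
    unfolding pdiff_def using assms[unfolded frechet_derivative_works] by (rule has_derivative_add)
qed

text \<open>The derivative of a product is a sum of two products; closing under sums gives a set
  that is stable under derivatives.\<close>

inductive_set products :: "('a::euclidean_space \<Rightarrow> complex) set" where
  "smooth f \<Longrightarrow> smooth g \<Longrightarrow> (\<lambda>z. f z * g z) \<in> products"
| "f \<in> products \<Longrightarrow> g \<in> products \<Longrightarrow> (\<lambda>z. f z + g z) \<in> products"

lemma products_differentiable: "h \<in> products \<Longrightarrow> h differentiable (at z)"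
proof (induction rule: products.induct)
  case (1 f g)
  then show ?case by (intro differentiable_mult smooth_differentiable)
next
  case (2 f g)
  then show ?case by (intro differentiable_add)
qed

lemma smooth_mult:
  assumes "smooth f" "smooth g" shows "smooth (\<lambda>z. f z * g z)"
proof (rule smooth_coinduct[of _ products])
  show "(\<lambda>z. f z * g z) \<in> products" by (intro products.intros assms)
  fix h :: "'a \<Rightarrow> complex" and b :: 'a assume "h \<in> products" "b \<in> Basis"
  then show "pdiff b h \<in> products"
  proof (induction rule: products.induct)
    case (1 f g)
    have "pdiff b (\<lambda>z. f z * g z) = (\<lambda>z. f z * pdiff b g z + pdiff b f z * g z)"
      using 1 by (intro ext pdiff_mult smooth_differentiable)
    then show ?case using 1 by (auto intro!: products.intros smooth_pdiff)
  next
    case (2 f g)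
    have "pdiff b (\<lambda>z. f z + g z) = (\<lambda>z. pdiff b f z + pdiff b g z)"
      using 2 by (intro ext pdiff_add products_differentiable)
    then show ?case using 2 by (auto intro!: products.intros)
  qed
qed (rule products_differentiable)

lemma pdiff_scale:
  assumes "smooth f"
  shows "((\<lambda>z. c * f (r *\<^sub>R z)) has_derivative (\<lambda>b. c * of_real r * pdiff b f (r *\<^sub>R z))) (at z)"
proof -
  note d = smooth_has_derivative[OF assms, of "r *\<^sub>R z"]
  have "((\<lambda>z. f (r *\<^sub>R z)) has_derivative (\<lambda>b. pdiff (r *\<^sub>R b) f (r *\<^sub>R z))) (at z)"
    by (rule has_derivative_compose[OF has_derivative_scaleR_right[OF has_derivative_ident] d])
  then have "((\<lambda>z. c * f (r *\<^sub>R z)) has_derivative (\<lambda>b. c * pdiff (r *\<^sub>R b) f (r *\<^sub>R z))) (at z)"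
    by (rule has_derivative_mult_right)
  moreover have "pdiff (r *\<^sub>R b) f (r *\<^sub>R z) = of_real r * pdiff b f (r *\<^sub>R z)" for b
    using linear_scale[OF has_derivative_linear[OF d]] by (simp add: scaleR_conv_of_real)
  ultimately show ?thesis by (simp add: mult.assoc)
qed

lemma smooth_scale:
  assumes "smooth f" shows "smooth (\<lambda>z. f (r *\<^sub>R z))"
proof (rule smooth_coinduct)
  show "(\<lambda>z. f (r *\<^sub>R z)) \<in> {\<lambda>z. c * g (r *\<^sub>R z) | c g. smooth g}"
    using assms by (auto intro!: exI[of _ 1])
  show "g differentiable at z" if "g \<in> {\<lambda>z. c * g (r *\<^sub>R z) | c g. smooth g}" for g z
    using that pdiff_scale unfolding differentiable_def by blast
  show "pdiff b g \<in> {\<lambda>z. c * g (r *\<^sub>R z) | c g. smooth g}"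
    if g: "g \<in> {\<lambda>z. c * g (r *\<^sub>R z) | c g. smooth g}" and b: "b \<in> Basis" for g b
  proof -
    obtain c h where h: "g = (\<lambda>z. c * h (r *\<^sub>R z))" "smooth h" using g by blast
    have "pdiff b g = (\<lambda>z. c * of_real r * pdiff b h (r *\<^sub>R z))"
      unfolding h(1) by (intro ext pdiff_eq pdiff_scale h)
    then show ?thesis using smooth_pdiff[OF h(2) b] by blast
  qed
qed

lemma has_derivative_exp_ii:
  "((\<lambda>z. c * exp (- \<i> * complex_of_real (z \<bullet> \<zeta>))) has_derivative
     (\<lambda>b. c * (- \<i> * of_real (b \<bullet> \<zeta>)) * exp (- \<i> * complex_of_real (z \<bullet> \<zeta>)))) (at z)"
proof -
  have "((\<lambda>z. - \<i> * complex_of_real (z \<bullet> \<zeta>)) has_derivative (\<lambda>b. - \<i> * complex_of_real (b \<bullet> \<zeta>))) (at z)"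
    by (intro has_derivative_mult_right has_derivative_of_real has_derivative_inner_left has_derivative_ident)
  from has_derivative_compose[OF this DERIV_exp[unfolded has_field_derivative_def]]
  have "((\<lambda>z. exp (- \<i> * complex_of_real (z \<bullet> \<zeta>))) has_derivative
     (\<lambda>b. (- \<i> * of_real (b \<bullet> \<zeta>)) * exp (- \<i> * complex_of_real (z \<bullet> \<zeta>)))) (at z)"
    by (simp add: mult_ac)
  from has_derivative_mult_right[OF this, of c] show ?thesis by (simp only: mult.assoc)
qed

lemma smooth_exp_ii: "smooth (\<lambda>z. exp (- \<i> * complex_of_real (z \<bullet> \<zeta>)))"
proof (rule smooth_coinduct)
  let ?S = "{\<lambda>z. c * exp (- \<i> * complex_of_real (z \<bullet> \<zeta>)) | c. True}"
  show "(\<lambda>z. exp (- \<i> * complex_of_real (z \<bullet> \<zeta>))) \<in> ?S"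
    by (auto intro!: exI[of _ 1])
  show "g differentiable at z" if "g \<in> ?S" for g z
    using that has_derivative_exp_ii unfolding differentiable_def by blast
  show "pdiff b g \<in> ?S" if g: "g \<in> ?S" and "b \<in> Basis" for g b
  proof -
    obtain c where c: "g = (\<lambda>z. c * exp (- \<i> * complex_of_real (z \<bullet> \<zeta>)))" using g by blast
    have "pdiff b g = (\<lambda>z. c * (- \<i> * of_real (b \<bullet> \<zeta>)) * exp (- \<i> * complex_of_real (z \<bullet> \<zeta>)))"
      unfolding c by (intro ext pdiff_eq has_derivative_exp_ii)
    then show ?thesis by blast
  qed
qed

lemma test_funI:
  assumes "smooth f" "\<And>z. f z \<noteq> 0 \<Longrightarrow> norm z \<le> R" shows "test_fun f"
proof -
  have "bounded {z. f z \<noteq> 0}" using assms(2) by (auto simp: bounded_iff)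
  then show ?thesis unfolding test_fun_def using assms(1) by (simp add: compact_closure)
qed

lemma test_funE:
  assumes "test_fun f"
  obtains R where "\<And>z. f z \<noteq> 0 \<Longrightarrow> norm z \<le> R"
proof -
  have "bounded (closure {z. f z \<noteq> 0})" using assms unfolding test_fun_def by (intro compact_imp_bounded) simp
  then have "bounded {z. f z \<noteq> 0}" by (rule bounded_subset[OF _ closure_subset])
  then obtain R where "\<forall>z\<in>{z. f z \<noteq> 0}. norm z \<le> R" unfolding bounded_iff by blast
  then show thesis by (intro that[of R]) auto
qed

lemma test_fun_smooth: "test_fun f \<Longrightarrow> smooth f"
  by (simp add: test_fun_def)

lemma test_fun_bcs:
  assumes f: "test_fun f" shows "bcs f"
proof -
  obtain R where R: "\<And>z. f z \<noteq> 0 \<Longrightarrow> norm z \<le> R" using test_funE[OF f] by blast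
  have "compact (f ` closure {z. f z \<noteq> 0})"
    using f unfolding test_fun_def
    by (intro compact_continuous_image continuous_on_subset[OF smooth_continuous]) auto
  then have "bounded (f ` closure {z. f z \<noteq> 0})" by (rule compact_imp_bounded)
  then obtain M where "\<forall>w\<in>f ` closure {z. f z \<noteq> 0}. norm w \<le> M" unfolding bounded_iff by blast
  then have M: "\<And>z. z \<in> closure {z. f z \<noteq> 0} \<Longrightarrow> norm (f z) \<le> M" by simp
  have "norm (f z) \<le> max M 0" for z
    using M[of z] closure_subset[of "{z. f z \<noteq> 0}"] by (cases "f z = 0") (auto simp: le_max_iff_disj)
  then show ?thesis
    by (intro bcsI[OF smooth_measurable[OF test_fun_smooth[OF f]] _ R])
qed

lemma test_fun_pdiff:
  assumes f: "test_fun f" and b: "b \<in> Basis" shows "test_fun (pdiff b f)"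
proof -
  obtain R where R: "\<And>z. f z \<noteq> 0 \<Longrightarrow> norm z \<le> R" using test_funE[OF f] by blast
  show ?thesis
  proof (rule test_funI)
    show "smooth (pdiff b f)" by (intro smooth_pdiff test_fun_smooth f b)
    show "norm z \<le> R" if "pdiff b f z \<noteq> 0" for z
    proof (rule ccontr)
      assume "\<not> norm z \<le> R"
      then have z: "z \<in> - cball 0 R" by simp
      have "((\<lambda>_. 0) has_derivative (\<lambda>_. 0)) (at z)" by simp
      then have "(f has_derivative (\<lambda>_. 0)) (at z)"
        by (rule has_derivative_transform_within_open[OF _ _ z]) (use R in auto)
      then show False using pdiff_eq[of f "\<lambda>_. 0" z b] that by simp
    qed
  qed
qed

lemma test_fun_mult:
  assumes "smooth f" "test_fun g" shows "test_fun (\<lambda>z. f z * g z)"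
proof -
  obtain R where R: "\<And>z. g z \<noteq> 0 \<Longrightarrow> norm z \<le> R" using test_funE[OF assms(2)] by blast
  show ?thesis by (rule test_funI[OF smooth_mult[OF assms(1) test_fun_smooth[OF assms(2)]], of R]) (use R in auto)
qed

lemma test_fun_scale:
  assumes f: "test_fun f" and r: "0 < r" shows "test_fun (\<lambda>z. f (r *\<^sub>R z))"
proof -
  obtain R where R: "\<And>z. f z \<noteq> 0 \<Longrightarrow> norm z \<le> R" using test_funE[OF f] by blast
  show ?thesis
  proof (rule test_funI)
    show "smooth (\<lambda>z. f (r *\<^sub>R z))" by (intro smooth_scale test_fun_smooth f)
    show "f (r *\<^sub>R z) \<noteq> 0 \<Longrightarrow> norm z \<le> R / r" for z
      using R[of "r *\<^sub>R z"] r by (simp add: field_simps)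
  qed
qed

subsection \<open>A bump function\<close>

text \<open>The classical flat function exp (-1/x) with a polynomial in 1/x in front; the polynomial
  is carried along because derivatives stay in this family.\<close>

definition expinv :: "real poly \<Rightarrow> real \<Rightarrow> real" where
  "expinv p x = (if 0 < x then poly p (1 / x) * exp (- (1 / x)) else 0)"

lemma poly_exp_tendsto_0: "((\<lambda>y. poly p y * exp (- y)) \<longlongrightarrow> 0) (at_top :: real filter)"
proof -
  have "((\<lambda>y. \<Sum>i\<le>degree p. coeff p i * (y ^ i / exp y)) \<longlongrightarrow> (\<Sum>i\<le>degree p. coeff p i * 0)) (at_top :: real filter)"
    by (intro tendsto_intros tendsto_power_div_exp_0)
  moreover have "(\<Sum>i\<le>degree p. coeff p i * (y ^ i / exp y)) = poly p y * exp (- y)" for y :: real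
    by (simp add: poly_altdef sum_distrib_right exp_minus field_simps sum_divide_distrib)
  ultimately show ?thesis by simp
qed

lemma expinv_tendsto_0: "(expinv p \<longlongrightarrow> 0) (at 0)"
proof (rule filterlim_split_at)
  show "(expinv p \<longlongrightarrow> 0) (at_left 0)"
    by (rule tendsto_eventually) (auto simp: expinv_def eventually_at_filter)
  have "((\<lambda>x. poly p (inverse x) * exp (- inverse x)) \<longlongrightarrow> 0) (at_right (0::real))"
    by (rule filterlim_compose[OF poly_exp_tendsto_0 filterlim_inverse_at_top_right])
  then show "(expinv p \<longlongrightarrow> 0) (at_right 0)"
    by (rule filterlim_mono_eventually) (auto simp: expinv_def eventually_at_filter inverse_eq_divide)
qed

text \<open>Differentiating p(1/x) exp (-1/x) produces 1/x^2 times p - p' at 1/x, and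
  \<open>[:0, 0, 1:]\<close> is the polynomial y^2 at y = 1/x.\<close>

lemma expinv_has_derivative:
  "(expinv p has_real_derivative expinv ([:0, 0, 1:] * (p - pderiv p)) x) (at x)"
proof -
  consider "x < 0" | "x = 0" | "0 < x" by linarith
  then show ?thesis
  proof cases
    case 1
    have "((\<lambda>_. 0::real) has_real_derivative 0) (at x)" by simp
    then have "(expinv p has_real_derivative 0) (at x)"
      by (rule has_field_derivative_transform_within_open[of _ _ _ "{..<0}"]) (use 1 in \<open>auto simp: expinv_def\<close>)
    then show ?thesis using 1 by (simp add: expinv_def)
  next
    case 2
    \<comment> \<open>Dividing by h is multiplication by y = 1/h, so the difference quotient at 0 is
      again of the form \<open>expinv\<close> and tends to 0.\<close>
    have "(\<lambda>h. (expinv p (0 + h) - expinv p 0) / h) = expinv ([:0, 1:] * p)"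
      by (auto simp: expinv_def fun_eq_iff)
    then have "((\<lambda>h. (expinv p (0 + h) - expinv p 0) / h) \<longlongrightarrow> 0) (at 0)"
      using expinv_tendsto_0 by simp
    then show ?thesis using 2 by (simp add: DERIV_def expinv_def)
  next
    case 3
    have "((\<lambda>x. poly p (1 / x) * exp (- (1 / x))) has_real_derivative
       (1/x * (1/x)) * (poly p (1/x) - poly (pderiv p) (1/x)) * exp (- (1/x))) (at x)"
      using 3 by (auto intro!: derivative_eq_intros DERIV_chain2[OF poly_DERIV] simp: field_simps power2_eq_square)
    then have "(expinv p has_real_derivative (1/x * (1/x)) * (poly p (1/x) - poly (pderiv p) (1/x)) * exp (- (1/x))) (at x)"
      by (rule has_field_derivative_transform_within_open[of _ _ _ "{0<..}"]) (use 3 in \<open>auto simp: expinv_def\<close>)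
    then show ?thesis using 3 by (simp add: expinv_def mult_ac)
  qed
qed

text \<open>Differentiating 1 - |z|^2 brings out a linear form, hence the closure under
  multiplication by linear forms; with sums and multiples the set is stable under
  derivatives.\<close>

inductive_set bumps :: "('a::euclidean_space \<Rightarrow> complex) set" where
  bump: "(\<lambda>z. complex_of_real (expinv p (1 - (norm z)\<^sup>2))) \<in> bumps"
| mult: "f \<in> bumps \<Longrightarrow> (\<lambda>z. complex_of_real (c * (z \<bullet> v)) * f z) \<in> bumps"
| cmult: "f \<in> bumps \<Longrightarrow> (\<lambda>z. complex_of_real c * f z) \<in> bumps"
| add: "f \<in> bumps \<Longrightarrow> g \<in> bumps \<Longrightarrow> (\<lambda>z. f z + g z) \<in> bumps"

lemma bumps_derivative:
  assumes "h \<in> bumps"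
  shows "\<exists>D. (\<forall>z. (h has_derivative (\<lambda>b. D b z)) (at z)) \<and> (\<forall>b. D b \<in> bumps)"
  using assms
proof (induction rule: bumps.induct)
  case (bump p)
  let ?q = "[:0, 0, 1:] * (p - pderiv p)"
  let ?D = "\<lambda>b z. complex_of_real (- 2 * (z \<bullet> b)) * complex_of_real (expinv ?q (1 - (norm z)\<^sup>2))"
  have "((\<lambda>z. complex_of_real (expinv p (1 - (norm z)\<^sup>2))) has_derivative (\<lambda>b. ?D b z)) (at z)" for z :: 'a
  proof -
    have "((\<lambda>z. 1 - z \<bullet> z) has_derivative (\<lambda>b. - 2 * (z \<bullet> b))) (at z)"
      by (auto intro!: derivative_eq_intros simp: inner_commute)
    then have "((\<lambda>z. 1 - (norm z)\<^sup>2) has_derivative (\<lambda>b. - 2 * (z \<bullet> b))) (at z)"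
      by (simp add: power2_norm_eq_inner)
    moreover have "(expinv p has_derivative (\<lambda>y. expinv ?q (1 - (norm z)\<^sup>2) * y)) (at (1 - (norm z)\<^sup>2))"
      using expinv_has_derivative[of p] unfolding has_field_derivative_def .
    ultimately have "((\<lambda>z. expinv p (1 - (norm z)\<^sup>2)) has_derivative (\<lambda>b. expinv ?q (1 - (norm z)\<^sup>2) * (- 2 * (z \<bullet> b)))) (at z)"
      by (rule has_derivative_compose)
    from has_derivative_of_real[OF this, where 'a=complex] show ?thesis by (simp add: mult_ac)
  qed
  moreover have "?D b \<in> bumps" for b :: 'a by (intro bumps.intros)
  ultimately show ?case by (intro exI[of _ ?D] conjI allI)
next
  case (mult f c v)
  then obtain D where D: "\<And>z. (f has_derivative (\<lambda>b. D b z)) (at z)" "\<And>b. D b \<in> bumps" by blast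
  let ?D = "\<lambda>b z. complex_of_real (c * (z \<bullet> v)) * D b z + complex_of_real (c * (b \<bullet> v)) * f z"
  have "((\<lambda>z. complex_of_real (c * (z \<bullet> v)) * f z) has_derivative (\<lambda>b. ?D b z)) (at z)" for z
    by (intro has_derivative_mult D has_derivative_of_real has_derivative_mult_right has_derivative_inner_left has_derivative_ident)
  moreover have "?D b \<in> bumps" for b by (intro bumps.intros D mult)
  ultimately show ?case by (intro exI[of _ ?D] conjI allI)
next
  case (cmult f c)
  then obtain D where D: "\<And>z. (f has_derivative (\<lambda>b. D b z)) (at z)" "\<And>b. D b \<in> bumps" by blast
  let ?D = "\<lambda>b z. complex_of_real c * D b z"
  have "((\<lambda>z. complex_of_real c * f z) has_derivative (\<lambda>b. ?D b z)) (at z)" for z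
    by (intro has_derivative_mult_right D)
  moreover have "?D b \<in> bumps" for b by (intro bumps.intros D)
  ultimately show ?case by (intro exI[of _ ?D] conjI allI)
next
  case (add f g)
  then obtain D where D: "\<And>z. (f has_derivative (\<lambda>b. D b z)) (at z)" "\<And>b. D b \<in> bumps" by blast
  obtain E where E: "\<And>z. (g has_derivative (\<lambda>b. E b z)) (at z)" "\<And>b. E b \<in> bumps" using add by blast
  let ?D = "\<lambda>b z. D b z + E b z"
  have "((\<lambda>z. f z + g z) has_derivative (\<lambda>b. ?D b z)) (at z)" for z
    by (intro has_derivative_add D E)
  moreover have "?D b \<in> bumps" for b by (intro bumps.intros D E)
  ultimately show ?case by (intro exI[of _ ?D] conjI allI)
qed

lemma smooth_bumps: assumes "f \<in> bumps" shows "smooth f"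
proof (rule smooth_coinduct[OF assms])
  fix g :: "'a \<Rightarrow> complex" and z b assume "g \<in> bumps"
  then obtain D where D: "\<And>z. (g has_derivative (\<lambda>b. D b z)) (at z)" "\<And>b. D b \<in> bumps"
    using bumps_derivative by blast
  then show "g differentiable (at z)" unfolding differentiable_def by blast
  have "pdiff b g = D b" by (intro ext pdiff_eq D)
  then show "pdiff b g \<in> bumps" using D by simp
qed

text \<open>At the origin \<open>expinv 1\<close> is evaluated at 1 and gives exp (-1); the factor
  exp 1 normalises this to 1.\<close>

definition cutoff :: "'a::euclidean_space \<Rightarrow> complex" where
  "cutoff z = complex_of_real (exp 1) * complex_of_real (expinv 1 (1 - (norm z)\<^sup>2))"

lemma cutoff_0: "cutoff 0 = 1"
  by (simp add: cutoff_def expinv_def exp_minus flip: of_real_mult)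

lemma test_fun_cutoff: "test_fun cutoff"
proof (rule test_funI)
  show "smooth cutoff" unfolding cutoff_def[abs_def] by (intro smooth_bumps bumps.intros)
  show "norm z \<le> 1" if "cutoff z \<noteq> 0" for z
  proof -
    have "(norm z)\<^sup>2 < 1\<^sup>2" using that by (auto simp: cutoff_def expinv_def split: if_splits)
    then have "norm z < 1" by (rule power2_less_imp_less) simp
    then show ?thesis by simp
  qed
qed

section \<open>Integration along characteristics\<close>

text \<open>The indicator of [0, t], set up as a function of both arguments for joint measurability:
  t will depend on the frequency, and Tonelli is applied in frequency and time.\<close>

definition window :: "real \<Rightarrow> real \<Rightarrow> ennreal" where
  "window t r = (if 0 \<le> r \<and> r \<le> t then 1 else 0)"

lemma window_measurable[measurable (raw)]:
  assumes [measurable]: "f \<in> borel_measurable M" "g \<in> borel_measurable M"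
  shows "(\<lambda>x. window (f x) (g x)) \<in> borel_measurable M"
  unfolding window_def by measurable

lemma window_cases: "(0 \<le> r \<Longrightarrow> r \<le> t \<Longrightarrow> a \<le> b) \<Longrightarrow> window t r * a \<le> window t r * b"
  by (simp add: window_def)

lemma nn_integral_window: "0 \<le> t \<Longrightarrow> (\<integral>\<^sup>+r. window t r \<partial>lborel) = ennreal t"
proof -
  assume "0 \<le> t"
  have "(\<lambda>r. window t r) = indicator {0..t}" by (auto simp: window_def indicator_def)
  then show ?thesis using \<open>0 \<le> t\<close> by simp
qed

lemma ennreal_le_add: "a \<le> b + c \<Longrightarrow> 0 \<le> b \<Longrightarrow> 0 \<le> c \<Longrightarrow> ennreal a \<le> ennreal b + ennreal c"
  using ennreal_leI[of a "b + c"] by simp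

text \<open>The integrating factor exp (-A r + i tau r) removes the linear term. Only its modulus
  exp (-A r) enters the estimate, so the time frequency tau disappears.\<close>

lemma integral_curve_bound:
  fixes y f :: "real \<Rightarrow> complex" and A a :: "real \<Rightarrow> real"
  assumes s: "0 \<le> s"
    and y: "\<And>r. (y has_vector_derivative (of_real (a r) - \<i> * of_real \<tau>) * y r - f r) (at r)"
    and A: "\<And>r. (A has_real_derivative a r) (at r)" "A 0 = 0"
    and f: "continuous_on UNIV f"
  shows "ennreal (norm (y 0)) \<le> ennreal (exp (- A s) * norm (y s))
    + (\<integral>\<^sup>+r. window s r * ennreal (exp (- A r) * norm (f r)) \<partial>lborel)"
proof -
  define E where "E r = exp (- of_real (A r) + \<i> * of_real (\<tau> * r))" for r
  have nE: "norm (E r) = exp (- A r)" for r by (simp add: E_def norm_exp_eq_Re)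
  have "((\<lambda>r. complex_of_real (A r)) has_vector_derivative of_real (a r)) (at r)" for r
    by (rule has_vector_derivative_of_real) (rule A)
  moreover have "((\<lambda>r. \<i> * complex_of_real (\<tau> * r)) has_vector_derivative \<i> * of_real \<tau>) (at r)" for r
    by (rule has_vector_derivative_mult_right, rule has_vector_derivative_of_real)
       (auto intro!: derivative_eq_intros)
  ultimately have "((\<lambda>r. - complex_of_real (A r) + \<i> * complex_of_real (\<tau> * r)) has_vector_derivative
      - of_real (a r) + \<i> * of_real \<tau>) (at r)" for r
    by (intro has_vector_derivative_add has_vector_derivative_minus)
  then have E': "(E has_vector_derivative (- of_real (a r) + \<i> * of_real \<tau>) * E r) (at r)" for r
    unfolding E_def
    using field_vector_diff_chain_at[OF _ DERIV_exp, of "\<lambda>r. - complex_of_real (A r) + \<i> * complex_of_real (\<tau> * r)"]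
    by (simp add: o_def)
  have d: "((\<lambda>r. E r * y r) has_vector_derivative - (E r * f r)) (at r)" for r
  proof -
    have "((\<lambda>r. E r * y r) has_vector_derivative
        E r * ((of_real (a r) - \<i> * of_real \<tau>) * y r - f r) + (- of_real (a r) + \<i> * of_real \<tau>) * E r * y r) (at r)"
      by (rule has_vector_derivative_mult[OF E' y])
    then show ?thesis by (simp add: algebra_simps)
  qed
  have cE: "continuous_on UNIV E"
    by (intro continuous_at_imp_continuous_on ballI has_vector_derivative_continuous[OF E'])
  have cont: "continuous_on {0..s} (\<lambda>r. - (E r * f r))"
    by (intro continuous_on_minus continuous_on_mult continuous_on_subset[OF cE] continuous_on_subset[OF f]) auto
  \<comment> \<open>The derivative of E y is -E f, so the fundamental theorem of calculus bounds the
    difference of the end values by the weighted integral of |f|.\<close>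
  have hb: "has_bochner_integral lborel (\<lambda>r. indicator {0..s} r *\<^sub>R (- (E r * f r))) (E s * y s - E 0 * y 0)"
    by (rule has_bochner_integral_FTC_Icc[OF s _ cont]) (rule has_vector_derivative_at_within, rule d)
  have "norm (E s * y s - E 0 * y 0) \<le> (\<integral>\<^sup>+r. norm (indicator {0..s} r *\<^sub>R (- (E r * f r))) \<partial>lborel)"
    using has_bochner_integral_norm_bound[OF hb] .
  also have "\<dots> = (\<integral>\<^sup>+r. window s r * ennreal (exp (- A r) * norm (f r)) \<partial>lborel)"
    by (intro nn_integral_cong) (auto simp: window_def indicator_def norm_mult nE)
  finally have le: "ennreal (norm (E s * y s - E 0 * y 0)) \<le> (\<integral>\<^sup>+r. window s r * ennreal (exp (- A r) * norm (f r)) \<partial>lborel)" .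
  have "y 0 = E s * y s - (E s * y s - E 0 * y 0)" using A(2) by (simp add: E_def)
  then have "norm (y 0) \<le> exp (- A s) * norm (y s) + norm (E s * y s - E 0 * y 0)"
    by (metis nE norm_mult norm_triangle_ineq4)
  then have "ennreal (norm (y 0)) \<le> ennreal (exp (- A s) * norm (y s)) + ennreal (norm (E s * y s - E 0 * y 0))"
    by (rule ennreal_le_add) auto
  then show ?thesis using le by (meson add_left_mono order_trans)
qed

text \<open>Frequencies are split into xi_0 in 'x and all others in 'y, and \<open>L\<close> maps
  the latter to the velocity eta of the characteristic. \<open>L_nonzero\<close> ensures that this
  velocity vanishes only on a null set.\<close>

locale kinetic = splitting \<iota> \<pi>
  for \<iota> :: "'x::euclidean_space \<times> 'y::euclidean_space \<Rightarrow> 'z::euclidean_space" and \<pi> :: "'z \<Rightarrow> 'x \<times> 'y" +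
  fixes L :: "'y \<Rightarrow> 'x" and \<sigma> :: real
  assumes linear_L: "linear L" and L_nonzero: "\<exists>y. L y \<noteq> 0" and \<sigma>_pos: "0 < \<sigma>"
begin

section \<open>The shear along the characteristics and its damping\<close>

definition X :: "'z \<Rightarrow> 'x" where "X z = fst (\<pi> z)"

definition H :: "'z \<Rightarrow> 'x" where "H z = L (snd (\<pi> z))"

definition S :: "real \<Rightarrow> 'z \<Rightarrow> 'z" where "S r z = z + r *\<^sub>R \<iota> (H z, 0)"

text \<open>\<open>A z r = \<sigma> \<integral>\<^sub>0\<^sup>r |X z + s H z|\<^sup>2 ds\<close>\<close>

definition A :: "'z \<Rightarrow> real \<Rightarrow> real" where
  "A z r = \<sigma> * ((norm (X z))\<^sup>2 * r + (X z \<bullet> H z) * r\<^sup>2 + (norm (H z))\<^sup>2 * r ^ 3 / 3)"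

lemma bounded_linear_L: "bounded_linear L"
  by (rule linear_conv_bounded_linear[THEN iffD1, OF linear_L])

lemma L_measurable[measurable]: "L \<in> borel_measurable borel"
  by (intro borel_measurable_continuous_onI linear_continuous_on bounded_linear_L)

lemma X_measurable[measurable]: "X \<in> borel_measurable borel"
  unfolding X_def[abs_def] by measurable

lemma H_measurable[measurable]: "H \<in> borel_measurable borel"
  unfolding H_def[abs_def] by measurable

lemma S_measurable[measurable (raw)]:
  assumes [measurable]: "f \<in> borel_measurable M" "g \<in> borel_measurable M"
  shows "(\<lambda>x. S (f x) (g x)) \<in> borel_measurable M"
  unfolding S_def by measurable

lemma A_measurable[measurable (raw)]:
  assumes [measurable]: "f \<in> borel_measurable M" "g \<in> borel_measurable M"
  shows "(\<lambda>x. A (f x) (g x)) \<in> borel_measurable M"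
  unfolding A_def by measurable

lemma \<pi>_S: "\<pi> (S r z) = (X z + r *\<^sub>R H z, snd (\<pi> z))"
proof -
  have "\<pi> (S r z) = \<pi> z + r *\<^sub>R \<pi> (\<iota> (H z, 0))"
    unfolding S_def by (simp only: linear_add[OF linear_\<pi>] linear_cmul[OF linear_\<pi>])
  then show ?thesis by (simp add: X_def prod_eq_iff)
qed

lemma X_S: "X (S r z) = X z + r *\<^sub>R H z"
  by (simp add: X_def[of "S r z"] \<pi>_S)

lemma H_S[simp]: "H (S r z) = H z"
  by (simp add: H_def \<pi>_S)

lemma S_0[simp]: "S 0 z = z"
  by (simp add: S_def)

lemma S_\<iota>: "S r (\<iota> (x, y)) = \<iota> (r *\<^sub>R L y + x, y)"
  by (metis H_def X_def \<iota>_\<pi> \<pi>_S \<pi>_\<iota> add.commute fst_conv snd_conv)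

text \<open>Crude growth control: characteristics that start in a ball stay in a ball for bounded
  times.\<close>

lemma norm_S:
  assumes "0 \<le> r" shows "norm (S r z) \<le> norm z + r * (onorm L * norm z)"
proof -
  have "norm (H z) \<le> onorm L * norm z"
    unfolding H_def
    by (rule order_trans[OF onorm[OF bounded_linear_L]])
       (intro mult_left_mono norm_snd_\<pi> onorm_pos_le bounded_linear_L)
  then have "norm (r *\<^sub>R \<iota> (H z, 0)) \<le> r * (onorm L * norm z)"
    using assms by (simp add: norm_Pair mult_left_mono)
  then show ?thesis unfolding S_def by (meson add_left_mono norm_triangle_ineq order_trans)
qed

lemma A_0[simp]: "A z 0 = 0"
  by (simp add: A_def)

text \<open>Completing the square at r/2: on [0, r] the average of |X + s H|^2 is its value at the
  midpoint plus the variance |H|^2 r^2 / 12. The second part does not depend on \<open>X\<close>; it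
  is the source of the 12 in \<open>crit_time\<close>.\<close>

lemma A_decomp: "A z r = \<sigma> * (r * (norm (X z + (r/2) *\<^sub>R H z))\<^sup>2 + (norm (H z))\<^sup>2 * r ^ 3 / 12)"
proof -
  have e: "(norm (X z + (r/2) *\<^sub>R H z))\<^sup>2 = (norm (X z))\<^sup>2 + r * (X z \<bullet> H z) + r\<^sup>2 / 4 * (norm (H z))\<^sup>2"
    unfolding power2_norm_eq_inner
    by (simp add: inner_add_left inner_add_right inner_commute power2_eq_square field_simps)
  show ?thesis unfolding A_def e by (simp add: power2_eq_square power3_eq_cube field_simps)
qed

lemma A_lower: "0 \<le> r \<Longrightarrow> \<sigma> * (norm (H z))\<^sup>2 * r ^ 3 / 12 \<le> A z r"
  unfolding A_decomp using \<sigma>_pos by (simp add: algebra_simps)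

lemma A_nonneg: "0 \<le> r \<Longrightarrow> 0 \<le> A z r"
  using A_lower[of r z] \<sigma>_pos by (smt (verit) divide_nonneg_nonneg mult_nonneg_nonneg zero_le_power zero_le_power2)

lemma A_derivative: "((\<lambda>r. A z r) has_real_derivative \<sigma> * (norm (X (S r z)))\<^sup>2) (at r)"
proof -
  have "(norm (X (S r z)))\<^sup>2 = (norm (X z))\<^sup>2 + 2 * (X z \<bullet> H z) * r + r\<^sup>2 * (norm (H z))\<^sup>2"
    unfolding X_S power2_norm_eq_inner
    by (simp add: inner_add_left inner_add_right inner_commute power2_eq_square algebra_simps)
  then show ?thesis
    unfolding A_def by (auto intro!: derivative_eq_intros simp: power2_eq_square algebra_simps)
qed

text \<open>\<open>H\<close> is constant along the shear, so on each fibre the time T (H z) is fixed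
  and the map is a translation. This is what allows the time to depend on eta.\<close>

lemma nn_integral_S:
  assumes [measurable]: "f \<in> borel_measurable borel" "T \<in> borel_measurable borel"
  shows "(\<integral>\<^sup>+z. f (S (T (H z)) z) \<partial>lborel) = (\<integral>\<^sup>+z. f z \<partial>lborel)"
proof -
  have "(\<integral>\<^sup>+z. f (S (T (H z)) z) \<partial>lborel) = (\<integral>\<^sup>+y. (\<integral>\<^sup>+x. f (\<iota> (T (L y) *\<^sub>R L y + x, y)) \<partial>lborel) \<partial>lborel)"
    by (subst nn_integral_\<iota>(1)) (auto simp: S_\<iota> H_def)
  also have "\<dots> = (\<integral>\<^sup>+y. (\<integral>\<^sup>+x. f (\<iota> (x, y)) \<partial>lborel) \<partial>lborel)"
  proof (rule nn_integral_cong)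
    fix y :: 'y
    have "(\<integral>\<^sup>+x. f (\<iota> (x, y)) \<partial>lborel) = (\<integral>\<^sup>+x. f (\<iota> (x, y)) \<partial>(distr lborel borel ((+) (T (L y) *\<^sub>R L y))))"
      by (simp only: lborel_distr_plus)
    also have "\<dots> = (\<integral>\<^sup>+x. f (\<iota> (T (L y) *\<^sub>R L y + x, y)) \<partial>lborel)"
      by (rule nn_integral_distr) measurable
    finally show "(\<integral>\<^sup>+x. f (\<iota> (T (L y) *\<^sub>R L y + x, y)) \<partial>lborel) = (\<integral>\<^sup>+x. f (\<iota> (x, y)) \<partial>lborel)" ..
  qed
  also have "\<dots> = (\<integral>\<^sup>+z. f z \<partial>lborel)" by (rule nn_integral_\<iota>(1)[symmetric]) measurable
  finally show ?thesis .
qed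

text \<open>Tonelli and, for fixed r, invariance under the shear. The window survives the change of
  variables because it depends on \<open>H z\<close> only.\<close>

lemma nn_integral_flow:
  fixes \<Phi> :: "real \<Rightarrow> 'z \<Rightarrow> ennreal"
  assumes [measurable]: "(\<lambda>p. \<Phi> (fst p) (snd p)) \<in> borel_measurable (borel :: (real \<times> 'z) measure)"
    and [measurable]: "T \<in> borel_measurable borel"
  shows "(\<integral>\<^sup>+z. (\<integral>\<^sup>+r. window (T (H z)) r * \<Phi> r (S r z) \<partial>lborel) \<partial>lborel)
    = (\<integral>\<^sup>+z. (\<integral>\<^sup>+r. window (T (H z)) r * \<Phi> r z \<partial>lborel) \<partial>lborel)"
proof -
  have \<Phi>: "(\<lambda>x. \<Phi> (f x) (g x)) \<in> borel_measurable M"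
    if [measurable]: "f \<in> borel_measurable M" "g \<in> borel_measurable M" for f g and M :: "'m measure"
    using measurable_compose[OF borel_measurable_Pair[OF that] assms(1)] by simp
  have \<Phi>2: "(\<lambda>x. \<Phi> (f x) (g x)) \<in> borel_measurable M"
    if [measurable]: "f \<in> borel_measurable M" "g \<in> borel_measurable M" for f g and M :: "('z \<times> real) measure"
    using measurable_compose[OF borel_measurable_Pair[OF that] assms(1)] by simp
  have \<Phi>3: "(\<lambda>x. \<Phi> (f x) (g x)) \<in> borel_measurable M"
    if [measurable]: "f \<in> borel_measurable M" "g \<in> borel_measurable M" for f g and M :: "'z measure"
    using measurable_compose[OF borel_measurable_Pair[OF that] assms(1)] by simp
  have swap: "(\<integral>\<^sup>+z. (\<integral>\<^sup>+r. window (T (H z)) r * \<Phi> r (q r z) \<partial>lborel) \<partial>lborel)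
    = (\<integral>\<^sup>+r. (\<integral>\<^sup>+z. window (T (H z)) r * \<Phi> r (q r z) \<partial>lborel) \<partial>lborel)"
    if [measurable]: "(\<lambda>p. q (snd p) (fst p)) \<in> borel_measurable (lborel \<Otimes>\<^sub>M lborel)" for q
  proof (rule lborel_pair.Fubini'[symmetric])
    note \<Phi>2[measurable]
    show "(\<lambda>(z, r). window (T (H z)) r * \<Phi> r (q r z)) \<in> borel_measurable (lborel \<Otimes>\<^sub>M lborel)"
      unfolding split_beta' by measurable
  qed
  have "(\<integral>\<^sup>+z. (\<integral>\<^sup>+r. window (T (H z)) r * \<Phi> r (S r z) \<partial>lborel) \<partial>lborel)
    = (\<integral>\<^sup>+r. (\<integral>\<^sup>+z. window (T (H z)) r * \<Phi> r (S r z) \<partial>lborel) \<partial>lborel)"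
    by (rule swap) measurable
  also have "\<dots> = (\<integral>\<^sup>+r. (\<integral>\<^sup>+z. window (T (H z)) r * \<Phi> r z \<partial>lborel) \<partial>lborel)"
  proof (rule nn_integral_cong)
    fix r :: real
    note \<Phi>3[measurable]
    show "(\<integral>\<^sup>+z. window (T (H z)) r * \<Phi> r (S r z) \<partial>lborel) = (\<integral>\<^sup>+z. window (T (H z)) r * \<Phi> r z \<partial>lborel)"
      using nn_integral_S[of "\<lambda>z. window (T (H z)) r * \<Phi> r z" "\<lambda>_. r"] by simp
  qed
  also have "\<dots> = (\<integral>\<^sup>+z. (\<integral>\<^sup>+r. window (T (H z)) r * \<Phi> r z \<partial>lborel) \<partial>lborel)"
    by (rule swap[symmetric]) measurable
  finally show ?thesis .
qed

text \<open>Once the shear is undone the integrand no longer depends on r, so each window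
  contributes its length; weights in \<open>H\<close> move inside because the shear leaves
  \<open>H\<close> unchanged.\<close>

lemma nn_integral_S_average:
  assumes [measurable]: "f \<in> borel_measurable borel" "T \<in> borel_measurable borel" "w \<in> borel_measurable borel"
    and T: "\<And>h. 0 \<le> T h"
  shows "(\<integral>\<^sup>+z. w (H z) * (\<integral>\<^sup>+r. window (T (H z)) r * f (S r z) \<partial>lborel) \<partial>lborel)
    = (\<integral>\<^sup>+z. w (H z) * ennreal (T (H z)) * f z \<partial>lborel)"
proof -
  have "(\<integral>\<^sup>+z. w (H z) * (\<integral>\<^sup>+r. window (T (H z)) r * f (S r z) \<partial>lborel) \<partial>lborel)
    = (\<integral>\<^sup>+z. (\<integral>\<^sup>+r. window (T (H z)) r * (w (H (S r z)) * f (S r z)) \<partial>lborel) \<partial>lborel)"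
  proof (rule nn_integral_cong)
    fix z
    have "w (H z) * (\<integral>\<^sup>+r. window (T (H z)) r * f (S r z) \<partial>lborel) = (\<integral>\<^sup>+r. w (H z) * (window (T (H z)) r * f (S r z)) \<partial>lborel)"
      by (rule nn_integral_cmult[symmetric]) measurable
    then show "w (H z) * (\<integral>\<^sup>+r. window (T (H z)) r * f (S r z) \<partial>lborel) = (\<integral>\<^sup>+r. window (T (H z)) r * (w (H (S r z)) * f (S r z)) \<partial>lborel)"
      by (simp add: mult_ac)
  qed
  also have "\<dots> = (\<integral>\<^sup>+z. (\<integral>\<^sup>+r. window (T (H z)) r * (w (H z) * f z) \<partial>lborel) \<partial>lborel)"
    by (rule nn_integral_flow[of "\<lambda>_ z. w (H z) * f z"]) measurable
  also have "\<dots> = (\<integral>\<^sup>+z. w (H z) * ennreal (T (H z)) * f z \<partial>lborel)"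
    by (intro nn_integral_cong) (subst nn_integral_multc, auto simp: nn_integral_window T mult_ac)
  finally show ?thesis .
qed

definition subsolution :: "('z \<Rightarrow> complex) \<Rightarrow> ('z \<Rightarrow> complex) \<Rightarrow> ('x \<Rightarrow> real) \<Rightarrow> 'z \<Rightarrow> bool" where
  "subsolution U G T z \<longleftrightarrow> ennreal (norm (U z)) \<le> ennreal (exp (- A z (T (H z))) * norm (U (S (T (H z)) z)))
     + (\<integral>\<^sup>+r. window (T (H z)) r * ennreal (exp (- A z r) * norm (G (S r z))) \<partial>lborel)"

text \<open>Convergence in L1 on balls is all that the cutoff argument provides, and it suffices:
  the errors at shifted points are integrated over z, where the shear preserves measure. Countably
  many bounds K then exhaust all z and all times T (H z).\<close>

lemma subsolution_limit:
  assumes [measurable]: "U \<in> borel_measurable borel" "G \<in> borel_measurable borel"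
    "\<And>n. V n \<in> borel_measurable borel" "\<And>n. f n \<in> borel_measurable borel" "T \<in> borel_measurable borel"
    and sub: "\<And>n z. subsolution (V n) (f n) T z" and T: "\<And>h. 0 \<le> T h"
    and V: "\<And>K. (\<lambda>n. \<integral>\<^sup>+z. indicator (cball 0 K) z * ennreal (norm (V n z - U z)) \<partial>lborel) \<longlonglongrightarrow> 0"
    and f: "\<And>K. (\<lambda>n. \<integral>\<^sup>+z. indicator (cball 0 K) z * ennreal (norm (f n z - G z)) \<partial>lborel) \<longlonglongrightarrow> 0"
  shows "AE z in lborel. subsolution U G T z"
proof -
  define R where "R z = ennreal (exp (- A z (T (H z))) * norm (U (S (T (H z)) z)))
     + (\<integral>\<^sup>+r. window (T (H z)) r * ennreal (exp (- A z r) * norm (G (S r z))) \<partial>lborel)" for z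
  have [measurable]: "R \<in> borel_measurable borel" unfolding R_def[abs_def] by measurable
  define e where "e n z = ennreal (norm (V n z - U z)) + (ennreal (norm (V n (S (T (H z)) z) - U (S (T (H z)) z)))
     + (\<integral>\<^sup>+r. window (T (H z)) r * ennreal (norm (f n (S r z) - G (S r z))) \<partial>lborel))" for n z
  have [measurable]: "e n \<in> borel_measurable borel" for n unfolding e_def[abs_def] by measurable
  have en: "ennreal (k * norm a) \<le> ennreal (k * norm b) + ennreal (norm (a - b))" if "0 \<le> k" "k \<le> 1" for k and a b :: complex
  proof -
    have "k * norm a \<le> k * (norm b + norm (a - b))"
      using that norm_triangle_sub[of a b] by (intro mult_left_mono) auto
    also have "\<dots> \<le> k * norm b + norm (a - b)"
      using mult_right_mono[OF that(2) norm_ge_zero[of "a - b"]] by (simp add: algebra_simps)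
    finally show ?thesis using that by (intro ennreal_le_add) auto
  qed
  have exp1: "exp (- A z r) \<le> 1" if "0 \<le> r" for z r using A_nonneg[OF that, of z] by simp
  have main: "ennreal (norm (U z)) \<le> R z + e n z" for n z
  proof -
    have "ennreal (norm (U z)) \<le> ennreal (norm (V n z)) + ennreal (norm (V n z - U z))"
      using en[of 1 "U z" "V n z"] by (simp add: norm_minus_commute)
    also have "ennreal (norm (V n z)) \<le> ennreal (exp (- A z (T (H z))) * norm (V n (S (T (H z)) z)))
      + (\<integral>\<^sup>+r. window (T (H z)) r * ennreal (exp (- A z r) * norm (f n (S r z))) \<partial>lborel)"
      using sub[of n z] unfolding subsolution_def .
    also have "ennreal (exp (- A z (T (H z))) * norm (V n (S (T (H z)) z))) \<le>
       ennreal (exp (- A z (T (H z))) * norm (U (S (T (H z)) z))) + ennreal (norm (V n (S (T (H z)) z) - U (S (T (H z)) z)))"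
      by (rule en) (simp_all add: exp1 T A_nonneg)
    also have "(\<integral>\<^sup>+r. window (T (H z)) r * ennreal (exp (- A z r) * norm (f n (S r z))) \<partial>lborel) \<le>
      (\<integral>\<^sup>+r. window (T (H z)) r * ennreal (exp (- A z r) * norm (G (S r z)))
         + window (T (H z)) r * ennreal (norm (f n (S r z) - G (S r z))) \<partial>lborel)"
    proof (rule nn_integral_mono)
      fix r
      show "window (T (H z)) r * ennreal (exp (- A z r) * norm (f n (S r z))) \<le>
        window (T (H z)) r * ennreal (exp (- A z r) * norm (G (S r z))) + window (T (H z)) r * ennreal (norm (f n (S r z) - G (S r z)))"
        unfolding distrib_left[symmetric] by (rule window_cases) (rule en, simp_all add: exp1 A_nonneg)
    qed
    also have "\<dots> = (\<integral>\<^sup>+r. window (T (H z)) r * ennreal (exp (- A z r) * norm (G (S r z))) \<partial>lborel)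
       + (\<integral>\<^sup>+r. window (T (H z)) r * ennreal (norm (f n (S r z) - G (S r z))) \<partial>lborel)"
      by (rule nn_integral_add) measurable
    finally show ?thesis by (simp add: R_def e_def add_ac add_mono)
  qed
  have "AE z in lborel. norm z \<le> real K \<and> T (H z) \<le> real K \<longrightarrow> ennreal (norm (U z)) \<le> R z" for K :: nat
  proof -
    \<comment> \<open>Restricts to points whose characteristic up to time T (H z) stays in a fixed
      ball, so that only the convergence on that ball is used.\<close>
    define D where "D z = (if norm z \<le> real K \<and> T (H z) \<le> real K then 1 else 0 :: ennreal)" for z
    have [measurable]: "D \<in> borel_measurable borel" unfolding D_def by measurable
    define K' where "K' = real K + real K * (onorm L * real K)"
    have K': "D z \<le> indicator (cball 0 K') (S r z)" if "0 \<le> r" "r \<le> T (H z)" for r z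
    proof (cases "norm z \<le> real K \<and> T (H z) \<le> real K")
      case True
      have "norm (S r z) \<le> norm z + r * (onorm L * norm z)" by (rule norm_S[OF that(1)])
      also have "\<dots> \<le> K'"
        unfolding K'_def using True that onorm_pos_le[OF bounded_linear_L] by (intro add_mono mult_mono) auto
      finally show ?thesis by (simp add: D_def)
    qed (auto simp: D_def)
    define J where "J = (indicator (cball 0 K') :: 'z \<Rightarrow> ennreal)"
    have [measurable]: "J \<in> borel_measurable borel" unfolding J_def by (intro borel_measurable_indicator) simp
    define I where "I h = (\<integral>\<^sup>+z. J z * ennreal (norm (h z)) \<partial>lborel)" for h :: "'z \<Rightarrow> complex"
    have De: "(\<integral>\<^sup>+z. D z * e n z \<partial>lborel) \<le> 2 * I (\<lambda>z. V n z - U z) + ennreal (real K) * I (\<lambda>z. f n z - G z)" for n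
    proof -
      have "(\<integral>\<^sup>+z. D z * e n z \<partial>lborel) \<le> (\<integral>\<^sup>+z. (J z * ennreal (norm (V n z - U z))
         + J (S (T (H z)) z) * ennreal (norm (V n (S (T (H z)) z) - U (S (T (H z)) z))))
         + (\<integral>\<^sup>+r. window (real K) r * (J (S r z) * ennreal (norm (f n (S r z) - G (S r z)))) \<partial>lborel) \<partial>lborel)"
      proof (rule nn_integral_mono)
        fix z
        have D1: "D z * ennreal (norm (V n z - U z)) \<le> J z * ennreal (norm (V n z - U z))"
          using K'[of 0 z] T[of "H z"] unfolding J_def by (intro mult_right_mono) auto
        have D2: "D z * ennreal (norm (V n (S (T (H z)) z) - U (S (T (H z)) z))) \<le>
          J (S (T (H z)) z) * ennreal (norm (V n (S (T (H z)) z) - U (S (T (H z)) z)))"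
          using K'[of "T (H z)" z] T[of "H z"] unfolding J_def by (intro mult_right_mono) auto
        have D3: "D z * (\<integral>\<^sup>+r. window (T (H z)) r * ennreal (norm (f n (S r z) - G (S r z))) \<partial>lborel) \<le>
          (\<integral>\<^sup>+r. window (real K) r * (J (S r z) * ennreal (norm (f n (S r z) - G (S r z)))) \<partial>lborel)"
        proof -
          have "D z * (\<integral>\<^sup>+r. window (T (H z)) r * ennreal (norm (f n (S r z) - G (S r z))) \<partial>lborel)
             = (\<integral>\<^sup>+r. D z * (window (T (H z)) r * ennreal (norm (f n (S r z) - G (S r z)))) \<partial>lborel)"
            by (rule nn_integral_cmult[symmetric]) measurable
          also have "\<dots> \<le> (\<integral>\<^sup>+r. window (real K) r * (J (S r z) * ennreal (norm (f n (S r z) - G (S r z)))) \<partial>lborel)"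
          proof (rule nn_integral_mono)
            fix r
            show "D z * (window (T (H z)) r * ennreal (norm (f n (S r z) - G (S r z)))) \<le>
              window (real K) r * (J (S r z) * ennreal (norm (f n (S r z) - G (S r z))))"
            proof (cases "0 \<le> r \<and> r \<le> T (H z)")
              case True
              have "window (real K) r = 1 \<or> D z = 0" using True by (auto simp: window_def D_def)
              then show ?thesis
                using mult_right_mono[OF K'[of r z], of "ennreal (norm (f n (S r z) - G (S r z)))"] True unfolding J_def by (auto simp: window_def)
            qed (auto simp: window_def)
          qed
          finally show ?thesis .
        qed
        show "D z * e n z \<le> (J z * ennreal (norm (V n z - U z))
         + J (S (T (H z)) z) * ennreal (norm (V n (S (T (H z)) z) - U (S (T (H z)) z))))
         + (\<integral>\<^sup>+r. window (real K) r * (J (S r z) * ennreal (norm (f n (S r z) - G (S r z)))) \<partial>lborel)"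
          unfolding e_def distrib_left add.assoc by (intro add_mono D1 D2 D3)
      qed
      also have "\<dots> = (\<integral>\<^sup>+z. J z * ennreal (norm (V n z - U z)) + J (S (T (H z)) z) * ennreal (norm (V n (S (T (H z)) z) - U (S (T (H z)) z))) \<partial>lborel)
         + (\<integral>\<^sup>+z. (\<integral>\<^sup>+r. window (real K) r * (J (S r z) * ennreal (norm (f n (S r z) - G (S r z)))) \<partial>lborel) \<partial>lborel)"
        by (rule nn_integral_add) measurable
      also have "(\<integral>\<^sup>+z. J z * ennreal (norm (V n z - U z)) + J (S (T (H z)) z) * ennreal (norm (V n (S (T (H z)) z) - U (S (T (H z)) z))) \<partial>lborel)
         = I (\<lambda>z. V n z - U z) + (\<integral>\<^sup>+z. J (S (T (H z)) z) * ennreal (norm (V n (S (T (H z)) z) - U (S (T (H z)) z))) \<partial>lborel)"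
        unfolding I_def by (rule nn_integral_add) measurable
      also have "(\<integral>\<^sup>+z. J (S (T (H z)) z) * ennreal (norm (V n (S (T (H z)) z) - U (S (T (H z)) z))) \<partial>lborel) = I (\<lambda>z. V n z - U z)"
        unfolding I_def by (rule nn_integral_S[of "\<lambda>z. J z * ennreal (norm (V n z - U z))"]) measurable
      also have "(\<integral>\<^sup>+z. (\<integral>\<^sup>+r. window (real K) r * (J (S r z) * ennreal (norm (f n (S r z) - G (S r z)))) \<partial>lborel) \<partial>lborel)
         = ennreal (real K) * I (\<lambda>z. f n z - G z)"
        using nn_integral_S_average[of "\<lambda>z. J z * ennreal (norm (f n z - G z))" "\<lambda>_. real K" "\<lambda>_. 1"]
        unfolding I_def by (simp add: nn_integral_cmult)
      finally show ?thesis by (simp add: mult_2)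
    qed
    have "(\<lambda>n. 2 * I (\<lambda>z. V n z - U z) + ennreal (real K) * I (\<lambda>z. f n z - G z)) \<longlonglongrightarrow> 2 * 0 + ennreal (real K) * 0"
      unfolding I_def J_def by (intro tendsto_add ennreal_tendsto_cmult V f) auto
    then have lim: "(\<lambda>n. 2 * I (\<lambda>z. V n z - U z) + ennreal (real K) * I (\<lambda>z. f n z - G z)) \<longlonglongrightarrow> 0" by simp
    have De0: "(\<lambda>n. \<integral>\<^sup>+z. D z * e n z \<partial>lborel) \<longlonglongrightarrow> 0"
      by (rule tendsto_sandwich[OF _ always_eventually[OF allI[OF De]] tendsto_const lim]) simp
    \<comment> \<open>Subtraction in \<open>ennreal\<close> is truncated at 0, so this is the
      integral of the defect of the inequality; it vanishes in the limit and hence the defect is 0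
      almost everywhere.\<close>
    have "(\<integral>\<^sup>+z. D z * (ennreal (norm (U z)) - R z) \<partial>lborel) \<le> (\<integral>\<^sup>+z. D z * e n z \<partial>lborel)" for n
    proof (rule nn_integral_mono, rule mult_left_mono)
      show "ennreal (norm (U z)) - R z \<le> e n z" for z
        unfolding ennreal_minus_le_iff using main[of z n] by simp
    qed simp
    then have "(\<integral>\<^sup>+z. D z * (ennreal (norm (U z)) - R z) \<partial>lborel) \<le> 0"
      by (intro LIMSEQ_le_const[OF De0]) blast
    then have "(\<integral>\<^sup>+z. D z * (ennreal (norm (U z)) - R z) \<partial>lborel) = 0" by simp
    then have "AE z in lborel. D z * (ennreal (norm (U z)) - R z) = 0"
      by (subst (asm) nn_integral_0_iff_AE) measurable
    then show ?thesis
      by eventually_elim (auto simp: D_def dest: ennreal_minus_eq_0)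
  qed
  then have "AE z in lborel. \<forall>K::nat. norm z \<le> real K \<and> T (H z) \<le> real K \<longrightarrow> ennreal (norm (U z)) \<le> R z"
    by (simp only: AE_all_countable) blast
  then show ?thesis
  proof eventually_elim
    case (elim z)
    obtain K :: nat where "max (norm z) (T (H z)) \<le> real K" using real_arch_simple by blast
    then have "ennreal (norm (U z)) \<le> R z" using elim by (auto dest: spec[of _ K])
    then show ?case unfolding subsolution_def R_def .
  qed
qed

end

section \<open>Estimates along characteristics\<close>

lemma ennreal_numeral_mult: "0 \<le> x \<Longrightarrow> numeral w * ennreal x = ennreal (numeral w * x)"
  by (simp add: ennreal_mult)

lemma ennreal_add_sq: "(a + b)\<^sup>2 \<le> 2 * a\<^sup>2 + 2 * (b::ennreal)\<^sup>2"
proof (cases "a = top \<or> b = top")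
  case True
  then show ?thesis by (auto simp: ennreal_mult_eq_top_iff power2_eq_square)
next
  case False
  then obtain x y where xy: "a = ennreal x" "0 \<le> x" "b = ennreal y" "0 \<le> y"
    by (metis ennreal_cases)
  have "(x + y)\<^sup>2 \<le> 2 * x\<^sup>2 + 2 * y\<^sup>2"
    using sum_squares_bound[of x y] by (simp add: power2_sum)
  then have "ennreal ((x + y)\<^sup>2) \<le> ennreal (2 * x\<^sup>2) + ennreal (2 * y\<^sup>2)"
    by (rule ennreal_le_add) auto
  then show ?thesis using xy
    by (simp add: ennreal_mult ennreal_power[symmetric])
qed

text \<open>Cauchy-Schwarz for the measure exp (-c r) dr on the window; the weight is split into two
  equal halves, so it appears to the first power in both factors.\<close>

lemma window_Cauchy_Schwarz:
  assumes [measurable]: "f \<in> borel_measurable borel"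
  shows "(\<integral>\<^sup>+r. window t r * (ennreal (exp (- c * r)) * f r) \<partial>lborel)\<^sup>2 \<le>
    (\<integral>\<^sup>+r. window t r * ennreal (exp (- c * r)) \<partial>lborel) * (\<integral>\<^sup>+r. window t r * (ennreal (exp (- c * r)) * (f r)\<^sup>2) \<partial>lborel)"
proof -
  define k where "k r = ennreal (exp (- c * r / 2))" for r
  have [measurable]: "k \<in> borel_measurable borel" unfolding k_def by measurable
  have k2: "ennreal (exp (- c * r)) = k r * k r" for r
    unfolding k_def by (simp add: ennreal_mult[symmetric] exp_add[symmetric])
  have "(\<integral>\<^sup>+r. (window t r * k r) * (k r * f r) \<partial>lborel)\<^sup>2 \<le>
     (\<integral>\<^sup>+r. (window t r * k r)\<^sup>2 \<partial>lborel) * (\<integral>\<^sup>+r. (window t r * (k r * f r))\<^sup>2 \<partial>lborel)"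
  proof -
    have "(\<integral>\<^sup>+r. (window t r * k r) * (window t r * (k r * f r)) \<partial>lborel)\<^sup>2 \<le>
     (\<integral>\<^sup>+r. (window t r * k r)\<^sup>2 \<partial>lborel) * (\<integral>\<^sup>+r. (window t r * (k r * f r))\<^sup>2 \<partial>lborel)"
      by (rule Cauchy_Schwarz_nn_integral) measurable
    moreover have "(window t r * k r) * (window t r * (k r * f r)) = (window t r * k r) * (k r * f r)" for r
      by (simp add: window_def)
    ultimately show ?thesis by simp
  qed
  moreover have "(window t r * k r)\<^sup>2 = window t r * (k r * k r)" for r
    by (simp add: window_def power2_eq_square)
  moreover have "(window t r * (k r * f r))\<^sup>2 = window t r * (k r * k r * (f r)\<^sup>2)" for r
    by (simp add: window_def power2_eq_square mult_ac)
  ultimately show ?thesis unfolding k2 by (simp add: mult.assoc)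
qed

text \<open>The whole half-line already gives 1/c, so the bound is uniform in the length of the
  window.\<close>

lemma nn_integral_window_exp:
  assumes "0 < c" shows "(\<integral>\<^sup>+r. window t r * ennreal (exp (- c * r)) \<partial>lborel) \<le> ennreal (1 / c)"
proof -
  have "(\<integral>\<^sup>+r. window t r * ennreal (exp (- c * r)) \<partial>lborel) \<le> (\<integral>\<^sup>+r. ennreal (exp (- c * r)) * indicator {0..} r \<partial>lborel)"
    by (intro nn_integral_mono) (auto simp: window_def)
  also have "\<dots> = ennreal (0 - (- exp (- c * 0) / c))"
  proof (rule nn_integral_FTC_atLeast)
    show "((\<lambda>r. - exp (- c * r) / c) has_real_derivative exp (- c * r)) (at r)" for r
      using assms by (auto intro!: derivative_eq_intros)
    have "filterlim (\<lambda>r. c * r) at_top at_top"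
      using assms by (intro filterlim_tendsto_pos_mult_at_top[OF tendsto_const]) (auto simp: filterlim_ident)
    then have "((\<lambda>r. exp (- (c * r))) \<longlongrightarrow> 0) at_top"
      by (intro filterlim_compose[OF exp_at_bot]) (simp add: filterlim_uminus_at_bot)
    then have "((\<lambda>r. - exp (- (c * r)) / c) \<longlongrightarrow> - 0 / c) at_top"
      using assms by (intro tendsto_intros) auto
    then show "((\<lambda>r. - exp (- c * r) / c) \<longlongrightarrow> 0) at_top" by simp
  qed auto
  finally show ?thesis by simp
qed

context kinetic
begin

text \<open>If L y0 is nonzero and a is its image under the adjoint of \<open>H\<close>, the zeros
  of \<open>H\<close> lie in the hyperplane orthogonal to a.\<close>

lemma AE_H_nonzero: "AE z in lborel. H z \<noteq> 0"
proof -
  obtain y0 where y0: "L y0 \<noteq> 0" using L_nonzero by blast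
  have lin: "linear H"
    unfolding H_def[abs_def] using linear_compose[OF linear_compose[OF linear_\<pi> linear_snd] linear_L] by (simp add: o_def)
  define a where "a = adjoint H (L y0)"
  have a: "z \<bullet> a = H z \<bullet> L y0" for z unfolding a_def by (rule adjoint_works[OF lin])
  have "H (\<iota> (0, y0)) = L y0" by (simp add: H_def)
  then have "\<iota> (0, y0) \<bullet> a \<noteq> 0" using a y0 by simp
  then have "a \<noteq> 0" by auto
  then have "{z. a \<bullet> z = 0} \<in> null_sets lebesgue"
    using negligible_hyperplane[of a 0] by (simp add: negligible_iff_null_sets)
  moreover have "{z. a \<bullet> z = 0} \<in> sets lborel"
    using closed_hyperplane[of a 0] by simp
  ultimately have "{z. a \<bullet> z = 0} \<in> null_sets lborel" by (simp add: null_sets_completion_iff)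
  then have "AE z in lborel. z \<notin> {z. a \<bullet> z = 0}" by (rule AE_not_in)
  then show ?thesis by eventually_elim (use a in \<open>auto simp: inner_commute\<close>)
qed

text \<open>Common squared form of the inequality: k bounds the damping at the end of the window and
  c is a linear rate of damping inside it. It is used with k = 1/2 and c = 0 for absorption, with c
  = a/2 at large xi_0, and with k = 1 and c = 0 when the damping is dropped.\<close>

lemma subsolution_sq:
  assumes sub: "subsolution U G T z" and [measurable]: "U \<in> borel_measurable borel" "G \<in> borel_measurable borel"
    and k: "exp (- A z (T (H z))) \<le> k" and c: "\<And>r. 0 \<le> r \<Longrightarrow> r \<le> T (H z) \<Longrightarrow> exp (- A z r) \<le> exp (- c * r)"
  shows "(ennreal (norm (U z)))\<^sup>2 \<le> 2 * (ennreal k * ennreal (norm (U (S (T (H z)) z))))\<^sup>2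
    + 2 * ((\<integral>\<^sup>+r. window (T (H z)) r * ennreal (exp (- c * r)) \<partial>lborel)
       * (\<integral>\<^sup>+r. window (T (H z)) r * (ennreal (exp (- c * r)) * (ennreal (norm (G (S r z))))\<^sup>2) \<partial>lborel))"
proof -
  have "0 \<le> k" using k exp_ge_zero order_trans by blast
  have 1: "ennreal (exp (- A z (T (H z))) * norm (U (S (T (H z)) z))) \<le> ennreal k * ennreal (norm (U (S (T (H z)) z)))"
    using k \<open>0 \<le> k\<close> by (subst ennreal_mult[symmetric]) (auto intro!: ennreal_leI mult_right_mono)
  have 2: "(\<integral>\<^sup>+r. window (T (H z)) r * ennreal (exp (- A z r) * norm (G (S r z))) \<partial>lborel) \<le>
    (\<integral>\<^sup>+r. window (T (H z)) r * (ennreal (exp (- c * r)) * ennreal (norm (G (S r z)))) \<partial>lborel)"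
  proof (rule nn_integral_mono, rule window_cases)
    fix r assume "0 \<le> r" "r \<le> T (H z)"
    then show "ennreal (exp (- A z r) * norm (G (S r z))) \<le> ennreal (exp (- c * r)) * ennreal (norm (G (S r z)))"
      using c by (subst ennreal_mult[symmetric]) (auto intro!: ennreal_leI mult_right_mono)
  qed
  have "ennreal (norm (U z)) \<le> ennreal k * ennreal (norm (U (S (T (H z)) z))) +
    (\<integral>\<^sup>+r. window (T (H z)) r * (ennreal (exp (- c * r)) * ennreal (norm (G (S r z)))) \<partial>lborel)"
    using sub[unfolded subsolution_def] add_mono[OF 1 2] by (rule order_trans)
  then have "(ennreal (norm (U z)))\<^sup>2 \<le> (ennreal k * ennreal (norm (U (S (T (H z)) z))) +
    (\<integral>\<^sup>+r. window (T (H z)) r * (ennreal (exp (- c * r)) * ennreal (norm (G (S r z)))) \<partial>lborel))\<^sup>2"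
    by (rule power_mono) simp
  also have "\<dots> \<le> 2 * (ennreal k * ennreal (norm (U (S (T (H z)) z))))\<^sup>2 +
    2 * (\<integral>\<^sup>+r. window (T (H z)) r * (ennreal (exp (- c * r)) * ennreal (norm (G (S r z)))) \<partial>lborel)\<^sup>2"
    by (rule ennreal_add_sq)
  also have "\<dots> \<le> 2 * (ennreal k * ennreal (norm (U (S (T (H z)) z))))\<^sup>2
    + 2 * ((\<integral>\<^sup>+r. window (T (H z)) r * ennreal (exp (- c * r)) \<partial>lborel)
       * (\<integral>\<^sup>+r. window (T (H z)) r * (ennreal (exp (- c * r)) * (ennreal (norm (G (S r z))))\<^sup>2) \<partial>lborel))"
    by (intro add_left_mono mult_left_mono window_Cauchy_Schwarz) auto
  finally show ?thesis .
qed

text \<open>The time at which the lower bound for \<open>A\<close> in \<open>A_lower\<close> equals 1.\<close>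

definition crit_time :: "'x \<Rightarrow> real" where "crit_time h = (12 / (\<sigma> * (norm h)\<^sup>2)) powr (1/3)"

lemma crit_time_measurable[measurable]: "crit_time \<in> borel_measurable borel"
  unfolding crit_time_def[abs_def] by measurable

lemma crit_time_nonneg: "0 \<le> crit_time h" by (simp add: crit_time_def)

lemma crit_time_cube: "h \<noteq> 0 \<Longrightarrow> \<sigma> * (norm h)\<^sup>2 * crit_time h ^ 3 = 12"
proof -
  assume h: "h \<noteq> 0"
  define x where "x = 12 / (\<sigma> * (norm h)\<^sup>2)"
  have x: "0 < x" using h \<sigma>_pos by (simp add: x_def)
  have "(x powr (1/3)) ^ 3 = (x powr (1/3)) powr real 3"
    using x by (intro powr_realpow[symmetric]) simp
  also have "\<dots> = x" using x by (simp add: powr_powr)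
  finally have "crit_time h ^ 3 = x" by (simp add: crit_time_def x_def)
  then show ?thesis using h \<sigma>_pos by (simp add: x_def)
qed

lemma crit_time_pos: "h \<noteq> 0 \<Longrightarrow> 0 < crit_time h"
  using \<sigma>_pos by (simp add: crit_time_def)

definition time_weight :: "'x \<Rightarrow> ennreal" where "time_weight h = (if h = 0 then 0 else ennreal (1 / (crit_time h)\<^sup>2))"

lemma time_weight_measurable[measurable]: "time_weight \<in> borel_measurable borel"
  unfolding time_weight_def[abs_def] by measurable

lemma time_weight_T: "time_weight h * ennreal (crit_time h) * ennreal (crit_time h) \<le> 1"
  using crit_time_pos[of h]
  by (auto simp: time_weight_def mult.assoc power2_eq_square simp flip: ennreal_mult)

definition sqint :: "('z \<Rightarrow> complex) \<Rightarrow> 'z \<Rightarrow> ennreal" where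
  "sqint f z = (ennreal (norm (f z)))\<^sup>2"

lemma sqint_measurable[measurable (raw)]:
  assumes [measurable]: "f \<in> borel_measurable borel" "h \<in> borel_measurable M"
  shows "(\<lambda>x. sqint f (h x)) \<in> borel_measurable M"
  unfolding sqint_def by measurable

lemma nn_integral_sqint: "(\<integral>\<^sup>+z. sqint f z \<partial>lborel) = nsq f"
  unfolding nsq_def sqint_def by (simp add: ennreal_power)

text \<open>By \<open>nn_integral_S\<close> the endpoint term has the same weighted integral as the
  left-hand side, with the factor 2 (1/2)^2 = 1/2, and can be subtracted. Subtraction needs a finite
  quantity, which is why the weight is first restricted to |h| \<le> K.\<close>

lemma subelliptic_weight:
  assumes U: "L2 U" and G: "L2 G" and sub: "AE z in lborel. subsolution U G crit_time z"
  shows "(\<integral>\<^sup>+z. time_weight (H z) * sqint U z \<partial>lborel) \<le> 4 * nsq G"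
proof -
  have [measurable]: "U \<in> borel_measurable borel" "G \<in> borel_measurable borel" using U G by (auto simp: L2_iff)
  define \<omega> where "\<omega> K h = (if norm h \<le> real K then time_weight h else 0)" for K :: nat and h
  have [measurable]: "\<omega> K \<in> borel_measurable borel" for K unfolding \<omega>_def[abs_def] by measurable
  have "(\<integral>\<^sup>+z. \<omega> K (H z) * sqint U z \<partial>lborel) \<le> 4 * nsq G" for K
  proof -
    define I where "I = (\<integral>\<^sup>+z. \<omega> K (H z) * sqint U z \<partial>lborel)"
    \<comment> \<open>\<open>crit_time\<close> decreases in |h|, so for 0 < |h| \<le> K the weight
      1/T^2 is at most its value at |h| = K.\<close>
    define C where "C = ennreal (1 / ((12 / (\<sigma> * (real K)\<^sup>2)) powr (1/3))\<^sup>2)"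
    have "\<omega> K h \<le> C" for h
    proof (cases "h \<noteq> 0 \<and> norm h \<le> real K")
      case True
      then have "0 < norm h" by simp
      then have "0 < real K" using True by linarith
      have "(12 / (\<sigma> * (real K)\<^sup>2)) powr (1/3) \<le> crit_time h"
        unfolding crit_time_def using True \<sigma>_pos \<open>0 < norm h\<close> \<open>0 < real K\<close>
        by (intro powr_mono2 divide_left_mono mult_left_mono power_mono mult_pos_pos) auto
      then have "1 / (crit_time h)\<^sup>2 \<le> 1 / ((12 / (\<sigma> * (real K)\<^sup>2)) powr (1/3))\<^sup>2"
        using \<sigma>_pos \<open>0 < real K\<close> True by (intro divide_left_mono power_mono mult_pos_pos) (auto simp: crit_time_pos)
      then show ?thesis using True by (simp add: \<omega>_def time_weight_def C_def ennreal_leI)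
    qed (auto simp: \<omega>_def time_weight_def)
    then have "I \<le> (\<integral>\<^sup>+z. C * sqint U z \<partial>lborel)"
      unfolding I_def by (intro nn_integral_mono mult_right_mono) auto
    also have "\<dots> = C * nsq U" by (subst nn_integral_cmult) (auto simp: nn_integral_sqint)
    also have "\<dots> < top" using U by (auto simp: L2_iff C_def ennreal_mult_less_top)
    finally have fin: "I < top" .
    have "I \<le> (\<integral>\<^sup>+z. (ennreal (1/2) * (\<omega> K (H z) * sqint U (S (crit_time (H z)) z))
       + (2 * \<omega> K (H z) * ennreal (crit_time (H z))) * (\<integral>\<^sup>+r. window (crit_time (H z)) r * sqint G (S r z) \<partial>lborel)) \<partial>lborel)"
      unfolding I_def
    proof (rule nn_integral_mono_AE)
      show "AE z in lborel. \<omega> K (H z) * sqint U z \<le> ennreal (1/2) * (\<omega> K (H z) * sqint U (S (crit_time (H z)) z))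
       + (2 * \<omega> K (H z) * ennreal (crit_time (H z))) * (\<integral>\<^sup>+r. window (crit_time (H z)) r * sqint G (S r z) \<partial>lborel)"
        using sub
      proof eventually_elim
        case (elim z)
        show ?case
        proof (cases "H z = 0")
          case False
          \<comment> \<open>At this time the lower bound for the damping is exactly 1, and exp (-1)
            \<le> 1/2 because e \<ge> 2.\<close>
          have "1 = \<sigma> * (norm (H z))\<^sup>2 * crit_time (H z) ^ 3 / 12" by (simp add: crit_time_cube[OF False])
          also have "\<dots> \<le> A z (crit_time (H z))" by (rule A_lower[OF crit_time_nonneg])
          finally have A1: "1 \<le> A z (crit_time (H z))" .
          have "exp (- A z (crit_time (H z))) \<le> exp (- 1)" using A1 by simp
          also have "\<dots> \<le> 1 / 2"
            using exp_ge_add_one_self[of 1] by (simp add: exp_minus field_simps)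
          finally have k: "exp (- A z (crit_time (H z))) \<le> 1/2" .
          have "sqint U z \<le> 2 * (ennreal (1/2) * ennreal (norm (U (S (crit_time (H z)) z))))\<^sup>2
            + 2 * ((\<integral>\<^sup>+r. window (crit_time (H z)) r * ennreal (exp (- 0 * r)) \<partial>lborel)
            * (\<integral>\<^sup>+r. window (crit_time (H z)) r * (ennreal (exp (- 0 * r)) * (ennreal (norm (G (S r z))))\<^sup>2) \<partial>lborel))"
            unfolding sqint_def by (rule subsolution_sq[OF elim _ _ k]) (auto simp: A_nonneg)
          also have "\<dots> = ennreal (1/2) * sqint U (S (crit_time (H z)) z)
             + 2 * (ennreal (crit_time (H z)) * (\<integral>\<^sup>+r. window (crit_time (H z)) r * sqint G (S r z) \<partial>lborel))"
          proof -
            have "2 * (ennreal (1/2))\<^sup>2 = ennreal (1/2)"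
              by (subst ennreal_power, simp, subst ennreal_numeral_mult, simp) (simp add: power2_eq_square)
            then show ?thesis
              unfolding sqint_def power_mult_distrib
              by (simp add: nn_integral_window crit_time_nonneg mult.assoc[symmetric])
          qed
          finally have "\<omega> K (H z) * sqint U z \<le> \<omega> K (H z) * (ennreal (1/2) * sqint U (S (crit_time (H z)) z)
             + 2 * (ennreal (crit_time (H z)) * (\<integral>\<^sup>+r. window (crit_time (H z)) r * sqint G (S r z) \<partial>lborel)))"
            by (rule mult_left_mono) simp
          then show ?thesis by (simp add: distrib_left mult_ac)
        qed (simp add: \<omega>_def time_weight_def)
      qed
    qed
    also have "\<dots> = (\<integral>\<^sup>+z. ennreal (1/2) * (\<omega> K (H z) * sqint U (S (crit_time (H z)) z)) \<partial>lborel)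
       + (\<integral>\<^sup>+z. (2 * \<omega> K (H z) * ennreal (crit_time (H z))) * (\<integral>\<^sup>+r. window (crit_time (H z)) r * sqint G (S r z) \<partial>lborel) \<partial>lborel)"
      by (rule nn_integral_add) measurable
    also have "(\<integral>\<^sup>+z. ennreal (1/2) * (\<omega> K (H z) * sqint U (S (crit_time (H z)) z)) \<partial>lborel) = ennreal (1/2) * I"
    proof -
      have "(\<integral>\<^sup>+z. \<omega> K (H z) * sqint U (S (crit_time (H z)) z) \<partial>lborel) = I"
        using nn_integral_S[of "\<lambda>z. \<omega> K (H z) * sqint U z" crit_time] unfolding I_def by simp
      then show ?thesis by (subst nn_integral_cmult) auto
    qed
    also have "(\<integral>\<^sup>+z. (2 * \<omega> K (H z) * ennreal (crit_time (H z))) * (\<integral>\<^sup>+r. window (crit_time (H z)) r * sqint G (S r z) \<partial>lborel) \<partial>lborel)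
      = (\<integral>\<^sup>+z. (2 * \<omega> K (H z) * ennreal (crit_time (H z))) * ennreal (crit_time (H z)) * sqint G z \<partial>lborel)"
      by (rule nn_integral_S_average[of "sqint G" crit_time "\<lambda>h. 2 * \<omega> K h * ennreal (crit_time h)"]) (auto simp: crit_time_nonneg)
    also have "\<dots> \<le> (\<integral>\<^sup>+z. 2 * sqint G z \<partial>lborel)"
    proof (rule nn_integral_mono, rule mult_right_mono)
      fix z
      have "\<omega> K (H z) * ennreal (crit_time (H z)) * ennreal (crit_time (H z)) \<le> time_weight (H z) * ennreal (crit_time (H z)) * ennreal (crit_time (H z))"
        by (intro mult_right_mono) (auto simp: \<omega>_def)
      also have "\<dots> \<le> 1" by (rule time_weight_T)
      finally have le: "\<omega> K (H z) * ennreal (crit_time (H z)) * ennreal (crit_time (H z)) \<le> 1" .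
      show "2 * \<omega> K (H z) * ennreal (crit_time (H z)) * ennreal (crit_time (H z)) \<le> 2"
        using mult_left_mono[OF le, of 2] by (simp add: mult.assoc)
    qed simp
    also have "\<dots> = 2 * nsq G" by (subst nn_integral_cmult) (auto simp: nn_integral_sqint)
    finally have *: "I \<le> ennreal (1/2) * I + 2 * nsq G" by (simp add: add_left_mono)
    obtain i g where ig: "I = ennreal i" "0 \<le> i" "nsq G = ennreal g" "0 \<le> g"
      using fin G unfolding L2_iff by (metis ennreal_cases infinity_ennreal_def less_irrefl)
    have "ennreal i \<le> ennreal (i / 2 + 2 * g)"
    proof -
      have "ennreal (i / 2 + 2 * g) = ennreal (1/2 * i) + ennreal (2 * g)" using ig by simp
      also have "\<dots> = ennreal (1/2) * ennreal i + 2 * ennreal g"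
        by (subst ennreal_mult) (use ig in \<open>auto simp: ennreal_numeral_mult\<close>)
      finally show ?thesis using * ig by simp
    qed
    then have "i \<le> i / 2 + 2 * g" by (subst (asm) ennreal_le_iff) (use ig in auto)
    then have "i \<le> 4 * g" by linarith
    then have "ennreal i \<le> 4 * ennreal g" using ig by (subst ennreal_numeral_mult) (auto intro: ennreal_leI)
    then show ?thesis using ig unfolding I_def by simp
  qed
  moreover have "(\<lambda>K. \<integral>\<^sup>+z. \<omega> K (H z) * sqint U z \<partial>lborel) \<longlonglongrightarrow> (\<integral>\<^sup>+z. time_weight (H z) * sqint U z \<partial>lborel)"
  proof (rule nn_integral_LIMSEQ)
    show "incseq (\<lambda>K z. \<omega> K (H z) * sqint U z)"
      by (rule incseq_SucI, rule le_funI) (auto simp: \<omega>_def intro!: mult_right_mono)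
    fix z
    obtain N :: nat where N: "norm (H z) \<le> real N" using real_arch_simple by blast
    then have "\<forall>\<^sub>F K in sequentially. \<omega> K (H z) * sqint U z = time_weight (H z) * sqint U z"
      unfolding eventually_sequentially by (intro exI[of _ N]) (auto simp: \<omega>_def)
    then show "(\<lambda>K. \<omega> K (H z) * sqint U z) \<longlonglongrightarrow> time_weight (H z) * sqint U z"
      by (rule tendsto_eventually)
  qed measurable
  ultimately show ?thesis by (intro LIMSEQ_le_const2) auto
qed

text \<open>Qualitative only: just the finiteness is recorded. With a = \<sigma> |X|^2,
  Cauchy-Schwarz against the exponential weight gains 1/a, which pays for one of the two powers of
  a; the other is paid by the integral of the same exponential over the window, after the shear has
  been undone.\<close>

lemma elliptic_estimate:
  assumes U: "L2 U" and G: "L2 G" and sub: "AE z in lborel. subsolution U G crit_time z"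
  shows "L2 (\<lambda>z. complex_of_real ((norm (X z))\<^sup>2) * U z)"
proof -
  have [measurable]: "U \<in> borel_measurable borel" "G \<in> borel_measurable borel" using U G by (auto simp: L2_iff)
  define a where "a z = \<sigma> * (norm (X z))\<^sup>2" for z
  have [measurable]: "a \<in> borel_measurable borel" unfolding a_def[abs_def] by measurable
  have a0: "0 \<le> a z" for z using \<sigma>_pos by (simp add: a_def)
  \<comment> \<open>The integrand is expressed at the shifted point \<open>S r z\<close>, so that
    \<open>nn_integral_flow\<close> can undo the shift. The constants absorb the change of base
    point: 16 = 4 * 4 from a z \<le> 4 a (S r z), and 2/9 = 1/2 * 4/9 from 4 a (S r z) \<le> 9 a
    z.\<close>
  define \<Phi> where "\<Phi> r z = ennreal (16 * a z * exp (- (2/9 * a z) * r)) * sqint G z" for r z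
  have sG: "sqint G (S r z) = (ennreal (norm (G (S r z))))\<^sup>2" for r z by (simp add: sqint_def)
  have AE1: "AE z in lborel. (ennreal (a z))\<^sup>2 * sqint U z \<le> 2304 * (time_weight (H z) * sqint U z)
     + (8 * (time_weight (H z) * sqint U (S (crit_time (H z)) z)) + (\<integral>\<^sup>+r. window (crit_time (H z)) r * \<Phi> r (S r z) \<partial>lborel))"
    using sub AE_H_nonzero
  proof eventually_elim
    case (elim z)
    let ?T = "crit_time (H z)"
    define q where "q = norm (H z)"
    have q: "0 < q" using elim(2) by (simp add: q_def)
    have T: "0 < ?T" by (rule crit_time_pos[OF elim(2)])
    have cube: "\<sigma> * q\<^sup>2 * ?T ^ 3 = 12" unfolding q_def by (rule crit_time_cube[OF elim(2)])
    have time_weight: "time_weight (H z) = ennreal (1 / ?T\<^sup>2)" using elim(2) by (simp add: time_weight_def)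
    show ?case
    \<comment> \<open>The threshold 2 q T keeps the displacement q r at most half of |X| throughout
      the window in the second case, so |X (S r z)| stays between |X|/2 and 3|X|/2.\<close>
    proof (cases "norm (X z) \<le> 2 * q * ?T")
      case True
      \<comment> \<open>The definition of the critical time turns 4 \<sigma> q^2 T^2 into 48/T; the
        constant 2304 is 48^2.\<close>
      have "a z \<le> \<sigma> * (2 * q * ?T)\<^sup>2"
        unfolding a_def using \<sigma>_pos True by (intro mult_left_mono power_mono) auto
      also have "\<dots> = 4 * (\<sigma> * q\<^sup>2 * ?T ^ 3) / ?T"
        using T by (simp add: power2_eq_square power3_eq_cube)
      finally have "a z \<le> 48 / ?T" by (simp add: cube)
      then have "(a z)\<^sup>2 \<le> (48 / ?T)\<^sup>2" using a0 by (intro power_mono) auto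
      then have "(ennreal (a z))\<^sup>2 \<le> ennreal (2304 * (1 / ?T\<^sup>2))"
        using a0 by (simp add: ennreal_power power_divide ennreal_leI)
      also have "\<dots> = 2304 * time_weight (H z)" unfolding time_weight by (rule ennreal_numeral_mult[symmetric]) simp
      finally have le: "(ennreal (a z))\<^sup>2 \<le> 2304 * time_weight (H z)" .
      have "(ennreal (a z))\<^sup>2 * sqint U z \<le> 2304 * (time_weight (H z) * sqint U z)"
        unfolding mult.assoc[symmetric, of 2304] by (rule mult_right_mono[OF le]) simp
      then show ?thesis by (rule order_trans) simp
    next
      case False
      then have big: "2 * q * ?T < norm (X z)" by simp
      have Xpos: "0 < norm (X z)" using big q T by (smt (verit) mult_pos_pos)
      have apos: "0 < a z" using \<sigma>_pos Xpos by (simp add: a_def)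
      \<comment> \<open>The cross term is at least -|X| q r^2, hence at least -|X|^2 r / 2 as 2 q r
        \<le> |X|; the cubic term is nonnegative.\<close>
      have Alow: "a z / 2 * r \<le> A z r" if r: "0 \<le> r" "r \<le> ?T" for r
      proof -
        have qr: "2 * q * r \<le> norm (X z)" using big mult_left_mono[OF r(2), of "2 * q"] q by linarith
        have "- (norm (X z) * q) \<le> X z \<bullet> H z"
          using Cauchy_Schwarz_ineq2[of "X z" "H z"] unfolding q_def by (simp add: abs_le_iff)
        then have "- (norm (X z) * q) * r\<^sup>2 \<le> (X z \<bullet> H z) * r\<^sup>2" by (rule mult_right_mono) simp
        then have 1: "- (norm (X z) * q * r\<^sup>2) \<le> (X z \<bullet> H z) * r\<^sup>2" by simp
        have "norm (X z) * r * (2 * q * r) \<le> norm (X z) * r * norm (X z)"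
          by (rule mult_left_mono[OF qr]) (simp add: r)
        then have 2: "norm (X z) * q * r\<^sup>2 \<le> (norm (X z))\<^sup>2 * r / 2" by (simp add: power2_eq_square mult_ac)
        have 3: "0 \<le> q\<^sup>2 * r ^ 3 / 3" using r by simp
        have "(norm (X z))\<^sup>2 * r / 2 \<le> (norm (X z))\<^sup>2 * r + (X z \<bullet> H z) * r\<^sup>2 + q\<^sup>2 * r ^ 3 / 3"
          using 1 2 3 by linarith
        then show ?thesis
          unfolding A_def a_def q_def[symmetric] using mult_left_mono[of _ _ \<sigma>] \<sigma>_pos by (simp add: mult_ac)
      qed
      have "(ennreal (a z))\<^sup>2 * sqint U z \<le> (ennreal (a z))\<^sup>2 * (2 * (ennreal (exp (- (a z / 2 * ?T))) * ennreal (norm (U (S ?T z))))\<^sup>2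
        + 2 * ((\<integral>\<^sup>+r. window ?T r * ennreal (exp (- (a z / 2) * r)) \<partial>lborel)
         * (\<integral>\<^sup>+r. window ?T r * (ennreal (exp (- (a z / 2) * r)) * (ennreal (norm (G (S r z))))\<^sup>2) \<partial>lborel)))"
        unfolding sqint_def
        by (intro mult_left_mono subsolution_sq[OF elim(1)]) (use Alow T in auto)
      also have "\<dots> \<le> (ennreal (a z))\<^sup>2 * (2 * (ennreal (exp (- (a z / 2 * ?T))) * ennreal (norm (U (S ?T z))))\<^sup>2
        + 2 * (ennreal (1 / (a z / 2))
         * (\<integral>\<^sup>+r. window ?T r * (ennreal (exp (- (a z / 2) * r)) * sqint G (S r z)) \<partial>lborel)))"
        unfolding sG using apos by (intro mult_left_mono add_left_mono mult_right_mono nn_integral_window_exp) auto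
      also have "\<dots> = 2 * (ennreal (a z) * ennreal (exp (- (a z / 2 * ?T))))\<^sup>2 * sqint U (S ?T z)
        + ((ennreal (a z))\<^sup>2 * 2 * ennreal (1 / (a z / 2)))
         * (\<integral>\<^sup>+r. window ?T r * (ennreal (exp (- (a z / 2) * r)) * sqint G (S r z)) \<partial>lborel)"
        by (simp add: sqint_def distrib_left power_mult_distrib mult_ac)
      also have "\<dots> \<le> 8 * (time_weight (H z) * sqint U (S ?T z)) + (\<integral>\<^sup>+r. window ?T r * \<Phi> r (S r z) \<partial>lborel)"
      proof (rule add_mono)
        \<comment> \<open>x exp (-x) \<le> 1 with x = a T / 2: two powers of a against the squared
          endpoint damping give the weight 1/T^2 again.\<close>
        have "a z / 2 * ?T \<le> exp (a z / 2 * ?T)"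
          using exp_ge_add_one_self[of "a z / 2 * ?T"] by linarith
        then have "a z * exp (- (a z / 2 * ?T)) \<le> 2 / ?T"
          using T by (simp add: exp_minus field_simps)
        then have "(a z * exp (- (a z / 2 * ?T)))\<^sup>2 \<le> (2 / ?T)\<^sup>2"
          using a0 by (intro power_mono) auto
        then have "2 * (ennreal (a z) * ennreal (exp (- (a z / 2 * ?T))))\<^sup>2 \<le> 2 * ennreal (4 * (1 / ?T\<^sup>2))"
          using a0 by (intro mult_left_mono) (subst ennreal_mult[symmetric], simp_all add: ennreal_power power_divide ennreal_leI)
        also have "\<dots> = 8 * time_weight (H z)"
          unfolding time_weight by (simp add: ennreal_numeral_mult)
        finally have le: "2 * (ennreal (a z) * ennreal (exp (- (a z / 2 * ?T))))\<^sup>2 \<le> 8 * time_weight (H z)" .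
        show "2 * (ennreal (a z) * ennreal (exp (- (a z / 2 * ?T))))\<^sup>2 * sqint U (S ?T z) \<le> 8 * (time_weight (H z) * sqint U (S ?T z))"
          unfolding mult.assoc[symmetric, of 8] by (rule mult_right_mono[OF le]) simp
        have "(ennreal (a z))\<^sup>2 * 2 * ennreal (1 / (a z / 2)) = ennreal (4 * a z)"
        proof -
          have "(ennreal (a z))\<^sup>2 * 2 * ennreal (1 / (a z / 2)) = 2 * (ennreal ((a z)\<^sup>2) * ennreal (1 / (a z / 2)))"
            using a0 by (simp add: ennreal_power mult_ac)
          also have "\<dots> = ennreal (2 * ((a z)\<^sup>2 * (1 / (a z / 2))))"
            using apos by (subst ennreal_mult[symmetric], simp, simp, subst ennreal_numeral_mult) auto
          also have "2 * ((a z)\<^sup>2 * (1 / (a z / 2))) = 4 * a z" using apos by (simp add: power2_eq_square)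
          finally show ?thesis .
        qed
        then have "((ennreal (a z))\<^sup>2 * 2 * ennreal (1 / (a z / 2)))
          * (\<integral>\<^sup>+r. window ?T r * (ennreal (exp (- (a z / 2) * r)) * sqint G (S r z)) \<partial>lborel)
          = (\<integral>\<^sup>+r. ennreal (4 * a z) * (window ?T r * (ennreal (exp (- (a z / 2) * r)) * sqint G (S r z))) \<partial>lborel)"
          by (subst nn_integral_cmult) auto
        also have "\<dots> \<le> (\<integral>\<^sup>+r. window ?T r * \<Phi> r (S r z) \<partial>lborel)"
        proof (rule nn_integral_mono)
          fix r
          show "ennreal (4 * a z) * (window ?T r * (ennreal (exp (- (a z / 2) * r)) * sqint G (S r z))) \<le> window ?T r * \<Phi> r (S r z)"
          proof (cases "0 \<le> r \<and> r \<le> ?T")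
            case True
            have qr: "q * r \<le> norm (X z) / 2" using big mult_left_mono[of r ?T "2 * q"] True q by linarith
            have nr: "norm (r *\<^sub>R H z) = q * r" using True by (simp add: q_def)
            have "norm (X z) / 2 \<le> norm (X (S r z))"
              unfolding X_S using norm_diff_ineq[of "X z" "r *\<^sub>R H z"] nr qr by linarith
            then have "(norm (X z) / 2)\<^sup>2 \<le> (norm (X (S r z)))\<^sup>2" by (rule power_mono) simp
            then have a1: "a z \<le> 4 * a (S r z)" unfolding a_def using \<sigma>_pos by (simp add: power_divide)
            have "norm (X (S r z)) \<le> 3/2 * norm (X z)"
              unfolding X_S using norm_triangle_ineq[of "X z" "r *\<^sub>R H z"] nr qr by linarith
            then have "(norm (X (S r z)))\<^sup>2 \<le> (3/2 * norm (X z))\<^sup>2" by (rule power_mono) simp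
            then have a2: "4 * a (S r z) \<le> 9 * a z" unfolding a_def using \<sigma>_pos by (simp add: power_mult_distrib power_divide)
            have "(2/9 * a (S r z)) * r \<le> a z / 2 * r" using a2 True by (intro mult_right_mono) auto
            then have "4 * a z * exp (- (a z / 2) * r) \<le> (16 * a (S r z)) * exp (- (2/9 * a (S r z)) * r)"
              using a1 a0 by (intro mult_mono[of "4 * a z"]) auto
            then have le: "ennreal (4 * a z) * ennreal (exp (- (a z / 2) * r)) \<le> ennreal (16 * a (S r z) * exp (- (2/9 * a (S r z)) * r))"
              using a0 by (subst ennreal_mult[symmetric]) (auto intro: ennreal_leI)
            show ?thesis
              using True mult_right_mono[OF le, of "sqint G (S r z)"] by (simp add: window_def \<Phi>_def mult.assoc)
          qed (auto simp: window_def)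
        qed
        finally show "((ennreal (a z))\<^sup>2 * 2 * ennreal (1 / (a z / 2)))
          * (\<integral>\<^sup>+r. window ?T r * (ennreal (exp (- (a z / 2) * r)) * sqint G (S r z)) \<partial>lborel)
          \<le> (\<integral>\<^sup>+r. window ?T r * \<Phi> r (S r z) \<partial>lborel)" .
      qed
      finally show ?thesis by (rule order_trans) simp
    qed
  qed
  have \<Phi>m[measurable]: "(\<lambda>x. \<Phi> (f x) (h x)) \<in> borel_measurable M"
    if [measurable]: "f \<in> borel_measurable M" "h \<in> borel_measurable M" for f h and M :: "'z measure"
    unfolding \<Phi>_def by measurable
  have \<Phi>m2[measurable]: "(\<lambda>x. \<Phi> (f x) (h x)) \<in> borel_measurable M"
    if [measurable]: "f \<in> borel_measurable M" "h \<in> borel_measurable M" for f h and M :: "('z \<times> real) measure"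
    unfolding \<Phi>_def by measurable
  have \<Phi>m3[measurable]: "(\<lambda>x. \<Phi> (f x) (h x)) \<in> borel_measurable M"
    if [measurable]: "f \<in> borel_measurable M" "h \<in> borel_measurable M" for f h and M :: "(real \<times> 'z) measure"
    unfolding \<Phi>_def by measurable
  have "(\<integral>\<^sup>+z. (ennreal (a z))\<^sup>2 * sqint U z \<partial>lborel) \<le> (\<integral>\<^sup>+z. 2304 * (time_weight (H z) * sqint U z)
     + (8 * (time_weight (H z) * sqint U (S (crit_time (H z)) z)) + (\<integral>\<^sup>+r. window (crit_time (H z)) r * \<Phi> r (S r z) \<partial>lborel)) \<partial>lborel)"
    by (rule nn_integral_mono_AE[OF AE1])
  also have "\<dots> = (\<integral>\<^sup>+z. 2304 * (time_weight (H z) * sqint U z) \<partial>lborel)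
     + (\<integral>\<^sup>+z. (8 * (time_weight (H z) * sqint U (S (crit_time (H z)) z)) + (\<integral>\<^sup>+r. window (crit_time (H z)) r * \<Phi> r (S r z) \<partial>lborel)) \<partial>lborel)"
    by (rule nn_integral_add) measurable
  also have "(\<integral>\<^sup>+z. (8 * (time_weight (H z) * sqint U (S (crit_time (H z)) z)) + (\<integral>\<^sup>+r. window (crit_time (H z)) r * \<Phi> r (S r z) \<partial>lborel)) \<partial>lborel)
     = (\<integral>\<^sup>+z. 8 * (time_weight (H z) * sqint U (S (crit_time (H z)) z)) \<partial>lborel) + (\<integral>\<^sup>+z. (\<integral>\<^sup>+r. window (crit_time (H z)) r * \<Phi> r (S r z) \<partial>lborel) \<partial>lborel)"
    by (rule nn_integral_add) measurable
  also have "(\<integral>\<^sup>+z. 2304 * (time_weight (H z) * sqint U z) \<partial>lborel) = 2304 * (\<integral>\<^sup>+z. time_weight (H z) * sqint U z \<partial>lborel)"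
    by (rule nn_integral_cmult) measurable
  also have "(\<integral>\<^sup>+z. 8 * (time_weight (H z) * sqint U (S (crit_time (H z)) z)) \<partial>lborel) = 8 * (\<integral>\<^sup>+z. time_weight (H z) * sqint U z \<partial>lborel)"
    using nn_integral_S[of "\<lambda>z. time_weight (H z) * sqint U z" crit_time] by (subst nn_integral_cmult) auto
  also have "(\<integral>\<^sup>+z. (\<integral>\<^sup>+r. window (crit_time (H z)) r * \<Phi> r (S r z) \<partial>lborel) \<partial>lborel) = (\<integral>\<^sup>+z. (\<integral>\<^sup>+r. window (crit_time (H z)) r * \<Phi> r z \<partial>lborel) \<partial>lborel)"
    by (rule nn_integral_flow) measurable
  also have "\<dots> \<le> (\<integral>\<^sup>+z. 72 * sqint G z \<partial>lborel)"
  proof (rule nn_integral_mono)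
    fix z
    show "(\<integral>\<^sup>+r. window (crit_time (H z)) r * \<Phi> r z \<partial>lborel) \<le> 72 * sqint G z"
    proof (cases "a z = 0")
      case False
      then have apos: "0 < a z" using a0[of z] by simp
      have "(\<integral>\<^sup>+r. window (crit_time (H z)) r * \<Phi> r z \<partial>lborel)
        = (\<integral>\<^sup>+r. (ennreal (16 * a z) * sqint G z) * (window (crit_time (H z)) r * ennreal (exp (- (2/9 * a z) * r))) \<partial>lborel)"
        unfolding \<Phi>_def using a0 by (intro nn_integral_cong) (simp add: ennreal_mult mult_ac)
      also have "\<dots> = (ennreal (16 * a z) * sqint G z) * (\<integral>\<^sup>+r. window (crit_time (H z)) r * ennreal (exp (- (2/9 * a z) * r)) \<partial>lborel)"
        by (rule nn_integral_cmult) measurable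
      also have "\<dots> \<le> (ennreal (16 * a z) * sqint G z) * ennreal (1 / (2/9 * a z))"
        using apos by (intro mult_left_mono nn_integral_window_exp) auto
      also have "\<dots> = (ennreal (16 * a z) * ennreal (1 / (2/9 * a z))) * sqint G z" by (simp only: mult_ac)
      \<comment> \<open>The powers of a cancel here, 16 * 9/2 = 72, so the bound is uniform in
        |X|.\<close>
      also have "ennreal (16 * a z) * ennreal (1 / (2/9 * a z)) = 72"
        using apos by (simp flip: ennreal_mult)
      finally show ?thesis .
    qed (simp add: \<Phi>_def)
  qed
  also have "\<dots> = 72 * nsq G" by (subst nn_integral_cmult) (auto simp: nn_integral_sqint)
  finally have le: "(\<integral>\<^sup>+z. (ennreal (a z))\<^sup>2 * sqint U z \<partial>lborel) \<le>
     2304 * (\<integral>\<^sup>+z. time_weight (H z) * sqint U z \<partial>lborel) + (8 * (\<integral>\<^sup>+z. time_weight (H z) * sqint U z \<partial>lborel) + 72 * nsq G)"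
    by (simp add: add_left_mono)
  have "(\<integral>\<^sup>+z. time_weight (H z) * sqint U z \<partial>lborel) < top"
    using subelliptic_weight[OF U G sub] G by (auto simp: L2_iff ennreal_mult_less_top intro: le_less_trans)
  then have "(\<integral>\<^sup>+z. (ennreal (a z))\<^sup>2 * sqint U z \<partial>lborel) < top"
    using le G by (auto simp: L2_iff ennreal_mult_less_top intro: le_less_trans)
  also have "(\<integral>\<^sup>+z. (ennreal (a z))\<^sup>2 * sqint U z \<partial>lborel) = (\<integral>\<^sup>+z. ennreal (\<sigma>\<^sup>2) * ennreal ((norm (complex_of_real ((norm (X z))\<^sup>2) * U z))\<^sup>2) \<partial>lborel)"
    using \<sigma>_pos by (intro nn_integral_cong)
      (simp add: a_def sqint_def norm_mult norm_power power_mult_distrib ennreal_power flip: ennreal_mult)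
  also have "\<dots> = ennreal (\<sigma>\<^sup>2) * nsq (\<lambda>z. complex_of_real ((norm (X z))\<^sup>2) * U z)"
    unfolding nsq_def by (rule nn_integral_cmult) measurable
  finally have "nsq (\<lambda>z. complex_of_real ((norm (X z))\<^sup>2) * U z) < top"
    using \<sigma>_pos by (auto simp: ennreal_mult_less_top)
  then show ?thesis unfolding L2_iff by simp
qed

text \<open>The damping enters only through A \<ge> 0, so \<sigma> does not occur in the bound. At
  an end of the window with |X| \<ge> T|H|/2 the weight |H|^(2/3) is at most |X|^2 / \<epsilon>^2;
  if this is the starting point, the estimate is immediate, otherwise the inequality leads to the
  far end. The 4 is the sum of the two ends, and 8 = 2 * 2^2 comes from the factor 2 in T.\<close>

lemma interpolation_estimate:
  assumes [measurable]: "U \<in> borel_measurable borel" "G \<in> borel_measurable borel"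
    and e: "0 < \<epsilon>" and sub: "AE z in lborel. subsolution U G (\<lambda>h. 2 * \<epsilon> * norm h powr (-2/3)) z"
  shows "nsq (\<lambda>z. complex_of_real (norm (H z) powr (2/3)) * U z) \<le>
    ennreal (4 / \<epsilon> ^ 4) * nsq (\<lambda>z. complex_of_real ((norm (X z))\<^sup>2) * U z) + ennreal (8 * \<epsilon>\<^sup>2) * nsq G"
proof -
  define T where "T h = 2 * \<epsilon> * norm h powr (-2/3)" for h :: 'x
  have [measurable]: "T \<in> borel_measurable borel" unfolding T_def[abs_def] by measurable
  have T0: "0 \<le> T h" for h using e by (simp add: T_def)
  define W where "W z = complex_of_real ((norm (X z))\<^sup>2) * U z" for z
  have [measurable]: "W \<in> borel_measurable borel" unfolding W_def[abs_def] by measurable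
  define \<mu> where "\<mu> h = ennreal ((norm h powr (2/3))\<^sup>2)" for h :: 'x
  have [measurable]: "\<mu> \<in> borel_measurable borel" unfolding \<mu>_def[abs_def] by measurable
  have AE1: "AE z in lborel. \<mu> (H z) * sqint U z \<le> ennreal (2 / \<epsilon> ^ 4) * sqint W z + (ennreal (2 / \<epsilon> ^ 4) * sqint W (S (T (H z)) z)
     + (2 * \<mu> (H z) * ennreal (T (H z))) * (\<integral>\<^sup>+r. window (T (H z)) r * sqint G (S r z) \<partial>lborel))"
    using sub AE_H_nonzero
  proof eventually_elim
    case (elim z)
    define q where "q = norm (H z)"
    have q: "0 < q" using elim(2) by (simp add: q_def)
    define t where "t = T (H z)"
    have t: "t = 2 * \<epsilon> * q powr (-2/3)" "0 < t" using e q by (auto simp: t_def T_def q_def)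
    have \<mu>: "\<mu> (H z) = ennreal ((q powr (2/3))\<^sup>2)" by (simp add: \<mu>_def q_def)
    \<comment> \<open>T q / 2 = \<epsilon> q^(1/3), whose square is \<epsilon>^2 q^(2/3); the
      comparison with |X|^2 is then squared once more, whence \<epsilon>^(-4).\<close>
    have key: "\<mu> (H z) * sqint U y \<le> ennreal (1 / \<epsilon> ^ 4) * sqint W y" if "t * q / 2 \<le> norm (X y)" for y
    proof -
      have "q powr (2/3) * \<epsilon>\<^sup>2 = (t * q / 2)\<^sup>2"
      proof -
        have "(q powr (-2/3) * q)\<^sup>2 = q powr (2/3)"
        proof -
          have "q powr (-2/3) * q = q powr (1/3)" using q powr_add[of q "-2/3" 1] by simp
          then show ?thesis using q by (simp add: powr_powr power2_eq_square flip: powr_add)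
        qed
        then show ?thesis unfolding t(1) by (simp add: power_mult_distrib power_divide mult_ac)
      qed
      also have "\<dots> \<le> (norm (X y))\<^sup>2" using that t(2) q by (intro power_mono) auto
      finally have "q powr (2/3) * \<epsilon>\<^sup>2 * norm (U y) \<le> (norm (X y))\<^sup>2 * norm (U y)" by (rule mult_right_mono) simp
      then have "q powr (2/3) * norm (U y) \<le> norm (W y) / \<epsilon>\<^sup>2"
        using e by (simp add: W_def norm_mult norm_power field_simps)
      then have "(q powr (2/3) * norm (U y))\<^sup>2 \<le> (norm (W y) / \<epsilon>\<^sup>2)\<^sup>2" by (rule power_mono) simp
      then have "(q powr (2/3))\<^sup>2 * (norm (U y))\<^sup>2 \<le> 1 / \<epsilon> ^ 4 * (norm (W y))\<^sup>2"
        by (simp add: power_mult_distrib power_divide power_mult[symmetric])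
      then have "ennreal ((q powr (2/3))\<^sup>2 * (norm (U y))\<^sup>2) \<le> ennreal (1 / \<epsilon> ^ 4 * (norm (W y))\<^sup>2)" by (rule ennreal_leI)
      moreover have "\<mu> (H z) * sqint U y = ennreal ((q powr (2/3))\<^sup>2 * (norm (U y))\<^sup>2)"
        by (simp add: \<mu> sqint_def ennreal_mult ennreal_power)
      moreover have "ennreal (1 / \<epsilon> ^ 4 * (norm (W y))\<^sup>2) = ennreal (1 / \<epsilon> ^ 4) * sqint W y"
        unfolding sqint_def ennreal_power[OF norm_ge_zero] by (rule ennreal_mult) (use e in auto)
      ultimately show ?thesis by (simp only:)
    qed
    \<comment> \<open>The two ends are at distance T q, so they cannot both be closer to the origin
      than T q / 2.\<close>
    have "norm (X (S t z) - X z) = t * q" using t(2) by (simp add: X_S q_def)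
    then have or: "t * q / 2 \<le> norm (X z) \<or> t * q / 2 \<le> norm (X (S t z))"
      using norm_triangle_ineq4[of "X (S t z)" "X z"] by linarith
    have le2: "ennreal (1 / \<epsilon> ^ 4) \<le> ennreal (2 / \<epsilon> ^ 4)" using e by (intro ennreal_leI divide_right_mono) auto
    from or show ?case
    proof
      assume "t * q / 2 \<le> norm (X z)"
      from key[OF this] have "\<mu> (H z) * sqint U z \<le> ennreal (2 / \<epsilon> ^ 4) * sqint W z"
        using mult_right_mono[OF le2, of "sqint W z"] by (rule order_trans) simp
      then show ?thesis by (rule order_trans) simp
    next
      assume b: "t * q / 2 \<le> norm (X (S t z))"
      have "sqint U z \<le> 2 * (ennreal 1 * ennreal (norm (U (S (T (H z)) z))))\<^sup>2
            + 2 * ((\<integral>\<^sup>+r. window (T (H z)) r * ennreal (exp (- 0 * r)) \<partial>lborel)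
            * (\<integral>\<^sup>+r. window (T (H z)) r * (ennreal (exp (- 0 * r)) * (ennreal (norm (G (S r z))))\<^sup>2) \<partial>lborel))"
        unfolding sqint_def
        by (rule subsolution_sq) (use elim(1) T0 in \<open>auto simp: A_nonneg T_def[abs_def]\<close>)
      also have "\<dots> = 2 * sqint U (S t z) + 2 * (ennreal t * (\<integral>\<^sup>+r. window (T (H z)) r * sqint G (S r z) \<partial>lborel))"
        by (simp add: sqint_def t_def nn_integral_window T0)
      finally have "\<mu> (H z) * sqint U z \<le> \<mu> (H z) * (2 * sqint U (S t z) + 2 * (ennreal t * (\<integral>\<^sup>+r. window (T (H z)) r * sqint G (S r z) \<partial>lborel)))"
        by (rule mult_left_mono) simp
      also have "\<dots> = 2 * (\<mu> (H z) * sqint U (S t z)) + (2 * \<mu> (H z) * ennreal t) * (\<integral>\<^sup>+r. window (T (H z)) r * sqint G (S r z) \<partial>lborel)"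
        by (simp add: distrib_left mult_ac)
      also have "\<dots> \<le> 2 * (ennreal (1 / \<epsilon> ^ 4) * sqint W (S t z)) + (2 * \<mu> (H z) * ennreal t) * (\<integral>\<^sup>+r. window (T (H z)) r * sqint G (S r z) \<partial>lborel)"
        by (intro add_right_mono mult_left_mono key[OF b]) simp
      also have "2 * (ennreal (1 / \<epsilon> ^ 4) * sqint W (S t z)) = ennreal (2 / \<epsilon> ^ 4) * sqint W (S t z)"
      proof -
        have "2 * ennreal (1 / \<epsilon> ^ 4) = ennreal (2 / \<epsilon> ^ 4)" using e by (simp add: ennreal_numeral_mult)
        then show ?thesis by (simp only: mult.assoc[symmetric])
      qed
      finally show ?thesis unfolding t_def by (rule order_trans) simp
    qed
  qed
  have "nsq (\<lambda>z. complex_of_real (norm (H z) powr (2/3)) * U z) = (\<integral>\<^sup>+z. \<mu> (H z) * sqint U z \<partial>lborel)"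
    unfolding nsq_def \<mu>_def sqint_def
    by (intro nn_integral_cong) (simp add: norm_mult power_mult_distrib ennreal_power flip: ennreal_mult)
  also have "\<dots> \<le> (\<integral>\<^sup>+z. ennreal (2 / \<epsilon> ^ 4) * sqint W z + (ennreal (2 / \<epsilon> ^ 4) * sqint W (S (T (H z)) z)
     + (2 * \<mu> (H z) * ennreal (T (H z))) * (\<integral>\<^sup>+r. window (T (H z)) r * sqint G (S r z) \<partial>lborel)) \<partial>lborel)"
    by (rule nn_integral_mono_AE[OF AE1])
  also have "\<dots> = (\<integral>\<^sup>+z. ennreal (2 / \<epsilon> ^ 4) * sqint W z \<partial>lborel) + (\<integral>\<^sup>+z. ennreal (2 / \<epsilon> ^ 4) * sqint W (S (T (H z)) z)
     + (2 * \<mu> (H z) * ennreal (T (H z))) * (\<integral>\<^sup>+r. window (T (H z)) r * sqint G (S r z) \<partial>lborel) \<partial>lborel)"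
    by (rule nn_integral_add) measurable
  also have "(\<integral>\<^sup>+z. ennreal (2 / \<epsilon> ^ 4) * sqint W (S (T (H z)) z)
     + (2 * \<mu> (H z) * ennreal (T (H z))) * (\<integral>\<^sup>+r. window (T (H z)) r * sqint G (S r z) \<partial>lborel) \<partial>lborel)
     = (\<integral>\<^sup>+z. ennreal (2 / \<epsilon> ^ 4) * sqint W (S (T (H z)) z) \<partial>lborel)
     + (\<integral>\<^sup>+z. (2 * \<mu> (H z) * ennreal (T (H z))) * (\<integral>\<^sup>+r. window (T (H z)) r * sqint G (S r z) \<partial>lborel) \<partial>lborel)"
    by (rule nn_integral_add) measurable
  also have "(\<integral>\<^sup>+z. ennreal (2 / \<epsilon> ^ 4) * sqint W (S (T (H z)) z) \<partial>lborel) = (\<integral>\<^sup>+z. ennreal (2 / \<epsilon> ^ 4) * sqint W z \<partial>lborel)"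
    by (rule nn_integral_S) measurable
  also have "(\<integral>\<^sup>+z. ennreal (2 / \<epsilon> ^ 4) * sqint W z \<partial>lborel) = ennreal (2 / \<epsilon> ^ 4) * nsq W"
    by (subst nn_integral_cmult) (auto simp: nn_integral_sqint)
  also have "(\<integral>\<^sup>+z. (2 * \<mu> (H z) * ennreal (T (H z))) * (\<integral>\<^sup>+r. window (T (H z)) r * sqint G (S r z) \<partial>lborel) \<partial>lborel)
    = (\<integral>\<^sup>+z. (2 * \<mu> (H z) * ennreal (T (H z))) * ennreal (T (H z)) * sqint G z \<partial>lborel)"
    by (rule nn_integral_S_average[of "sqint G" T "\<lambda>h. 2 * \<mu> h * ennreal (T h)"]) (auto simp: T0)
  also have "\<dots> \<le> (\<integral>\<^sup>+z. ennreal (8 * \<epsilon>\<^sup>2) * sqint G z \<partial>lborel)"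
  proof (rule nn_integral_mono, rule mult_right_mono)
    fix z
    \<comment> \<open>|H|^(2/3) T = 2 \<epsilon> away from H = 0: this cancellation is the reason
      for the exponent -2/3 in the time.\<close>
    have "2 * ((norm (H z) powr (2/3))\<^sup>2 * (T (H z) * T (H z))) \<le> 8 * \<epsilon>\<^sup>2"
    proof (cases "H z = 0")
      case False
      then have "norm (H z) powr (2/3) * norm (H z) powr (-2/3) = 1" by (simp flip: powr_add)
      then have "norm (H z) powr (2/3) * T (H z) = 2 * \<epsilon>" by (simp add: T_def mult_ac)
      then have "(norm (H z) powr (2/3) * T (H z))\<^sup>2 = (2 * \<epsilon>)\<^sup>2" by simp
      then show ?thesis by (simp add: power2_eq_square mult_ac)
    qed simp
    then have "ennreal (2 * ((norm (H z) powr (2/3))\<^sup>2 * (T (H z) * T (H z)))) \<le> ennreal (8 * \<epsilon>\<^sup>2)" by (rule ennreal_leI)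
    then show "2 * \<mu> (H z) * ennreal (T (H z)) * ennreal (T (H z)) \<le> ennreal (8 * \<epsilon>\<^sup>2)"
      unfolding \<mu>_def using T0 by (simp add: ennreal_mult mult.assoc)
  qed simp
  also have "\<dots> = ennreal (8 * \<epsilon>\<^sup>2) * nsq G" by (subst nn_integral_cmult) (auto simp: nn_integral_sqint)
  finally have "nsq (\<lambda>z. complex_of_real (norm (H z) powr (2/3)) * U z) \<le>
    ennreal (2 / \<epsilon> ^ 4) * nsq W + (ennreal (2 / \<epsilon> ^ 4) * nsq W + ennreal (8 * \<epsilon>\<^sup>2) * nsq G)"
    by (simp add: add_left_mono)
  also have "\<dots> = ennreal (4 / \<epsilon> ^ 4) * nsq W + ennreal (8 * \<epsilon>\<^sup>2) * nsq G"
  proof -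
    have "ennreal (4 / \<epsilon> ^ 4) = ennreal (2 / \<epsilon> ^ 4) + ennreal (2 / \<epsilon> ^ 4)"
      using e by (simp flip: ennreal_plus)
    then show ?thesis by (simp add: distrib_right add.assoc)
  qed
  finally show ?thesis unfolding W_def .
qed

end

section \<open>Fourier transforms of functions with bounded support\<close>

text \<open>|v| \<le> 1 + |v|^2 on a ball of finite measure that contains the support.\<close>

lemma bounded_support_integrable:
  assumes v: "L2 v" and R: "\<And>z. v z \<noteq> 0 \<Longrightarrow> norm z \<le> R" shows "integrable lborel v"
proof (rule Bochner_Integration.integrable_bound)
  show "integrable lborel (\<lambda>z. indicator (cball 0 R) z + (norm (v z))\<^sup>2 :: real)"
    by (intro Bochner_Integration.integrable_add integrable_indicator_cball L2_integrable_sq v)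
  have "norm (v z) \<le> indicator (cball 0 R) z + (norm (v z))\<^sup>2" for z
  proof (cases "v z = 0")
    case False
    then have "indicator (cball 0 R) z = (1::real)" using R by simp
    moreover have "norm (v z) \<le> 1 + (norm (v z))\<^sup>2"
    proof -
      have "2 * norm (v z) \<le> 1 + (norm (v z))\<^sup>2" using sum_squares_bound[of 1 "norm (v z)"] by simp
      then show ?thesis using norm_ge_zero[of "v z"] by linarith
    qed
    ultimately show ?thesis by simp
  qed simp
  then show "AE z in lborel. norm (v z) \<le> norm (indicator (cball 0 R) z + (norm (v z))\<^sup>2 :: real)"
    by simp
qed (use v in \<open>simp add: L2_iff\<close>)

text \<open>The truncations of \<open>v\<close> have transforms that converge pointwise to the
  integral and in norm to the L2 extension; Fatou compares the two limits.\<close>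

lemma fourier_bounded_support:
  fixes v W :: "'a::euclidean_space \<Rightarrow> complex"
  assumes e: "fourier.ext v W" and R: "\<And>z. v z \<noteq> 0 \<Longrightarrow> norm z \<le> R"
  shows "AE z in lborel. fourier v z = W z"
proof -
  note v = fourier.extD(1)[OF e]
  have vi: "integrable lborel v" by (rule bounded_support_integrable[OF v R])
  have [measurable]: "v \<in> borel_measurable borel" "W \<in> borel_measurable borel"
    using v fourier.extD(2)[OF e] by (auto simp: L2_iff)
  have b: "bcs (truncate n v)" for n by (rule bcs_truncate) measurable
  have lim: "(\<lambda>n. fourier (truncate n v) \<xi>) \<longlonglongrightarrow> fourier v \<xi>" for \<xi>
    unfolding fourier_def
  proof (rule integral_dominated_convergence[where w="\<lambda>z. norm (v z)"])
    show "AE y in lborel. (\<lambda>n. exp (- \<i> * complex_of_real (y \<bullet> \<xi>)) * truncate n v y) \<longlonglongrightarrow> exp (- \<i> * complex_of_real (y \<bullet> \<xi>)) * v y"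
      by (intro AE_I2 tendsto_mult tendsto_const tendsto_eventually eventually_truncate_eq)
    show "AE y in lborel. norm (exp (- \<i> * complex_of_real (y \<bullet> \<xi>)) * truncate n v y) \<le> norm (v y)" for n
      by (simp add: norm_mult truncate_def)
  qed (use vi in auto)
  have "nsq (\<lambda>z. fourier v z - W z) = (\<integral>\<^sup>+z. liminf (\<lambda>n. ennreal ((norm (fourier (truncate n v) z - W z))\<^sup>2)) \<partial>lborel)"
    unfolding nsq_def
  proof (rule nn_integral_cong)
    fix z
    have "(\<lambda>n. ennreal ((norm (fourier (truncate n v) z - W z))\<^sup>2)) \<longlonglongrightarrow> ennreal ((norm (fourier v z - W z))\<^sup>2)"
      by (intro tendsto_intros lim)
    from lim_imp_Liminf[OF trivial_limit_sequentially this]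
    show "ennreal ((norm (fourier v z - W z))\<^sup>2) = liminf (\<lambda>n. ennreal ((norm (fourier (truncate n v) z - W z))\<^sup>2))"
      by (rule sym)
  qed
  also have "\<dots> \<le> liminf (\<lambda>n. nsq (\<lambda>z. fourier (truncate n v) z - W z))"
    unfolding nsq_def by (intro nn_integral_liminf) measurable
  also have "\<dots> = 0"
  proof (rule lim_imp_Liminf)
    have "(\<lambda>n. ennreal ((L2norm (\<lambda>z. fourier (truncate n v) z - W z))\<^sup>2)) \<longlonglongrightarrow> ennreal (0\<^sup>2)"
      by (intro tendsto_ennrealI tendsto_power fourier.ext_tendsto e)
    then show "(\<lambda>n. nsq (\<lambda>z. fourier (truncate n v) z - W z)) \<longlonglongrightarrow> 0"
      by (simp add: nsq_L2norm L2_diff fourier.T_L2 b fourier.extD(2)[OF e])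
  qed simp
  finally have "nsq (\<lambda>z. fourier v z - W z) = 0" by simp
  then have "AE z in lborel. ennreal ((norm (fourier v z - W z))\<^sup>2) = 0"
    unfolding nsq_def by (subst (asm) nn_integral_0_iff_AE) measurable
  then show ?thesis by eventually_elim simp
qed

text \<open>The isometry gives convergence in L2; Cauchy-Schwarz against the indicator of a ball
  weakens it to the local L1 form that \<open>subsolution_limit\<close> takes.\<close>

lemma fourier_tendsto_local:
  fixes v :: "nat \<Rightarrow> 'a::euclidean_space \<Rightarrow> complex"
  assumes v: "\<And>n. L2 (v n)" and R: "\<And>n z. v n z \<noteq> 0 \<Longrightarrow> norm z \<le> R n"
    and e: "fourier.ext u W" and lim: "(\<lambda>n. L2norm (\<lambda>z. v n z - u z)) \<longlonglongrightarrow> 0"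
  shows "(\<lambda>n. \<integral>\<^sup>+z. indicator (cball 0 K) z * ennreal (norm (fourier (v n) z - W z)) \<partial>lborel) \<longlonglongrightarrow> 0"
proof -
  have [measurable]: "v n \<in> borel_measurable borel" "W \<in> borel_measurable borel" for n
    using v[of n] fourier.extD(2)[OF e] by (auto simp: L2_iff)
  define J where "J = (indicator (cball 0 K) :: 'a \<Rightarrow> ennreal)"
  have Jm[measurable]: "J \<in> borel_measurable borel" unfolding J_def by (intro borel_measurable_indicator) simp
  define c where "c = (2*pi) ^ DIM('a)"
  define b where "b = emeasure lborel (cball (0::'a) K)"
  have b: "b < top" unfolding b_def using emeasure_lborel_cball_finite[of "0::'a" K] by simp
  have nsq: "nsq (\<lambda>z. fourier (v n) z - W z) = ennreal (c * (L2norm (\<lambda>z. v n z - u z))\<^sup>2)" for n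
  proof -
    obtain Wn where Wn: "fourier.ext (v n) Wn" using fourier.ext_exists[OF v] by blast
    have "nsq (\<lambda>z. fourier (v n) z - W z) = nsq (\<lambda>z. Wn z - W z)"
    proof (rule nsq_cong_AE)
      have "AE z in lborel. fourier (v n) z = Wn z" by (rule fourier_bounded_support[OF Wn]) (rule R)
      then show "AE z in lborel. fourier (v n) z - W z = Wn z - W z" by eventually_elim simp
    qed
    also have "\<dots> = ennreal ((L2norm (\<lambda>z. Wn z - W z))\<^sup>2)"
      by (intro nsq_L2norm L2_diff fourier.extD(2)[OF Wn] fourier.extD(2)[OF e])
    also have "L2norm (\<lambda>z. Wn z - W z) = sqrt c * L2norm (\<lambda>z. v n z - u z)"
      unfolding c_def by (rule fourier.ext_norm[OF fourier.ext_diff[OF Wn e]])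
    finally show ?thesis by (simp add: power_mult_distrib c_def)
  qed
  have sq: "(\<integral>\<^sup>+z. J z * ennreal (norm (fourier (v n) z - W z)) \<partial>lborel)\<^sup>2 \<le> b * ennreal (c * (L2norm (\<lambda>z. v n z - u z))\<^sup>2)" for n
  proof -
    have "(\<integral>\<^sup>+z. J z * ennreal (norm (fourier (v n) z - W z)) \<partial>lborel)\<^sup>2 \<le>
       (\<integral>\<^sup>+z. (J z)\<^sup>2 \<partial>lborel) * (\<integral>\<^sup>+z. (ennreal (norm (fourier (v n) z - W z)))\<^sup>2 \<partial>lborel)"
      by (rule Cauchy_Schwarz_nn_integral) measurable
    also have "(\<integral>\<^sup>+z. (J z)\<^sup>2 \<partial>lborel) = b"
    proof -
      have "(J z)\<^sup>2 = J z" for z by (simp add: J_def indicator_def)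
      then show ?thesis by (simp add: J_def b_def)
    qed
    also have "(\<integral>\<^sup>+z. (ennreal (norm (fourier (v n) z - W z)))\<^sup>2 \<partial>lborel) = nsq (\<lambda>z. fourier (v n) z - W z)"
      unfolding nsq_def by (simp add: ennreal_power)
    finally show ?thesis unfolding nsq .
  qed
  have "(\<lambda>n. b * ennreal (c * (L2norm (\<lambda>z. v n z - u z))\<^sup>2)) \<longlonglongrightarrow> b * ennreal (c * 0\<^sup>2)"
    by (intro ennreal_tendsto_cmult b tendsto_ennrealI tendsto_mult tendsto_const tendsto_power lim)
  then have l0: "(\<lambda>n. b * ennreal (c * (L2norm (\<lambda>z. v n z - u z))\<^sup>2)) \<longlonglongrightarrow> 0" by simp
  have sq0: "(\<lambda>n. (\<integral>\<^sup>+z. J z * ennreal (norm (fourier (v n) z - W z)) \<partial>lborel)\<^sup>2) \<longlonglongrightarrow> 0"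
    by (rule tendsto_sandwich[OF _ always_eventually[OF allI[OF sq]] tendsto_const l0]) simp
  have "(\<lambda>n. \<integral>\<^sup>+z. J z * ennreal (norm (fourier (v n) z - W z)) \<partial>lborel) \<longlonglongrightarrow> 0"
  proof (rule order_tendstoI)
    fix a :: ennreal assume "0 < a"
    then have "0 < a\<^sup>2" by (simp add: zero_less_iff_neq_zero)
    from order_tendstoD(2)[OF sq0 this]
    show "\<forall>\<^sub>F n in sequentially. (\<integral>\<^sup>+z. J z * ennreal (norm (fourier (v n) z - W z)) \<partial>lborel) < a"
    proof eventually_elim
      case (elim n)
      then show ?case by (meson not_le power_mono zero_le leD)
    qed
  qed simp
  then show ?thesis unfolding J_def .
qed

text \<open>Bounded support makes |z.h| bounded where \<open>v\<close> is nonzero, so the Taylor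
  remainder |exp (i x) - 1 - i x| \<le> x^2/2 gives a quadratic error after integration. This is
  what the cutoff is for: it makes the transform differentiable along characteristics.\<close>

lemma fourier_line_derivative:
  fixes v :: "'a::euclidean_space \<Rightarrow> complex"
  assumes vi: "integrable lborel v" and R: "\<And>z. v z \<noteq> 0 \<Longrightarrow> norm z \<le> R"
  shows "((\<lambda>s. fourier v (\<zeta> + s *\<^sub>R h)) has_vector_derivative
      fourier (\<lambda>z. - \<i> * complex_of_real (z \<bullet> h) * v z) (\<zeta> + s *\<^sub>R h)) (at s)"
proof -
  have [measurable]: "v \<in> borel_measurable borel" using vi by auto
  define R' where "R' = \<bar>R\<bar> * norm h"
  have zh: "norm (complex_of_real (z \<bullet> h)) * norm (v z) \<le> R' * norm (v z)" for z
  proof (cases "v z = 0")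
    case False
    have "\<bar>z \<bullet> h\<bar> \<le> norm z * norm h" by (rule Cauchy_Schwarz_ineq2)
    also have "\<dots> \<le> R' " unfolding R'_def using R[OF False] by (intro mult_right_mono) auto
    finally show ?thesis by (intro mult_right_mono) auto
  qed simp
  have i1: "integrable lborel (\<lambda>z. - \<i> * complex_of_real (z \<bullet> h) * v z)"
  proof (rule Bochner_Integration.integrable_bound)
    show "integrable lborel (\<lambda>z. R' * norm (v z))" using vi by simp
    have "R' \<ge> 0" by (simp add: R'_def)
    then show "AE z in lborel. norm (- \<i> * complex_of_real (z \<bullet> h) * v z) \<le> norm (R' * norm (v z))"
      using zh by (simp add: norm_mult abs_mult)
  qed measurable
  define D where "D = fourier (\<lambda>z. - \<i> * complex_of_real (z \<bullet> h) * v z) (\<zeta> + s *\<^sub>R h)"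
  define C where "C = R'\<^sup>2 / 2 * (LINT z|lborel. norm (v z))"
  have rem: "norm (fourier v (\<zeta> + t *\<^sub>R h) - fourier v (\<zeta> + s *\<^sub>R h) - (t - s) *\<^sub>R D) \<le> C * (t - s)\<^sup>2" for t
  proof -
    define k where "k z = exp (- \<i> * complex_of_real (z \<bullet> (\<zeta> + s *\<^sub>R h)))" for z
    define x where "x z = - ((t - s) * (z \<bullet> h))" for z
    define q where "q z = k z * (exp (\<i> * complex_of_real (x z)) - 1 - \<i> * complex_of_real (x z)) * v z" for z
    have ek: "exp (- \<i> * complex_of_real (z \<bullet> (\<zeta> + t *\<^sub>R h))) = k z * exp (\<i> * complex_of_real (x z))" for z
      unfolding k_def x_def exp_add[symmetric]
      by (rule arg_cong[where f=exp]) (simp add: inner_add_right algebra_simps)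
    note ii = integrable_exp_mult(2)[OF vi, of "\<lambda>z. z \<bullet> (\<zeta> + t *\<^sub>R h)"]
      integrable_exp_mult(2)[OF vi, of "\<lambda>z. z \<bullet> (\<zeta> + s *\<^sub>R h)"]
      integrable_exp_mult(2)[OF i1, of "\<lambda>z. z \<bullet> (\<zeta> + s *\<^sub>R h)"]
    have "fourier v (\<zeta> + t *\<^sub>R h) - fourier v (\<zeta> + s *\<^sub>R h) - (t - s) *\<^sub>R D =
       (LINT z|lborel. exp (- \<i> * complex_of_real (z \<bullet> (\<zeta> + t *\<^sub>R h))) * v z
         - exp (- \<i> * complex_of_real (z \<bullet> (\<zeta> + s *\<^sub>R h))) * v z
         - (t - s) *\<^sub>R (exp (- \<i> * complex_of_real (z \<bullet> (\<zeta> + s *\<^sub>R h))) * (- \<i> * complex_of_real (z \<bullet> h) * v z)))"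
      unfolding D_def fourier_def using ii by (subst Bochner_Integration.integral_diff, simp, simp)+ simp
    also have "\<dots> = (LINT z|lborel. q z)"
      unfolding ek unfolding k_def[symmetric] q_def x_def
      by (intro Bochner_Integration.integral_cong refl) (simp add: scaleR_conv_of_real algebra_simps)
    finally have eq: "fourier v (\<zeta> + t *\<^sub>R h) - fourier v (\<zeta> + s *\<^sub>R h) - (t - s) *\<^sub>R D = (LINT z|lborel. q z)" .
    have "norm (LINT z|lborel. q z) \<le> (LINT z|lborel. (t - s)\<^sup>2 * (R'\<^sup>2 / 2) * norm (v z))"
    proof (rule order_trans[OF integral_norm_bound integral_mono_AE'])
      show "integrable lborel (\<lambda>z. (t - s)\<^sup>2 * (R'\<^sup>2 / 2) * norm (v z))" using vi by simp
      have "norm (q z) \<le> (t - s)\<^sup>2 * (R'\<^sup>2 / 2) * norm (v z)" for z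
      proof -
        have "norm (exp (\<i> * complex_of_real (x z)) - 1 - \<i> * complex_of_real (x z)) \<le> (x z)\<^sup>2 / 2"
          using iexp_approx1[of "x z" 1] by (simp add: numeral_2_eq_2 algebra_simps)
        then have "norm (q z) \<le> (x z)\<^sup>2 / 2 * norm (v z)"
          unfolding q_def norm_mult by (intro mult_right_mono) (simp_all add: k_def)
        also have "\<dots> \<le> (t - s)\<^sup>2 * (R'\<^sup>2 / 2) * norm (v z)"
        proof (cases "v z = 0")
          case False
          then have "\<bar>z \<bullet> h\<bar> \<le> R'" using zh[of z] by simp
          then have "(z \<bullet> h)\<^sup>2 \<le> R'\<^sup>2" by (metis abs_ge_zero power2_abs power_mono)
          then have "(t - s)\<^sup>2 * (z \<bullet> h)\<^sup>2 \<le> (t - s)\<^sup>2 * R'\<^sup>2" by (rule mult_left_mono) simp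
          then show ?thesis by (intro mult_right_mono) (simp_all add: x_def power_mult_distrib)
        qed simp
        finally show ?thesis .
      qed
      then show "AE z in lborel. norm (q z) \<le> (t - s)\<^sup>2 * (R'\<^sup>2 / 2) * norm (v z)" by simp
    qed simp
    then show ?thesis unfolding eq C_def by (simp add: mult_ac)
  qed
  have "((\<lambda>s. fourier v (\<zeta> + s *\<^sub>R h)) has_derivative (\<lambda>t. t *\<^sub>R D)) (at s)"
  proof (rule has_derivativeI_sandwich[where e=1 and H="\<lambda>t. C * \<bar>t - s\<bar>"])
    show "bounded_linear (\<lambda>t. t *\<^sub>R D)" by (rule bounded_linear_scaleR_left)
    show "norm (fourier v (\<zeta> + t *\<^sub>R h) - fourier v (\<zeta> + s *\<^sub>R h) - (t - s) *\<^sub>R D) / norm (t - s) \<le> C * \<bar>t - s\<bar>"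
      if "t \<noteq> s" for t
    proof -
      have "(t - s)\<^sup>2 = \<bar>t - s\<bar> * \<bar>t - s\<bar>" by (simp add: power2_eq_square)
      then have "norm (fourier v (\<zeta> + t *\<^sub>R h) - fourier v (\<zeta> + s *\<^sub>R h) - (t - s) *\<^sub>R D) \<le> C * \<bar>t - s\<bar> * norm (t - s)"
        using rem[of t] by (simp only: mult.assoc real_norm_def)
      then show ?thesis using that by (intro divide_le_eq[THEN iffD2]) simp
    qed
    show "((\<lambda>t. C * \<bar>t - s\<bar>) \<longlongrightarrow> 0) (at s)"
    proof -
      have "((\<lambda>t. C * \<bar>t - s\<bar>) \<longlongrightarrow> C * \<bar>s - s\<bar>) (at s)" by (intro tendsto_intros)
      then show ?thesis by simp
    qed
  qed simp
  then show ?thesis unfolding has_vector_derivative_def D_def .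
qed

section \<open>Integration by parts\<close>

text \<open>Translation invariance makes the integral of every difference quotient 0; the mean value
  bound and the bounded support dominate the quotients as the step tends to 0.\<close>

lemma integral_derivative_zero:
  fixes k :: "'a::euclidean_space \<Rightarrow> complex"
  assumes k: "\<And>x. (k has_derivative D x) (at x)" and kb: "bcs k"
    and M: "\<And>x. norm (D x b) \<le> M" and m: "(\<lambda>x. D x b) \<in> borel_measurable borel"
  shows "(LINT x|lborel. D x b) = 0"
proof -
  have [measurable]: "k \<in> borel_measurable borel" by (rule bcs_measurable[OF kb])
  obtain R where R: "\<And>z. k z \<noteq> 0 \<Longrightarrow> norm z \<le> R" using bcsE[OF kb] by metis
  define e where "e n = 1 / real (Suc n)" for n
  have e: "0 < e n" "e n \<le> 1" for n by (auto simp: e_def)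
  define Q where "Q n x = (k (x + e n *\<^sub>R b) - k x) /\<^sub>R e n" for n x
  have tr: "integrable lborel (\<lambda>x. k (x + e n *\<^sub>R b)) \<and> (LINT x|lborel. k (x + e n *\<^sub>R b)) = (LINT x|lborel. k x)" for n
  proof -
    have ki: "integrable (distr lborel borel ((+) (e n *\<^sub>R b))) k"
      using bcs_integrable[OF kb] by (simp add: lborel_distr_plus)
    have "(LINT x|lborel. k x) = (LINT x|(distr lborel borel ((+) (e n *\<^sub>R b))). k x)"
      by (simp add: lborel_distr_plus)
    also have "\<dots> = (LINT x|lborel. k (e n *\<^sub>R b + x))" by (subst integral_distr) auto
    finally show ?thesis
      using ki by (subst (asm) integrable_distr_eq) (auto simp: add.commute)
  qed
  have Q0: "(LINT x|lborel. Q n x) = 0" for n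
    unfolding Q_def using tr[of n] bcs_integrable[OF kb] by simp
  have "(\<lambda>n. LINT x|lborel. Q n x) \<longlonglongrightarrow> (LINT x|lborel. D x b)"
  proof (rule integral_dominated_convergence[where w="\<lambda>x. M * indicator (cball 0 (R + norm b)) x"])
    show "AE x in lborel. (\<lambda>n. Q n x) \<longlonglongrightarrow> D x b"
    proof (rule AE_I2)
      fix x
      have "((\<lambda>s. k (x + s *\<^sub>R b)) has_derivative (\<lambda>s. D (x + 0 *\<^sub>R b) (s *\<^sub>R b))) (at 0)"
        by (rule has_derivative_compose[OF _ k]) (auto intro!: derivative_eq_intros)
      then have "((\<lambda>s. k (x + s *\<^sub>R b)) has_vector_derivative D x b) (at 0)"
        unfolding has_vector_derivative_def
        using linear_scale[OF has_derivative_linear[OF k[of x]]] by simp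
      then have "((\<lambda>s. (k (x + s *\<^sub>R b) - k x - s *\<^sub>R D x b) /\<^sub>R \<bar>s\<bar>) \<longlongrightarrow> 0) (at 0)"
        unfolding has_vector_derivative_def has_derivative_at_within by simp
      then have "((\<lambda>s. norm ((k (x + s *\<^sub>R b) - k x - s *\<^sub>R D x b) /\<^sub>R \<bar>s\<bar>)) \<longlongrightarrow> 0) (at 0)"
        by (rule tendsto_norm_zero)
      moreover have "\<forall>\<^sub>F s in at 0. norm ((k (x + s *\<^sub>R b) - k x - s *\<^sub>R D x b) /\<^sub>R \<bar>s\<bar>)
          = norm ((k (x + s *\<^sub>R b) - k x) /\<^sub>R s - D x b)"
        unfolding eventually_at_filter
      proof (rule always_eventually, intro allI impI)
        fix s :: real assume "s \<noteq> 0"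
        then have "(k (x + s *\<^sub>R b) - k x) /\<^sub>R s - D x b = (k (x + s *\<^sub>R b) - k x - s *\<^sub>R D x b) /\<^sub>R s"
          by (simp add: scaleR_diff_right)
        then show "norm ((k (x + s *\<^sub>R b) - k x - s *\<^sub>R D x b) /\<^sub>R \<bar>s\<bar>)
          = norm ((k (x + s *\<^sub>R b) - k x) /\<^sub>R s - D x b)" by simp
      qed
      ultimately have "((\<lambda>s. norm ((k (x + s *\<^sub>R b) - k x) /\<^sub>R s - D x b)) \<longlongrightarrow> 0) (at 0)"
        by (rule Lim_transform_eventually)
      then have "((\<lambda>s. (k (x + s *\<^sub>R b) - k x) /\<^sub>R s) \<longlongrightarrow> D x b) (at 0)"
        by (rule LIM_zero_cancel[OF tendsto_norm_zero_cancel])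
      moreover have "filterlim e (at 0) sequentially"
      proof -
        have "e \<longlonglongrightarrow> 0" unfolding e_def by (rule LIMSEQ_Suc[OF lim_1_over_n])
        moreover have "e n \<noteq> 0" for n using e(1)[of n] by simp
        ultimately show ?thesis by (simp add: filterlim_at)
      qed
      ultimately show "(\<lambda>n. Q n x) \<longlonglongrightarrow> D x b" unfolding Q_def by (rule filterlim_compose)
    qed
    have bound: "norm (k (x + t *\<^sub>R b) - k x) \<le> M * t" if "0 \<le> t" for x t
    proof -
      have "norm (k (x + t *\<^sub>R b) - k (x + 0 *\<^sub>R b)) \<le> M * norm (t - 0)"
      proof (rule differentiable_bound[of UNIV])
        show "((\<lambda>s. k (x + s *\<^sub>R b)) has_derivative (\<lambda>s. s *\<^sub>R D (x + r *\<^sub>R b) b)) (at r within UNIV)" for r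
        proof -
          have "((\<lambda>s. k (x + s *\<^sub>R b)) has_derivative (\<lambda>s. D (x + r *\<^sub>R b) (s *\<^sub>R b))) (at r)"
            by (rule has_derivative_compose[OF _ k]) (auto intro!: derivative_eq_intros)
          then show ?thesis using linear_scale[OF has_derivative_linear[OF k]] by simp
        qed
        show "onorm (\<lambda>s. s *\<^sub>R D (x + r *\<^sub>R b) b) \<le> M" for r
          using M by (simp add: onorm_scaleR_left[OF bounded_linear_ident] onorm_id)
      qed auto
      then show ?thesis using that by simp
    qed
    have "norm (Q n x) \<le> M * indicator (cball 0 (R + norm b)) x" for n x
    proof (cases "x \<in> cball 0 (R + norm b)")
      case True
      have "norm (Q n x) = norm (k (x + e n *\<^sub>R b) - k x) / e n"
        using e(1)[of n] by (simp add: Q_def divide_inverse_commute)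
      also have "\<dots> \<le> M" using bound[of "e n" x] e(1)[of n] by (simp add: divide_le_eq mult.commute)
      finally show ?thesis using True by simp
    next
      case False
      then have x: "R + norm b < norm x" by simp
      have "norm (e n *\<^sub>R b) \<le> norm b" using e[of n] by (simp add: mult_left_le_one_le)
      then have "R < norm (x + e n *\<^sub>R b)" "R < norm x"
        using x norm_diff_ineq[of x "e n *\<^sub>R b"] norm_ge_zero[of b] by linarith+
      then have "k (x + e n *\<^sub>R b) = 0" "k x = 0" using R by (meson not_le)+
      then show ?thesis using False by (simp add: Q_def)
    qed
    then show "AE x in lborel. norm (Q n x) \<le> M * indicator (cball 0 (R + norm b)) x" for n by simp
    show "Q n \<in> borel_measurable lborel" for n unfolding Q_def by measurable
  qed (use m in auto)
  then show ?thesis by (simp add: Q0 LIMSEQ_const_iff)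
qed

text \<open>Conjugated test functions occur in \<open>laplacian_eq\<close>, because
  \<open>ext_inverse\<close> conjugates the test function inside the transform.\<close>

lemma smooth_cnj:
  assumes "smooth f" shows "smooth (\<lambda>z. cnj (f z))"
    and "pdiff b (\<lambda>z. cnj (f z)) = (\<lambda>z. cnj (pdiff b f z))"
proof -
  have d: "((\<lambda>z. cnj (g z)) has_derivative (\<lambda>v. cnj (pdiff v g z))) (at z)" if "smooth g" for g :: "'a \<Rightarrow> complex" and z
    by (rule bounded_linear.has_derivative[OF bounded_linear_cnj smooth_has_derivative[OF that]])
  show "smooth (\<lambda>z. cnj (f z))"
  proof (rule smooth_coinduct)
    let ?S = "{\<lambda>z. cnj (g z) | g :: 'a \<Rightarrow> complex. smooth g}"
    show "(\<lambda>z. cnj (f z)) \<in> ?S" using assms by blast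
    show "g differentiable (at z)" if g: "g \<in> ?S" for g z
    proof -
      obtain h where h: "g = (\<lambda>z. cnj (h z))" "smooth h" using g by blast
      show ?thesis unfolding h(1) differentiable_def using d[OF h(2)] by blast
    qed
    show "pdiff b g \<in> ?S" if g: "g \<in> ?S" and b: "b \<in> Basis" for g b
    proof -
      obtain h where h: "g = (\<lambda>z. cnj (h z))" "smooth h" using g by blast
      have "pdiff b g = (\<lambda>z. cnj (pdiff b h z))" unfolding h(1) by (rule ext, rule pdiff_eq[OF d[OF h(2)]])
      then show ?thesis using smooth_pdiff[OF h(2) b] by blast
    qed
  qed
  show "pdiff b (\<lambda>z. cnj (f z)) = (\<lambda>z. cnj (pdiff b f z))"
    by (rule ext, rule pdiff_eq[OF d[OF assms]])
qed

lemma test_fun_cnj: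
  assumes "test_fun f" shows "test_fun (\<lambda>z. cnj (f z))"
  using assms smooth_cnj(1)[of f] unfolding test_fun_def by simp

context splitting
begin

text \<open>Integration by parts on a slice: the integral of the derivative of exp (-i x.xi) times
  \<phi> vanishes, and the product rule splits it into the two sides.\<close>

lemma partial_pdiff:
  assumes \<phi>: "test_fun \<phi>" and b: "b \<in> Basis"
  shows "partial (pdiff (\<iota> (b, 0)) \<phi>) z = \<i> * complex_of_real (fst (\<pi> z) \<bullet> b) * partial \<phi> z"
proof -
  define \<xi> where "\<xi> = fst (\<pi> z)"
  define y where "y = snd (\<pi> z)"
  have \<iota>b: "\<iota> (b, 0) \<in> Basis" using b \<iota>_Basis by (auto simp: Basis_prod_def)
  note \<phi>' = test_fun_pdiff[OF \<phi> \<iota>b]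
  note s = test_fun_smooth[OF \<phi>]
  have bl: "bounded_linear (\<lambda>v. \<iota> (v, 0))"
    by (rule bounded_linear_compose[OF linear_conv_bounded_linear[THEN iffD1, OF linear_\<iota>]
          bounded_linear_Pair[OF bounded_linear_ident bounded_linear_zero]])
  have aff: "\<iota> (x, y) = \<iota> (x, 0) + \<iota> (0, y)" for x
    using linear_add[OF linear_\<iota>, of "(x, 0)" "(0, y)"] by simp
  have d\<iota>: "((\<lambda>x. \<iota> (x, y)) has_derivative (\<lambda>v. \<iota> (v, 0))) (at x)" for x
  proof -
    have "(\<lambda>x. \<iota> (x, y)) = (\<lambda>x. \<iota> (x, 0) + \<iota> (0, y))" by (rule ext, rule aff)
    moreover have "((\<lambda>x. \<iota> (x, 0) + \<iota> (0, y)) has_derivative (\<lambda>v. \<iota> (v, 0))) (at x)"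
      by (intro has_derivative_add_const bounded_linear.has_derivative[OF bl] has_derivative_ident)
    ultimately show ?thesis by simp
  qed
  define k where "k x = exp (- \<i> * complex_of_real (x \<bullet> \<xi>)) * \<phi> (\<iota> (x, y))" for x
  define D where "D x v = exp (- \<i> * complex_of_real (x \<bullet> \<xi>)) * pdiff (\<iota> (v, 0)) \<phi> (\<iota> (x, y))
     + (- \<i> * of_real (v \<bullet> \<xi>)) * exp (- \<i> * complex_of_real (x \<bullet> \<xi>)) * \<phi> (\<iota> (x, y))" for x v
  have kD: "(k has_derivative D x) (at x)" for x
  proof -
    have 1: "((\<lambda>x. \<phi> (\<iota> (x, y))) has_derivative (\<lambda>v. pdiff (\<iota> (v, 0)) \<phi> (\<iota> (x, y)))) (at x)"
      by (rule has_derivative_compose[OF d\<iota> smooth_has_derivative[OF s]])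
    show ?thesis
      unfolding k_def[abs_def] D_def[abs_def]
      using has_derivative_mult[OF has_derivative_exp_ii[of 1 \<xi> x] 1] by simp
  qed
  have [measurable]: "\<phi> \<in> borel_measurable borel" "pdiff (\<iota> (b, 0)) \<phi> \<in> borel_measurable borel"
    using test_fun_bcs[OF \<phi>] test_fun_bcs[OF \<phi>'] by (auto simp: bcs_def)
  obtain M1 where M1: "\<And>z. norm (\<phi> z) \<le> M1" using bcsE[OF test_fun_bcs[OF \<phi>]] by metis
  obtain M2 where M2: "\<And>z. norm (pdiff (\<iota> (b, 0)) \<phi> z) \<le> M2" using bcsE[OF test_fun_bcs[OF \<phi>']] by metis
  note i1 = integrable_exp_mult(2)[OF bcs_integrable[OF bcs_slice[OF test_fun_bcs[OF \<phi>]]], of "\<lambda>x. x \<bullet> \<xi>" y]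
  note i2 = integrable_exp_mult(2)[OF bcs_integrable[OF bcs_slice[OF test_fun_bcs[OF \<phi>']]], of "\<lambda>x. x \<bullet> \<xi>" y]
  have "(LINT x|lborel. D x b) = 0"
  proof (rule integral_derivative_zero[OF kD])
    show "bcs k"
      unfolding k_def[abs_def] by (rule bcs_mult_bounded[OF bcs_slice[OF test_fun_bcs[OF \<phi>]], where M=1]) auto
    show "norm (D x b) \<le> M2 + \<bar>b \<bullet> \<xi>\<bar> * M1" for x
      unfolding D_def
      by (rule norm_triangle_mono) (auto simp: norm_mult intro!: M2 M1 mult_left_mono)
    show "(\<lambda>x. D x b) \<in> borel_measurable borel" unfolding D_def by measurable
  qed
  also have "(LINT x|lborel. D x b) = (LINT x|lborel. exp (- \<i> * complex_of_real (x \<bullet> \<xi>)) * pdiff (\<iota> (b, 0)) \<phi> (\<iota> (x, y)))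
     + (- \<i> * of_real (b \<bullet> \<xi>)) * (LINT x|lborel. exp (- \<i> * complex_of_real (x \<bullet> \<xi>)) * \<phi> (\<iota> (x, y)))"
    unfolding D_def mult.assoc using i1 i2
    by (subst Bochner_Integration.integral_add) (simp_all add: mult.assoc)
  finally have "(LINT x|lborel. exp (- \<i> * complex_of_real (x \<bullet> \<xi>)) * pdiff (\<iota> (b, 0)) \<phi> (\<iota> (x, y)))
     = \<i> * of_real (\<xi> \<bullet> b) * (LINT x|lborel. exp (- \<i> * complex_of_real (x \<bullet> \<xi>)) * \<phi> (\<iota> (x, y)))"
    by (simp add: inner_commute eq_neg_iff_add_eq_0[symmetric])
  then show ?thesis unfolding partial_def fourier_def \<xi>_def y_def .
qed

lemma partial_pdiff2:
  assumes \<phi>: "test_fun \<phi>" and b: "b \<in> Basis"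
  shows "partial (pdiff (\<iota> (b, 0)) (pdiff (\<iota> (b, 0)) \<phi>)) z = - complex_of_real ((fst (\<pi> z) \<bullet> b)\<^sup>2) * partial \<phi> z"
proof -
  have \<iota>b: "\<iota> (b, 0) \<in> Basis" using b \<iota>_Basis by (auto simp: Basis_prod_def)
  have "\<i> * a * (\<i> * a * p) = (\<i> * \<i>) * (a * a) * p" for a p :: complex by (simp only: mult_ac)
  then show ?thesis
    by (simp add: partial_pdiff[OF test_fun_pdiff[OF \<phi> \<iota>b] b] partial_pdiff[OF \<phi> b] power2_eq_square)
qed

end

section \<open>The block decomposition\<close>

lemma sum_UNIV_sum: "(\<Sum>k\<in>(UNIV :: ('a::finite + 'b::finite) set). f k) = (\<Sum>i\<in>UNIV. f (Inl i)) + (\<Sum>j\<in>UNIV. f (Inr j))"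
  by (simp add: UNIV_Plus_UNIV[symmetric] sum.Plus del: UNIV_Plus_UNIV)

lemma join_nth[simp]: "Defs.join a b $ Inl i = a $ i" "Defs.join a b $ Inr j = b $ j"
  by (simp_all add: Defs.join_def)

lemma blk_nth[simp]: "blk0 x $ i = x $ Inl i" "blk1 x $ j = x $ Inr j"
  by (simp_all add: blk0_def blk1_def)

lemma vec_sum_eqI: "(\<And>i. x $ Inl i = y $ Inl i) \<Longrightarrow> (\<And>j. x $ Inr j = y $ Inr j) \<Longrightarrow> x = y"
  unfolding vec_eq_iff by (metis sum.exhaust)

lemma blk_join[simp]: "blk0 (Defs.join a b) = a" "blk1 (Defs.join a b) = b" "Defs.join (blk0 x) (blk1 x) = x"
  by (auto simp: vec_eq_iff[of _ a] vec_eq_iff[of _ b] intro: vec_sum_eqI)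

lemma inner_join: "Defs.join a b \<bullet> Defs.join c d = a \<bullet> c + b \<bullet> d"
  by (simp add: inner_vec_def sum_UNIV_sum)

lemma join_axis: "Defs.join (axis i r) 0 = axis (Inl i) r" "Defs.join 0 (axis j r) = axis (Inr j) r"
  "Defs.join 0 0 = 0"
  by (auto intro!: vec_sum_eqI simp: axis_def)

lemma join_linear: "Defs.join (a + a') (b + b') = Defs.join a b + Defs.join a' b'"
  "Defs.join (r *\<^sub>R a) (r *\<^sub>R b) = r *\<^sub>R Defs.join a b"
  by (auto intro!: vec_sum_eqI)

lemma Basis_vec_real: "(Basis :: (real ^ 'k::finite) set) = range (\<lambda>i. axis i 1)"
  by (auto simp: Basis_vec_def)

definition \<iota>0 :: "(real ^ 'm::finite) \<times> (real ^ 'n::finite) \<times> real \<Rightarrow> (real ^ ('m + 'n)) \<times> real" where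
  "\<iota>0 p = (Defs.join (fst p) (fst (snd p)), snd (snd p))"

definition \<pi>0 :: "(real ^ ('m::finite + 'n::finite)) \<times> real \<Rightarrow> (real ^ 'm) \<times> (real ^ 'n) \<times> real" where
  "\<pi>0 z = (blk0 (fst z), blk1 (fst z), snd z)"

definition \<iota>1 :: "(real ^ 'n::finite) \<times> (real ^ 'm::finite) \<times> real \<Rightarrow> (real ^ ('m + 'n)) \<times> real" where
  "\<iota>1 p = (Defs.join (fst (snd p)) (fst p), snd (snd p))"

definition \<pi>1 :: "(real ^ ('m::finite + 'n::finite)) \<times> real \<Rightarrow> (real ^ 'n) \<times> (real ^ 'm) \<times> real" where
  "\<pi>1 z = (blk1 (fst z), blk0 (fst z), snd z)"

lemma Basis_space_time: "(Basis :: ((real ^ ('m::finite + 'n::finite)) \<times> real) set) =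
  range (\<lambda>i. (axis (Inl i) 1, 0)) \<union> range (\<lambda>j. (axis (Inr j) 1, 0)) \<union> {(0, 1)}"
proof -
  have "range (\<lambda>k :: 'm + 'n. (axis k (1::real), 0::real)) = range (\<lambda>i. (axis (Inl i) 1, 0)) \<union> range (\<lambda>j. (axis (Inr j) 1, 0))"
    unfolding UNIV_sum by (simp add: image_Un image_image)
  then show ?thesis
    by (simp add: Basis_prod_def Basis_vec_real image_image)
qed

lemma splitting_\<iota>0: "splitting (\<iota>0 :: (real ^ 'm::finite) \<times> (real ^ 'n::finite) \<times> real \<Rightarrow> _) \<pi>0"
proof (rule splitting.intro)
  show "linear (\<iota>0 :: (real ^ 'm) \<times> (real ^ 'n) \<times> real \<Rightarrow> _)"
    by (rule linearI) (simp_all add: \<iota>0_def join_linear)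
  show "\<pi>0 (\<iota>0 p) = p" for p :: "(real ^ 'm) \<times> (real ^ 'n) \<times> real" by (simp add: \<iota>0_def \<pi>0_def)
  show "\<iota>0 (\<pi>0 z) = z" for z :: "(real ^ ('m + 'n)) \<times> real" by (simp add: \<iota>0_def \<pi>0_def)
  show "\<iota>0 p \<bullet> \<iota>0 q = p \<bullet> q" for p q :: "(real ^ 'm) \<times> (real ^ 'n) \<times> real"
    by (simp add: \<iota>0_def inner_join inner_prod_def)
  show "\<iota>0 ` Basis = (Basis :: ((real ^ ('m + 'n)) \<times> real) set)"
    unfolding Basis_space_time
    by (simp add: Basis_prod_def Basis_vec_real image_Un image_image \<iota>0_def join_axis Un_assoc)
qed

lemma splitting_\<iota>1: "splitting (\<iota>1 :: (real ^ 'n::finite) \<times> (real ^ 'm::finite) \<times> real \<Rightarrow> _) \<pi>1"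
proof (rule splitting.intro)
  show "linear (\<iota>1 :: (real ^ 'n) \<times> (real ^ 'm) \<times> real \<Rightarrow> _)"
    by (rule linearI) (simp_all add: \<iota>1_def join_linear)
  show "\<pi>1 (\<iota>1 p) = p" for p :: "(real ^ 'n) \<times> (real ^ 'm) \<times> real" by (simp add: \<iota>1_def \<pi>1_def)
  show "\<iota>1 (\<pi>1 z) = z" for z :: "(real ^ ('m + 'n)) \<times> real" by (simp add: \<iota>1_def \<pi>1_def)
  show "\<iota>1 p \<bullet> \<iota>1 q = p \<bullet> q" for p q :: "(real ^ 'n) \<times> (real ^ 'm) \<times> real"
    by (simp add: \<iota>1_def inner_join inner_prod_def)
  show "\<iota>1 ` Basis = (Basis :: ((real ^ ('m + 'n)) \<times> real) set)"
    unfolding Basis_space_time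
    by (auto simp: Basis_prod_def Basis_vec_real image_Un image_image \<iota>1_def join_axis)
qed

interpretation s0: splitting "\<iota>0 :: (real ^ 'm::finite) \<times> (real ^ 'n::finite) \<times> real \<Rightarrow> _" \<pi>0
  by (rule splitting_\<iota>0)

interpretation s1: splitting "\<iota>1 :: (real ^ 'n::finite) \<times> (real ^ 'm::finite) \<times> real \<Rightarrow> _" \<pi>1
  by (rule splitting_\<iota>1)

lemma fourier0_partial: "fourier0 \<phi> = s0.partial \<phi>"
  by (auto simp: fourier0_def s0.partial_def fourier_def \<iota>0_def \<pi>0_def)

lemma fourier1_partial: "fourier1 \<phi> = s1.partial \<phi>"
  by (auto simp: fourier1_def s1.partial_def fourier_def \<iota>1_def \<pi>1_def)

section \<open>Testing the equation with localised exponentials\<close>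

abbreviation e0 :: "'m::finite \<Rightarrow> (real ^ ('m + 'n::finite)) \<times> real" where "e0 l \<equiv> (axis (Inl l) 1, 0)"
abbreviation e1 :: "'n::finite \<Rightarrow> (real ^ ('m::finite + 'n)) \<times> real" where "e1 k \<equiv> (axis (Inr k) 1, 0)"
abbreviation et :: "(real ^ ('m::finite + 'n::finite)) \<times> real" where "et \<equiv> (0, 1)"

lemma e_Basis: "e0 l \<in> Basis" "e1 k \<in> Basis" "et \<in> Basis"
  by (auto simp: Basis_space_time)

text \<open>The formal adjoint of Y minus \<sigma> times the Laplacian in x^(0). It has no term of
  order zero, because every entry of \<open>B1\<close> pairs a derivative in x^(1) with a coordinate
  of x^(0).\<close>

definition kolmogorov :: "real ^ 'm::finite ^ 'n::finite \<Rightarrow> real \<Rightarrow> ((real ^ ('m + 'n)) \<times> real \<Rightarrow> complex)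
   \<Rightarrow> (real ^ ('m + 'n)) \<times> real \<Rightarrow> complex" where
  "kolmogorov B1 \<sigma> \<phi> z = - (\<Sum>k\<in>UNIV. \<Sum>l\<in>UNIV. of_real (B1 $ k $ l) * (of_real (fst z $ Inl l) * pdiff (e1 k) \<phi> z))
     + pdiff et \<phi> z - of_real \<sigma> * (\<Sum>l\<in>UNIV. pdiff (e0 l) (pdiff (e0 l) \<phi>) z)"

lemma pdiff_coordinate_mult:
  assumes "smooth \<phi>"
  shows "pdiff (axis i 1, 0) (\<lambda>z. complex_of_real (fst z $ j) * \<phi> z) z =
    of_real (fst z $ j) * pdiff (axis i 1, 0) \<phi> z + (if i = j then \<phi> z else 0)"
proof (rule trans[OF pdiff_eq])
  have "((\<lambda>z. complex_of_real (fst z $ j)) has_derivative (\<lambda>v. complex_of_real (fst v $ j))) (at z)"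
    by (intro has_derivative_of_real bounded_linear.has_derivative[OF bounded_linear_vec_nth] has_derivative_fst has_derivative_ident)
  from has_derivative_mult[OF this smooth_has_derivative[OF assms]]
  show "((\<lambda>z. complex_of_real (fst z $ j) * \<phi> z) has_derivative
     (\<lambda>v. complex_of_real (fst z $ j) * pdiff v \<phi> z + complex_of_real (fst v $ j) * \<phi> z)) (at z)" .
qed (simp add: axis_def)

lemma bcs_coordinate_mult:
  assumes f: "bcs f" shows "bcs (\<lambda>z::(real ^ 'k::finite) \<times> real. complex_of_real (fst z $ i) * f z)"
proof -
  obtain R where R: "\<And>z. f z \<noteq> 0 \<Longrightarrow> norm z \<le> R" using bcsE[OF f] by metis
  show ?thesis
  proof (rule bcs_mult_bounded[OF f, where M=R])
    show "(\<lambda>z::(real ^ 'k) \<times> real. complex_of_real (fst z $ i)) \<in> borel_measurable borel"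
      by (intro borel_measurable_continuous_onI continuous_intros)
    fix z assume "f z \<noteq> 0"
    then have "norm z \<le> R" by (rule R)
    moreover have "\<bar>fst z $ i\<bar> \<le> norm z"
      using component_le_norm_cart[of "fst z" i] norm_fst_le[of "fst z" "snd z"] by simp
    ultimately show "norm (complex_of_real (fst z $ i)) \<le> R" by simp
  qed
qed

lemma weak_equation:
  fixes B1 :: "real ^ 'm::finite ^ 'n::finite"
  assumes u: "L2 u" and eq: "eq_distrib (\<lambda>\<phi>. transport_Y (block_matrix B1) (regular u) \<phi> - complex_of_real \<sigma> * laplacian0 (regular u) \<phi>) (regular g)"
    and \<phi>: "test_fun \<phi>"
  shows "(LINT z|lborel. g z * \<phi> z) = (LINT z|lborel. u z * kolmogorov B1 \<sigma> \<phi> z)"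
proof -
  have sm: "smooth \<phi>" by (rule test_fun_smooth[OF \<phi>])
  have t1: "bcs (pdiff (e1 k) \<phi>)" for k by (intro test_fun_bcs test_fun_pdiff \<phi> e_Basis)
  have t2: "bcs (pdiff et \<phi>)" by (intro test_fun_bcs test_fun_pdiff \<phi> e_Basis)
  have t3: "bcs (pdiff (e0 l) (pdiff (e0 l) \<phi>))" for l by (intro test_fun_bcs test_fun_pdiff \<phi> e_Basis)
  have t4: "bcs (\<lambda>z. of_real (fst z $ Inl l) * pdiff (e1 k) \<phi> z)" for k l
    by (rule bcs_coordinate_mult[OF t1])
  note int = L2_integrable_mult[OF u bcs_L2]
  have Y0: "transport_Y (block_matrix B1) (regular u) \<phi> =
     (\<Sum>k\<in>UNIV. \<Sum>l\<in>UNIV. complex_of_real (B1 $ k $ l) * dmult (\<lambda>z. fst z $ Inl l) (dpartial (e1 k) (regular u)) \<phi>)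
     - dpartial et (regular u) \<phi>"
    unfolding transport_Y_def by (simp add: sum_UNIV_sum block_matrix_def)
  \<comment> \<open>The derivative of the coordinate itself contributes nothing: the indices
    \<open>Inl l\<close> and \<open>Inr k\<close> differ.\<close>
  have dm: "dmult (\<lambda>z. fst z $ Inl l) (dpartial (e1 k) (regular u)) \<phi> =
     - (LINT z|lborel. u z * (of_real (fst z $ Inl l) * pdiff (e1 k) \<phi> z))" for k l
    unfolding dmult_def dpartial_def regular_def by (simp add: pdiff_coordinate_mult[OF sm])
  have dt: "dpartial et (regular u) \<phi> = - (LINT z|lborel. u z * pdiff et \<phi> z)"
    by (simp add: dpartial_def regular_def)
  have Y: "transport_Y (block_matrix B1) (regular u) \<phi> =
     - (\<Sum>k\<in>UNIV. \<Sum>l\<in>UNIV. complex_of_real (B1 $ k $ l) * (LINT z|lborel. u z * (of_real (fst z $ Inl l) * pdiff (e1 k) \<phi> z)))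
     + (LINT z|lborel. u z * pdiff et \<phi> z)"
    unfolding Y0 dm dt by (simp add: sum_negf)
  have lap: "laplacian0 (regular u) \<phi> = (\<Sum>l\<in>UNIV. LINT z|lborel. u z * pdiff (e0 l) (pdiff (e0 l) \<phi>) z)"
    by (simp add: laplacian0_def dpartial_def regular_def)
  have "(LINT z|lborel. u z * kolmogorov B1 \<sigma> \<phi> z) = (LINT z|lborel.
     - (\<Sum>k\<in>UNIV. \<Sum>l\<in>UNIV. complex_of_real (B1 $ k $ l) * (u z * (of_real (fst z $ Inl l) * pdiff (e1 k) \<phi> z)))
     + u z * pdiff et \<phi> z - of_real \<sigma> * (\<Sum>l\<in>UNIV. u z * pdiff (e0 l) (pdiff (e0 l) \<phi>) z))"
    by (simp add: kolmogorov_def sum_distrib_left algebra_simps)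
  also have "\<dots> = - (\<Sum>k\<in>UNIV. \<Sum>l\<in>UNIV. complex_of_real (B1 $ k $ l) * (LINT z|lborel. u z * (of_real (fst z $ Inl l) * pdiff (e1 k) \<phi> z)))
     + (LINT z|lborel. u z * pdiff et \<phi> z) - of_real \<sigma> * (\<Sum>l\<in>UNIV. LINT z|lborel. u z * pdiff (e0 l) (pdiff (e0 l) \<phi>) z)"
    using int[OF t2] int[OF t3] int[OF t4] by (simp add: Bochner_Integration.integral_sum)
  also have "\<dots> = (LINT z|lborel. g z * \<phi> z)"
  proof -
    have "transport_Y (block_matrix B1) (regular u) \<phi> - complex_of_real \<sigma> * laplacian0 (regular u) \<phi> = regular g \<phi>"
      using eq \<phi> unfolding eq_distrib_def by blast
    then show ?thesis unfolding Y lap by (simp only: regular_def)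
  qed
  finally show ?thesis ..
qed

text \<open>Conjugation by the exponential: the transport of E gives i z.eta, which after
  integration becomes a derivative of the transform along eta; the time derivative gives -i tau and
  the Laplacian \<sigma> |xi_0|^2. The remaining terms have derivatives on \<open>h\<close> and will
  go into \<open>source\<close>.\<close>

lemma kolmogorov_exp:
  fixes B1 :: "real ^ 'm::finite ^ 'n::finite" and \<zeta> :: "(real ^ ('m + 'n)) \<times> real"
  assumes h: "smooth h"
  defines "E \<equiv> \<lambda>z. exp (- \<i> * complex_of_real (z \<bullet> \<zeta>))"
  shows "kolmogorov B1 \<sigma> (\<lambda>z. E z * h z) z = E z * (
     \<i> * of_real (z \<bullet> \<iota>0 (transpose B1 *v blk1 (fst \<zeta>), 0)) * h z
     + (of_real (\<sigma> * (norm (blk0 (fst \<zeta>)))\<^sup>2) - \<i> * of_real (snd \<zeta>)) * h z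
     + kolmogorov B1 \<sigma> h z
     + (\<Sum>l\<in>UNIV. 2 * \<i> * of_real \<sigma> * of_real (fst \<zeta> $ Inl l) * pdiff (e0 l) h z))"
proof -
  have 1: "pdiff b (\<lambda>z. E z * k z) z = E z * (pdiff b k z - \<i> * of_real (b \<bullet> \<zeta>) * k z)"
    if "k differentiable (at z)" for k b z
  proof (rule trans[OF pdiff_eq])
    have k: "(k has_derivative (\<lambda>v. pdiff v k z)) (at z)"
      using that unfolding pdiff_def frechet_derivative_works .
    show "((\<lambda>z. E z * k z) has_derivative (\<lambda>v. E z * pdiff v k z + (- \<i> * of_real (v \<bullet> \<zeta>)) * E z * k z)) (at z)"
      unfolding E_def using has_derivative_mult[OF has_derivative_exp_ii[of 1 \<zeta> z] k] by simp
  qed (simp add: algebra_simps)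
  have e1: "pdiff b (\<lambda>z. E z * h z) = (\<lambda>z. E z * (pdiff b h z - \<i> * of_real (b \<bullet> \<zeta>) * h z))" for b
    by (intro ext 1 smooth_differentiable h)
  have e2: "pdiff b (pdiff b (\<lambda>z. E z * h z)) z = E z * (pdiff b (pdiff b h) z
     - 2 * \<i> * of_real (b \<bullet> \<zeta>) * pdiff b h z - of_real ((b \<bullet> \<zeta>)\<^sup>2) * h z)" if b: "b \<in> Basis" for b z
  proof -
    define k where "k z = pdiff b h z - \<i> * of_real (b \<bullet> \<zeta>) * h z" for z
    have kd: "(k has_derivative (\<lambda>v. pdiff v (pdiff b h) z - \<i> * of_real (b \<bullet> \<zeta>) * pdiff v h z)) (at z)"
      unfolding k_def[abs_def]
      by (intro has_derivative_diff has_derivative_mult_right smooth_has_derivative smooth_pdiff h b)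
    have "pdiff b (\<lambda>z. E z * k z) z = E z * (pdiff b k z - \<i> * of_real (b \<bullet> \<zeta>) * k z)"
      by (rule 1) (use kd in \<open>auto simp: differentiable_def\<close>)
    also have "pdiff b k z = pdiff b (pdiff b h) z - \<i> * of_real (b \<bullet> \<zeta>) * pdiff b h z"
      by (rule pdiff_eq[OF kd])
    finally show ?thesis unfolding e1 k_def[symmetric]
      by (simp add: k_def power2_eq_square algebra_simps)
  qed
  have inner: "e0 l \<bullet> \<zeta> = fst \<zeta> $ Inl l" "e1 k \<bullet> \<zeta> = fst \<zeta> $ Inr k" "et \<bullet> \<zeta> = snd \<zeta>" for l k
    by (simp_all add: inner_prod_def inner_axis')
  have n: "complex_of_real ((norm (blk0 (fst \<zeta>)))\<^sup>2) = (\<Sum>l\<in>UNIV. of_real ((fst \<zeta> $ Inl l)\<^sup>2))"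
    unfolding power2_norm_eq_inner by (simp add: inner_vec_def power2_eq_square)
  have zh: "complex_of_real (z \<bullet> \<iota>0 (transpose B1 *v blk1 (fst \<zeta>), 0)) =
     (\<Sum>k\<in>UNIV. \<Sum>l\<in>UNIV. of_real (B1 $ k $ l) * of_real (fst z $ Inl l) * of_real (fst \<zeta> $ Inr k))"
  proof -
    have "z \<bullet> \<iota>0 (transpose B1 *v blk1 (fst \<zeta>), 0) = (\<Sum>l\<in>UNIV. \<Sum>k\<in>UNIV. B1 $ k $ l * fst z $ Inl l * fst \<zeta> $ Inr k)"
      by (simp add: \<iota>0_def inner_prod_def inner_vec_def sum_UNIV_sum matrix_vector_mult_def transpose_def sum_distrib_left mult_ac)
    also have "\<dots> = (\<Sum>k\<in>UNIV. \<Sum>l\<in>UNIV. B1 $ k $ l * fst z $ Inl l * fst \<zeta> $ Inr k)"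
      by (rule sum.swap)
    finally show ?thesis by simp
  qed
  show ?thesis
    unfolding kolmogorov_def zh n of_real_mult e2[OF e_Basis(1)] inner
    by (simp add: e1 inner sum_distrib_left sum_distrib_right sum.distrib sum_subtractf sum_negf algebra_simps)
qed

lemma multiplier_tendsto:
  fixes u :: "'a::euclidean_space \<Rightarrow> complex"
  assumes u: "L2 u" and [measurable]: "\<And>n. \<chi>' n \<in> borel_measurable borel"
    and b: "\<And>n z. norm (\<chi>' n z) \<le> M" and lim: "\<And>z. (\<lambda>n. \<chi>' n z) \<longlonglongrightarrow> c"
  shows "(\<lambda>n. L2norm (\<lambda>z. \<chi>' n z * u z - c * u z)) \<longlonglongrightarrow> 0"
proof (rule L2norm_dominated_tendsto)
  have [measurable]: "u \<in> borel_measurable borel" using u by (simp add: L2_iff)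
  have M0: "0 \<le> M" using b[of 0 0] norm_ge_zero order_trans by blast
  show "L2 (\<lambda>z. of_real (M + norm c) * u z)" by (rule L2_cmult[OF u])
  show "norm (\<chi>' n z * u z - c * u z) \<le> norm (of_real (M + norm c) * u z)" for n z
  proof -
    have "norm (\<chi>' n z * u z - c * u z) = norm (\<chi>' n z - c) * norm (u z)"
      by (simp add: norm_mult left_diff_distrib[symmetric])
    also have "\<dots> \<le> (M + norm c) * norm (u z)"
      using norm_triangle_ineq4[of "\<chi>' n z" c] b[of n z] by (intro mult_right_mono) auto
    finally show ?thesis using M0 by (simp add: norm_mult abs_of_nonneg del: of_real_add)
  qed
  show "AE z in lborel. (\<lambda>n. \<chi>' n z * u z) \<longlonglongrightarrow> c * u z"
    by (intro AE_I2 tendsto_mult lim tendsto_const)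
  show "(\<lambda>z. \<chi>' n z * u z) \<in> borel_measurable borel" for n by measurable
  show "(\<lambda>z. c * u z) \<in> borel_measurable borel" by measurable
qed

lemma L2_multiplier:
  assumes u: "L2 u" and \<chi>: "bcs \<chi>'"
  shows "L2 (\<lambda>z. \<chi>' z * u z)"
proof -
  obtain M where "\<And>z. norm (\<chi>' z) \<le> M" using bcsE[OF \<chi>] by metis
  then show ?thesis by (intro L2_mult_bounded u bcs_measurable \<chi>)
qed

section \<open>Localised solutions along the characteristics\<close>

locale kolmogorov_equation =
  fixes B1 :: "real ^ 'm::finite ^ 'n::finite" and \<sigma> :: real
  assumes rank_B1: "rank B1 = CARD('n)" and \<sigma>_pos: "0 < \<sigma>"

text \<open>Full row rank makes the transpose of \<open>B1\<close> injective, and an injective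
  linear map in finite dimension is bounded below. The final constant is a function of this
  \<kappa>.\<close>

lemma transpose_bounded_below:
  fixes B1 :: "real ^ 'm::finite ^ 'n::finite"
  assumes "rank B1 = CARD('n)"
  obtains \<kappa> where "0 < \<kappa>" "\<And>b. \<kappa> * norm b \<le> norm (b v* B1)"
proof -
  have "inj ((*v) (transpose B1))"
    using assms by (simp add: full_rank_injective[symmetric] rank_transpose)
  from linear_inj_bounded_below_pos[OF matrix_vector_mul_linear this] that
  show thesis by (metis transpose_matrix_vector)
qed

text \<open>Here y = (xi_1, tau), and the velocity eta ignores the time frequency.\<close>

sublocale kolmogorov_equation \<subseteq> kinetic \<iota>0 \<pi>0 "\<lambda>y. fst y v* B1" \<sigma>
proof (rule kinetic.intro[OF splitting_\<iota>0], rule kinetic_axioms.intro)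
  show "linear (\<lambda>y :: (real ^ 'n) \<times> real. fst y v* B1)"
    using linear_compose[OF linear_fst matrix_vector_mul_linear[of "transpose B1"]]
    by (simp add: o_def)
  obtain \<kappa> where k: "0 < \<kappa>" "\<And>b. \<kappa> * norm b \<le> norm (b v* B1)"
    using transpose_bounded_below[OF rank_B1] by blast
  have "0 < \<kappa> * norm (axis undefined 1 :: real ^ 'n)" using k(1) by (simp add: axis_eq_0_iff)
  then have "axis undefined 1 v* B1 \<noteq> 0" using k(2)[of "axis undefined 1"] by auto
  then show "\<exists>y :: (real ^ 'n) \<times> real. fst y v* B1 \<noteq> 0" by (intro exI[of _ "(axis undefined 1, 0)"]) simp
qed (rule \<sigma>_pos)

context kolmogorov_equation
begin

lemma X_eq: "X z = blk0 (fst z)"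
  by (simp add: X_def \<pi>0_def)

lemma H_eq: "H z = blk1 (fst z) v* B1"
  by (simp add: H_def \<pi>0_def)

definition \<theta> :: "real \<Rightarrow> (real ^ ('m + 'n)) \<times> real \<Rightarrow> complex" where
  "\<theta> r z = cutoff (r *\<^sub>R z)"

definition V :: "real \<Rightarrow> ((real ^ ('m + 'n)) \<times> real \<Rightarrow> complex) \<Rightarrow> (real ^ ('m + 'n)) \<times> real \<Rightarrow> complex" where
  "V r u = fourier (\<lambda>z. \<theta> r z * u z)"

text \<open>The terms besides \<open>V r g\<close> come from derivatives falling on the cutoff; they vanish as \<open>r \<rightarrow> 0\<close>.\<close>

definition source :: "real \<Rightarrow> ((real ^ ('m + 'n)) \<times> real \<Rightarrow> complex) \<Rightarrow> ((real ^ ('m + 'n)) \<times> real \<Rightarrow> complex)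
    \<Rightarrow> (real ^ ('m + 'n)) \<times> real \<Rightarrow> complex" where
  "source r u g \<zeta> = V r g \<zeta> - fourier (\<lambda>z. kolmogorov B1 \<sigma> (\<theta> r) z * u z) \<zeta>
     - (\<Sum>l\<in>UNIV. 2 * \<i> * of_real \<sigma> * of_real (fst \<zeta> $ Inl l) * fourier (\<lambda>z. pdiff (e0 l) (\<theta> r) z * u z) \<zeta>)"

lemma test_fun_\<theta>: "0 < r \<Longrightarrow> test_fun (\<theta> r)"
  unfolding \<theta>_def[abs_def] by (rule test_fun_scale[OF test_fun_cutoff])

lemma bcs_\<theta>: "0 < r \<Longrightarrow> bcs (\<theta> r)"
  by (intro test_fun_bcs test_fun_\<theta>)

lemma bcs_pdiff_\<theta>: "0 < r \<Longrightarrow> b \<in> Basis \<Longrightarrow> bcs (pdiff b (\<theta> r))"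
  by (intro test_fun_bcs test_fun_pdiff test_fun_\<theta>)

lemma bcs_kolmogorov:
  assumes h: "test_fun h" shows "bcs (kolmogorov B1 \<sigma> h)"
proof -
  have "bcs (\<lambda>z. (-1) * (\<Sum>k\<in>UNIV. \<Sum>l\<in>UNIV. complex_of_real (B1 $ k $ l) * (of_real (fst z $ Inl l) * pdiff (e1 k) h z))
     + pdiff et h z - of_real \<sigma> * (\<Sum>l\<in>UNIV. pdiff (e0 l) (pdiff (e0 l) h) z))"
    by (intro bcs_diff bcs_add bcs_cmult bcs_sum bcs_coordinate_mult test_fun_bcs test_fun_pdiff h e_Basis)
  then show ?thesis unfolding kolmogorov_def[abs_def] by simp
qed

text \<open>The left side is the derivative of \<open>V r u\<close> along the characteristic, by
  \<open>fourier_line_derivative\<close>; the identity is the weak equation tested with the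
  exponential times the cutoff, solved for that term.\<close>

lemma V_equation:
  assumes u: "L2 u" and g: "L2 g" and r: "0 < r"
    and eq: "eq_distrib (\<lambda>\<phi>. transport_Y (block_matrix B1) (regular u) \<phi> - complex_of_real \<sigma> * laplacian0 (regular u) \<phi>) (regular g)"
  shows "fourier (\<lambda>z. - \<i> * complex_of_real (z \<bullet> \<iota>0 (H \<zeta>, 0)) * (\<theta> r z * u z)) \<zeta> =
     (of_real (\<sigma> * (norm (X \<zeta>))\<^sup>2) - \<i> * of_real (snd \<zeta>)) * V r u \<zeta> - source r u g \<zeta>"
proof -
  define E where "E z = exp (- \<i> * complex_of_real (z \<bullet> \<zeta>))" for z
  define h :: "(real ^ ('m + 'n)) \<times> real" where "h = \<iota>0 (H \<zeta>, 0)"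
  define c where "c = complex_of_real (\<sigma> * (norm (X \<zeta>))\<^sup>2) - \<i> * of_real (snd \<zeta>)"
  have \<phi>: "test_fun (\<lambda>z. E z * \<theta> r z)"
    unfolding E_def by (rule test_fun_mult[OF smooth_exp_ii test_fun_\<theta>[OF r]])
  have b1: "bcs (\<lambda>z. complex_of_real (z \<bullet> h) * \<theta> r z)"
  proof -
    obtain R where R: "\<And>z. \<theta> r z \<noteq> 0 \<Longrightarrow> norm z \<le> R" using bcsE[OF bcs_\<theta>[OF r]] by metis
    show ?thesis
    proof (rule bcs_mult_bounded[OF bcs_\<theta>[OF r], where M="R * norm h"])
      show "norm (complex_of_real (z \<bullet> h)) \<le> R * norm h" if "\<theta> r z \<noteq> 0" for z
        using Cauchy_Schwarz_ineq2[of z h] mult_right_mono[OF R[OF that] norm_ge_zero[of h]] by simp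
    qed measurable
  qed
  have ii: "integrable lborel (\<lambda>z. E z * (\<chi>' z * u z))" if "bcs \<chi>'" for \<chi>'
    unfolding E_def by (intro integrable_exp_mult(2) L2_integrable_mult[OF bcs_L2[OF that] u]) measurable
  have F: "(LINT z|lborel. E z * (\<chi>' z * u z)) = fourier (\<lambda>z. \<chi>' z * u z) \<zeta>" for \<chi>'
    by (simp add: fourier_def E_def)
  have "V r g \<zeta> = (LINT z|lborel. g z * (E z * \<theta> r z))"
    by (simp add: V_def fourier_def E_def mult_ac)
  also have "\<dots> = (LINT z|lborel. u z * kolmogorov B1 \<sigma> (\<lambda>z. E z * \<theta> r z) z)"
    by (rule weak_equation[OF u eq \<phi>])
  also have "\<dots> = (LINT z|lborel. \<i> * (E z * ((complex_of_real (z \<bullet> h) * \<theta> r z) * u z)) + c * (E z * (\<theta> r z * u z))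
     + E z * (kolmogorov B1 \<sigma> (\<theta> r) z * u z)
     + (\<Sum>l\<in>UNIV. (2 * \<i> * of_real \<sigma> * of_real (fst \<zeta> $ Inl l)) * (E z * (pdiff (e0 l) (\<theta> r) z * u z))))"
    unfolding E_def kolmogorov_exp[OF test_fun_smooth[OF test_fun_\<theta>[OF r]]] h_def c_def X_eq H_eq transpose_matrix_vector
    by (intro Bochner_Integration.integral_cong refl) (simp add: sum_distrib_left sum_distrib_right ring_distribs mult_ac)
  also have "\<dots> = \<i> * fourier (\<lambda>z. (complex_of_real (z \<bullet> h) * \<theta> r z) * u z) \<zeta> + c * V r u \<zeta>
     + fourier (\<lambda>z. kolmogorov B1 \<sigma> (\<theta> r) z * u z) \<zeta>
     + (\<Sum>l\<in>UNIV. (2 * \<i> * of_real \<sigma> * of_real (fst \<zeta> $ Inl l)) * fourier (\<lambda>z. pdiff (e0 l) (\<theta> r) z * u z) \<zeta>)"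
    using ii[OF b1] ii[OF bcs_\<theta>[OF r]] ii[OF bcs_kolmogorov[OF test_fun_\<theta>[OF r]]] ii[OF bcs_pdiff_\<theta>[OF r e_Basis(1)]]
    unfolding V_def F[symmetric]
    by (simp add: Bochner_Integration.integral_sum del: mult.assoc)
  also have "\<i> * fourier (\<lambda>z. (complex_of_real (z \<bullet> h) * \<theta> r z) * u z) \<zeta> =
     - fourier (\<lambda>z. - \<i> * complex_of_real (z \<bullet> h) * (\<theta> r z * u z)) \<zeta>"
    unfolding fourier_def
    by (subst integral_mult_right_zero[symmetric], subst Bochner_Integration.integral_minus[symmetric])
       (intro Bochner_Integration.integral_cong refl, simp add: mult_ac)
  finally show ?thesis
    unfolding h_def[symmetric] c_def[symmetric] source_def by simp
qed

text \<open>With the cutoff in place the transforms are differentiable along the line and the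
  inequality holds at every frequency. The time frequency is constant on the line because the shear
  moves only xi_0.\<close>

lemma subsolution_cutoff:
  assumes u: "L2 u" and g: "L2 g" and r: "0 < r"
    and eq: "eq_distrib (\<lambda>\<phi>. transport_Y (block_matrix B1) (regular u) \<phi> - complex_of_real \<sigma> * laplacian0 (regular u) \<phi>) (regular g)"
    and T: "\<And>h. 0 \<le> T h"
  shows "subsolution (V r u) (source r u g) T \<zeta>"
proof -
  have S: "S s \<zeta> = \<zeta> + s *\<^sub>R \<iota>0 (H \<zeta>, 0)" for s by (simp add: S_def)
  have deriv: "((\<lambda>s. fourier (\<lambda>z. \<chi>' z * v z) (S s \<zeta>)) has_vector_derivative
      fourier (\<lambda>z. - \<i> * complex_of_real (z \<bullet> \<iota>0 (H \<zeta>, 0)) * (\<chi>' z * v z)) (S s \<zeta>)) (at s)"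
    if v: "L2 v" and c: "bcs \<chi>'" for \<chi>' v s
  proof -
    obtain R where R: "\<And>z. \<chi>' z \<noteq> 0 \<Longrightarrow> norm z \<le> R" using bcsE[OF c] by metis
    show ?thesis unfolding S
      by (rule fourier_line_derivative[OF L2_integrable_mult[OF bcs_L2[OF c] v], where R=R]) (use R in auto)
  qed
  have cont: "continuous_on UNIV (\<lambda>s. fourier (\<lambda>z. \<chi>' z * v z) (S s \<zeta>))" if "L2 v" "bcs \<chi>'" for \<chi>' v
    by (intro continuous_at_imp_continuous_on ballI has_vector_derivative_continuous[OF deriv[OF that]])
  have snd_S: "snd (S s \<zeta>) = snd \<zeta>" for s by (simp add: S \<iota>0_def)
  have "ennreal (norm (V r u (S 0 \<zeta>))) \<le> ennreal (exp (- A \<zeta> (T (H \<zeta>))) * norm (V r u (S (T (H \<zeta>)) \<zeta>)))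
    + (\<integral>\<^sup>+s. window (T (H \<zeta>)) s * ennreal (exp (- A \<zeta> s) * norm (source r u g (S s \<zeta>))) \<partial>lborel)"
  proof (rule integral_curve_bound[OF T, where a="\<lambda>s. \<sigma> * (norm (X (S s \<zeta>)))\<^sup>2" and \<tau>="snd \<zeta>"])
    show "((\<lambda>s. V r u (S s \<zeta>)) has_vector_derivative
       (of_real (\<sigma> * (norm (X (S s \<zeta>)))\<^sup>2) - \<i> * of_real (snd \<zeta>)) * V r u (S s \<zeta>) - source r u g (S s \<zeta>)) (at s)" for s
      using deriv[OF u bcs_\<theta>[OF r], of s] V_equation[OF u g r eq, of "S s \<zeta>"]
      unfolding H_S snd_S V_def by simp
    show "(A \<zeta> has_real_derivative \<sigma> * (norm (X (S s \<zeta>)))\<^sup>2) (at s)" for s by (rule A_derivative)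
    have "continuous_on UNIV (\<lambda>s. fst (S s \<zeta>) $ Inl l)" for l
      unfolding S by (intro continuous_intros)
    then show "continuous_on UNIV (\<lambda>s. source r u g (S s \<zeta>))"
      unfolding source_def V_def
      by (intro continuous_on_diff continuous_on_sum continuous_on_mult continuous_on_const continuous_on_of_real
           cont u g bcs_\<theta> bcs_kolmogorov test_fun_\<theta> bcs_pdiff_\<theta> r e_Basis)
  qed simp
  then show ?thesis by (simp add: subsolution_def)
qed

section \<open>Removing the cutoff\<close>

definition shrink :: "nat \<Rightarrow> real" where "shrink n = 1 / real (Suc n)"

lemma shrink: "0 < shrink n" "shrink n \<le> 1" "shrink \<longlonglongrightarrow> 0"
proof -
  show "0 < shrink n" "shrink n \<le> 1" by (auto simp: shrink_def)
  show "shrink \<longlonglongrightarrow> 0" unfolding shrink_def by (rule LIMSEQ_Suc[OF lim_1_over_n])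
qed

lemma pdiff_\<theta>:
  "pdiff b (\<theta> r) z = of_real r * pdiff b cutoff (r *\<^sub>R z)"
  "b \<in> Basis \<Longrightarrow> pdiff b (pdiff b (\<theta> r)) z = of_real r * (of_real r * pdiff b (pdiff b cutoff) (r *\<^sub>R z))"
proof -
  note s = test_fun_smooth[OF test_fun_cutoff]
  have 1: "pdiff b (\<theta> r) = (\<lambda>z. of_real r * pdiff b cutoff (r *\<^sub>R z))" for b
    unfolding \<theta>_def[abs_def] using pdiff_eq[OF pdiff_scale[OF s, of 1 r]] by (intro ext) simp
  show "pdiff b (\<theta> r) z = of_real r * pdiff b cutoff (r *\<^sub>R z)" unfolding 1 ..
  show "pdiff b (pdiff b (\<theta> r)) z = of_real r * (of_real r * pdiff b (pdiff b cutoff) (r *\<^sub>R z))" if "b \<in> Basis"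
    unfolding 1 using pdiff_eq[OF pdiff_scale[OF smooth_pdiff[OF s that], of "of_real r" r]] by (simp add: mult.assoc)
qed

lemma scaled_tendsto:
  assumes "test_fun h"
  shows "(\<lambda>n. h (shrink n *\<^sub>R z)) \<longlonglongrightarrow> h 0"
proof -
  have "(\<lambda>n. shrink n *\<^sub>R z) \<longlonglongrightarrow> 0 *\<^sub>R z" by (intro tendsto_intros shrink)
  then show ?thesis
    using continuous_on_tendsto_compose[OF smooth_continuous[OF test_fun_smooth[OF assms]], of "\<lambda>n. shrink n *\<^sub>R z"] by simp
qed

lemma ext_zero: "fourier.ext (\<lambda>_::'a::euclidean_space. 0) (\<lambda>_. 0)"
  by (simp add: fourier.ext_def)

text \<open>Used with c = 1 for the cutoff itself and with c = 0 for its derivatives, whose limit is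
  the transform of 0.\<close>

lemma multiplier_fourier_tendsto:
  fixes u U :: "'a::euclidean_space \<Rightarrow> complex"
  assumes u: "L2 u" and b: "\<And>n. bcs (\<chi>' n)" and M: "\<And>n z. norm (\<chi>' n z) \<le> M"
    and lim: "\<And>z. (\<lambda>n. \<chi>' n z) \<longlonglongrightarrow> c" and e: "fourier.ext (\<lambda>z. c * u z) U"
  shows "(\<lambda>n. \<integral>\<^sup>+z. indicator (cball 0 K) z * ennreal (norm (fourier (\<lambda>z. \<chi>' n z * u z) z - U z)) \<partial>lborel) \<longlonglongrightarrow> 0"
proof -
  have "\<forall>n. \<exists>R. \<forall>z. \<chi>' n z \<noteq> 0 \<longrightarrow> norm z \<le> R" using b unfolding bcs_def by blast
  then obtain R where R: "\<And>n z. \<chi>' n z \<noteq> 0 \<Longrightarrow> norm z \<le> R n" by metis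
  show ?thesis
  proof (rule fourier_tendsto_local[OF _ _ e])
    show "L2 (\<lambda>z. \<chi>' n z * u z)" for n by (rule L2_multiplier[OF u b])
    show "norm z \<le> R n" if "\<chi>' n z * u z \<noteq> 0" for n z using that R by auto
    show "(\<lambda>n. L2norm (\<lambda>z. \<chi>' n z * u z - c * u z)) \<longlonglongrightarrow> 0"
      by (rule multiplier_tendsto[OF u bcs_measurable[OF b] M lim])
  qed
qed

lemma V_tendsto:
  assumes "fourier.ext u U"
  shows "(\<lambda>n. \<integral>\<^sup>+z. indicator (cball 0 K) z * ennreal (norm (V (shrink n) u z - U z)) \<partial>lborel) \<longlonglongrightarrow> 0"
proof -
  obtain M where M: "\<And>z::(real ^ ('m + 'n)) \<times> real. norm (cutoff z) \<le> M"
    using bcsE[OF test_fun_bcs[OF test_fun_cutoff]] by metis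
  show ?thesis unfolding V_def
  proof (rule multiplier_fourier_tendsto[where c=1])
    show "(\<lambda>n. \<theta> (shrink n) z) \<longlonglongrightarrow> 1" for z
      using scaled_tendsto[OF test_fun_cutoff, of z] by (simp add: \<theta>_def cutoff_0)
    show "norm (\<theta> (shrink n) z) \<le> M" for n z unfolding \<theta>_def by (rule M)
  qed (use assms fourier.extD(1)[OF assms] shrink(1) in \<open>auto intro: bcs_\<theta>\<close>)
qed

text \<open>The transport term carries no small factor: the coordinate grows like 1/r on the support
  and cancels the r from the derivative. Up to sign it equals P (r z) with P fixed and bounded, and
  P 0 = 0 because of that coordinate, so dominated convergence still gives the limit 0.\<close>

lemma kolmogorov_tendsto:
  assumes u: "L2 u"
  shows "(\<lambda>n. \<integral>\<^sup>+z. indicator (cball 0 K) z * ennreal (norm (fourier (\<lambda>z. kolmogorov B1 \<sigma> (\<theta> (shrink n)) z * u z) z - 0)) \<partial>lborel) \<longlonglongrightarrow> 0"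
proof -
  define P where "P z = (\<Sum>k\<in>UNIV. \<Sum>l\<in>UNIV. complex_of_real (B1 $ k $ l) * (of_real (fst z $ Inl l) * pdiff (e1 k) cutoff z))" for z
  define N where "N z = (\<Sum>l\<in>UNIV. pdiff (e0 l) (pdiff (e0 l) cutoff) z)" for z :: "(real ^ ('m + 'n)) \<times> real"
  have Pb: "bcs P" unfolding P_def[abs_def]
    by (intro bcs_sum bcs_cmult bcs_coordinate_mult test_fun_bcs test_fun_pdiff test_fun_cutoff e_Basis)
  have Nb: "bcs N" unfolding N_def[abs_def]
    by (intro bcs_sum test_fun_bcs test_fun_pdiff test_fun_cutoff e_Basis)
  have Qt: "test_fun (pdiff (et :: (real ^ ('m + 'n)) \<times> real) cutoff)"
    by (intro test_fun_pdiff test_fun_cutoff e_Basis)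
  have k: "kolmogorov B1 \<sigma> (\<theta> r) z = - P (r *\<^sub>R z) + of_real r * pdiff et cutoff (r *\<^sub>R z) - of_real (\<sigma> * r\<^sup>2) * N (r *\<^sub>R z)" for r z
    unfolding kolmogorov_def P_def N_def
    by (simp add: pdiff_\<theta> e_Basis sum_distrib_left power2_eq_square mult_ac)
  obtain MP where MP: "\<And>z. norm (P z) \<le> MP" using bcsE[OF Pb] by metis
  obtain MQ where MQ: "\<And>z. norm (pdiff (et :: (real ^ ('m + 'n)) \<times> real) cutoff z) \<le> MQ" using bcsE[OF test_fun_bcs[OF Qt]] by metis
  obtain MN where MN: "\<And>z. norm (N z) \<le> MN" using bcsE[OF Nb] by metis
  have "continuous_on UNIV P" unfolding P_def[abs_def]
    by (intro continuous_intros smooth_continuous test_fun_smooth test_fun_pdiff test_fun_cutoff e_Basis)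
  moreover have "continuous_on UNIV N" unfolding N_def[abs_def]
    by (intro continuous_intros smooth_continuous test_fun_smooth test_fun_pdiff test_fun_cutoff e_Basis)
  moreover have z0: "(\<lambda>n. shrink n *\<^sub>R z) \<longlonglongrightarrow> 0" for z :: "(real ^ ('m + 'n)) \<times> real"
    using tendsto_scaleR[OF shrink(3) tendsto_const[of z]] by simp
  ultimately have Pl: "(\<lambda>n. P (shrink n *\<^sub>R z)) \<longlonglongrightarrow> P 0" and Nl: "(\<lambda>n. N (shrink n *\<^sub>R z)) \<longlonglongrightarrow> N 0" for z
    using continuous_on_tendsto_compose[of UNIV P "\<lambda>n. shrink n *\<^sub>R z" 0] continuous_on_tendsto_compose[of UNIV N "\<lambda>n. shrink n *\<^sub>R z" 0] by auto
  have P0: "P 0 = 0" by (simp add: P_def)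
  show ?thesis
  proof (rule multiplier_fourier_tendsto[OF u, where c=0])
    show "bcs (kolmogorov B1 \<sigma> (\<theta> (shrink n)))" for n by (intro bcs_kolmogorov test_fun_\<theta> shrink)
    show "norm (kolmogorov B1 \<sigma> (\<theta> (shrink n)) z) \<le> MP + MQ + \<sigma> * MN" for n z
    proof -
      have "norm (of_real (shrink n) * pdiff et cutoff (shrink n *\<^sub>R z)) \<le> 1 * MQ"
        unfolding norm_mult using shrink(1)[of n] shrink(2)[of n] by (intro mult_mono MQ) auto
      moreover have "norm (of_real (\<sigma> * (shrink n)\<^sup>2) * N (shrink n *\<^sub>R z)) \<le> (\<sigma> * 1) * MN"
      proof -
        have "\<bar>\<sigma> * (shrink n)\<^sup>2\<bar> \<le> \<sigma> * 1"
          using shrink(1)[of n] shrink(2)[of n] \<sigma>_pos by (simp add: abs_mult power_le_one)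
        then show ?thesis
          unfolding norm_mult[of "of_real (\<sigma> * (shrink n)\<^sup>2)"] norm_of_real using \<sigma>_pos by (intro mult_mono MN) auto
      qed
      ultimately show ?thesis unfolding k
        using norm_triangle_ineq4[of "- P (shrink n *\<^sub>R z) + of_real (shrink n) * pdiff et cutoff (shrink n *\<^sub>R z)" "of_real (\<sigma> * (shrink n)\<^sup>2) * N (shrink n *\<^sub>R z)"]
          norm_triangle_ineq[of "- P (shrink n *\<^sub>R z)" "of_real (shrink n) * pdiff et cutoff (shrink n *\<^sub>R z)"] MP[of "shrink n *\<^sub>R z"]
        by simp
    qed
    show "(\<lambda>n. kolmogorov B1 \<sigma> (\<theta> (shrink n)) z) \<longlonglongrightarrow> 0" for z
    proof -
      have "(\<lambda>n. - P (shrink n *\<^sub>R z) + of_real (shrink n) * pdiff et cutoff (shrink n *\<^sub>R z) - of_real (\<sigma> * (shrink n)\<^sup>2) * N (shrink n *\<^sub>R z))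
         \<longlonglongrightarrow> - P 0 + of_real 0 * pdiff et cutoff (0 :: (real ^ ('m + 'n)) \<times> real) - of_real (\<sigma> * 0\<^sup>2) * N 0"
        by (intro tendsto_intros Pl Nl shrink scaled_tendsto[OF Qt])
      then show ?thesis unfolding k by (simp add: P0)
    qed
    show "fourier.ext (\<lambda>z. 0 * u z) (\<lambda>_. 0)" by (simp add: ext_zero)
  qed
qed

lemma pdiff_\<theta>_tendsto:
  assumes u: "L2 u"
  shows "(\<lambda>n. \<integral>\<^sup>+z. indicator (cball 0 K) z * ennreal (norm (fourier (\<lambda>z. pdiff (e0 l) (\<theta> (shrink n)) z * u z) z - 0)) \<partial>lborel) \<longlonglongrightarrow> 0"
proof -
  have Qt: "test_fun (pdiff (e0 l :: (real ^ ('m + 'n)) \<times> real) cutoff)"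
    by (intro test_fun_pdiff test_fun_cutoff e_Basis)
  obtain MQ where MQ: "\<And>z. norm (pdiff (e0 l :: (real ^ ('m + 'n)) \<times> real) cutoff z) \<le> MQ" using bcsE[OF test_fun_bcs[OF Qt]] by metis
  show ?thesis
  proof (rule multiplier_fourier_tendsto[OF u, where c=0])
    show "bcs (pdiff (e0 l) (\<theta> (shrink n)))" for n by (intro bcs_pdiff_\<theta> shrink e_Basis)
    show "norm (pdiff (e0 l) (\<theta> (shrink n)) z) \<le> 1 * MQ" for n z
      unfolding pdiff_\<theta>(1) norm_mult using shrink(1)[of n] shrink(2)[of n] by (intro mult_mono MQ) auto
    have "(\<lambda>n. of_real (shrink n) * pdiff (e0 l) cutoff (shrink n *\<^sub>R z)) \<longlonglongrightarrow> of_real 0 * pdiff (e0 l) cutoff (0 :: (real ^ ('m + 'n)) \<times> real)" for z :: "(real ^ ('m + 'n)) \<times> real"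
      by (intro tendsto_intros shrink scaled_tendsto[OF Qt])
    then show "(\<lambda>n. pdiff (e0 l) (\<theta> (shrink n)) z) \<longlonglongrightarrow> 0" for z
      unfolding pdiff_\<theta>(1) by simp
    show "fourier.ext (\<lambda>z. 0 * u z) (\<lambda>_. 0)" by (simp add: ext_zero)
  qed
qed

text \<open>The gradient term carries the unbounded factor xi_l, so convergence is stated on balls,
  where that factor is at most |K|.\<close>

lemma source_tendsto:
  assumes u: "L2 u" and G: "fourier.ext g G"
  shows "(\<lambda>n. \<integral>\<^sup>+z. indicator (cball 0 K) z * ennreal (norm (source (shrink n) u g z - G z)) \<partial>lborel) \<longlonglongrightarrow> 0"
proof -
  note g = fourier.extD(1)[OF G]
  have [measurable]: "u \<in> borel_measurable borel" "g \<in> borel_measurable borel" "G \<in> borel_measurable borel"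
    using u g fourier.extD(2)[OF G] by (auto simp: L2_iff)
  define J where "J = (indicator (cball 0 K) :: (real ^ ('m + 'n)) \<times> real \<Rightarrow> ennreal)"
  have [measurable]: "J \<in> borel_measurable borel" unfolding J_def by (intro borel_measurable_indicator) simp
  define I where "I h = (\<integral>\<^sup>+z. J z * ennreal (norm (h z)) \<partial>lborel)" for h :: "(real ^ ('m + 'n)) \<times> real \<Rightarrow> complex"
  define h1 where "h1 n z = V (shrink n) g z - G z" for n z
  define h2 where "h2 n z = fourier (\<lambda>z. kolmogorov B1 \<sigma> (\<theta> (shrink n)) z * u z) z - 0" for n z
  define h3 where "h3 n l z = fourier (\<lambda>z. pdiff (e0 l) (\<theta> (shrink n)) z * u z) z - 0" for n l z
  have L: "bcs \<chi>' \<Longrightarrow> (\<lambda>z. \<chi>' z * v z) \<in> borel_measurable borel" if "v \<in> borel_measurable borel" for \<chi>' v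
    using that by (intro borel_measurable_times[OF bcs_measurable])
  have [measurable]: "h1 n \<in> borel_measurable borel" for n
    unfolding h1_def V_def by (intro borel_measurable_diff fourier_measurable L bcs_\<theta> shrink) measurable
  have [measurable]: "h2 n \<in> borel_measurable borel" for n
    unfolding h2_def by (intro borel_measurable_diff fourier_measurable L bcs_kolmogorov test_fun_\<theta> shrink) measurable
  have [measurable]: "h3 n l \<in> borel_measurable borel" for n l
    unfolding h3_def by (intro borel_measurable_diff fourier_measurable L bcs_pdiff_\<theta> e_Basis shrink) measurable
  define c where "c = ennreal (2 * \<sigma> * \<bar>K\<bar>)"
  have pt: "J z * ennreal (norm (source (shrink n) u g z - G z)) \<le> (J z * ennreal (norm (h1 n z)) + J z * ennreal (norm (h2 n z)))
      + (\<Sum>l\<in>UNIV. c * (J z * ennreal (norm (h3 n l z))))" for n z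
  proof (cases "z \<in> cball 0 K")
    case True
    have zl: "\<bar>fst z $ Inl l\<bar> \<le> \<bar>K\<bar>" for l
      using True component_le_norm_cart[of "fst z" "Inl l"] norm_fst_le[of "fst z" "snd z"] by simp
    have "source (shrink n) u g z - G z = h1 n z - h2 n z - (\<Sum>l\<in>UNIV. 2 * \<i> * of_real \<sigma> * of_real (fst z $ Inl l) * h3 n l z)"
      by (simp add: source_def h1_def h2_def h3_def)
    moreover have "norm (a - b - c) \<le> (norm a + norm b) + norm c" for a b c :: complex
      using norm_triangle_ineq4[of "a - b" c] norm_triangle_ineq4[of a b] by linarith
    ultimately have "norm (source (shrink n) u g z - G z) \<le> (norm (h1 n z) + norm (h2 n z)) + norm (\<Sum>l\<in>UNIV. 2 * \<i> * of_real \<sigma> * of_real (fst z $ Inl l) * h3 n l z)"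
      by simp
    also have "norm (\<Sum>l\<in>UNIV. 2 * \<i> * of_real \<sigma> * of_real (fst z $ Inl l) * h3 n l z) \<le> (\<Sum>l\<in>UNIV. (2 * \<sigma> * \<bar>K\<bar>) * norm (h3 n l z))"
    proof (rule order_trans[OF norm_sum], rule sum_mono)
      fix l :: 'm
      have "2 * \<sigma> * \<bar>fst z $ Inl l\<bar> \<le> 2 * \<sigma> * \<bar>K\<bar>" using zl[of l] \<sigma>_pos by (intro mult_left_mono) auto
      then show "norm (2 * \<i> * of_real \<sigma> * of_real (fst z $ Inl l) * h3 n l z) \<le> (2 * \<sigma> * \<bar>K\<bar>) * norm (h3 n l z)"
        using \<sigma>_pos by (simp add: norm_mult mult_right_mono)
    qed
    finally have "ennreal (norm (source (shrink n) u g z - G z)) \<le> ennreal ((norm (h1 n z) + norm (h2 n z)) + (\<Sum>l\<in>UNIV. (2 * \<sigma> * \<bar>K\<bar>) * norm (h3 n l z)))"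
      by (simp add: ennreal_leI)
    also have "\<dots> = (ennreal (norm (h1 n z)) + ennreal (norm (h2 n z))) + (\<Sum>l\<in>UNIV. c * ennreal (norm (h3 n l z)))"
    proof -
      have "ennreal (\<Sum>l\<in>UNIV. (2 * \<sigma> * \<bar>K\<bar>) * norm (h3 n l z)) = (\<Sum>l\<in>UNIV. ennreal ((2 * \<sigma> * \<bar>K\<bar>) * norm (h3 n l z)))"
        using \<sigma>_pos by (intro sum_ennreal[symmetric]) simp
      also have "\<dots> = (\<Sum>l\<in>UNIV. c * ennreal (norm (h3 n l z)))"
        unfolding c_def using \<sigma>_pos by (intro sum.cong refl ennreal_mult) auto
      finally have e: "ennreal (\<Sum>l\<in>UNIV. (2 * \<sigma> * \<bar>K\<bar>) * norm (h3 n l z)) = (\<Sum>l\<in>UNIV. c * ennreal (norm (h3 n l z)))" .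
      have "0 \<le> (\<Sum>l\<in>UNIV. (2 * \<sigma> * \<bar>K\<bar>) * norm (h3 n l z))" using \<sigma>_pos by (intro sum_nonneg) simp
      then show ?thesis unfolding e[symmetric] by (simp only: ennreal_plus norm_ge_zero add_nonneg_nonneg)
    qed
    finally show ?thesis using True by (simp add: J_def)
  qed (simp add: J_def)
  have le: "I (\<lambda>z. source (shrink n) u g z - G z) \<le> (I (h1 n) + I (h2 n)) + (\<Sum>l\<in>UNIV. c * I (h3 n l))" for n
  proof -
    have "I (\<lambda>z. source (shrink n) u g z - G z) \<le> (\<integral>\<^sup>+z. (J z * ennreal (norm (h1 n z)) + J z * ennreal (norm (h2 n z)))
      + (\<Sum>l\<in>UNIV. c * (J z * ennreal (norm (h3 n l z)))) \<partial>lborel)"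
      unfolding I_def by (rule nn_integral_mono) (rule pt)
    also have "\<dots> = (\<integral>\<^sup>+z. J z * ennreal (norm (h1 n z)) + J z * ennreal (norm (h2 n z)) \<partial>lborel)
      + (\<integral>\<^sup>+z. (\<Sum>l\<in>UNIV. c * (J z * ennreal (norm (h3 n l z)))) \<partial>lborel)"
      by (rule nn_integral_add) measurable
    also have "(\<integral>\<^sup>+z. J z * ennreal (norm (h1 n z)) + J z * ennreal (norm (h2 n z)) \<partial>lborel) = I (h1 n) + I (h2 n)"
      unfolding I_def by (rule nn_integral_add) measurable
    also have "(\<integral>\<^sup>+z. (\<Sum>l\<in>UNIV. c * (J z * ennreal (norm (h3 n l z)))) \<partial>lborel) = (\<Sum>l\<in>UNIV. (\<integral>\<^sup>+z. c * (J z * ennreal (norm (h3 n l z))) \<partial>lborel))"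
      by (rule nn_integral_sum) measurable
    also have "\<dots> = (\<Sum>l\<in>UNIV. c * I (h3 n l))"
      unfolding I_def by (intro sum.cong refl nn_integral_cmult) measurable
    finally show ?thesis .
  qed
  have "(\<lambda>n. (I (h1 n) + I (h2 n)) + (\<Sum>l\<in>UNIV. c * I (h3 n l))) \<longlonglongrightarrow> (0 + 0) + (\<Sum>l\<in>(UNIV :: 'm set). c * 0)"
    unfolding I_def J_def h1_def h2_def h3_def
    by (intro tendsto_add tendsto_sum ennreal_tendsto_cmult V_tendsto[OF G] kolmogorov_tendsto[OF u] pdiff_\<theta>_tendsto[OF u])
       (simp add: c_def)
  then have l0: "(\<lambda>n. (I (h1 n) + I (h2 n)) + (\<Sum>l\<in>UNIV. c * I (h3 n l))) \<longlonglongrightarrow> 0" by simp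
  have "(\<lambda>n. I (\<lambda>z. source (shrink n) u g z - G z)) \<longlonglongrightarrow> 0"
    by (rule tendsto_sandwich[OF _ always_eventually[OF allI[OF le]] tendsto_const l0]) simp
  then show ?thesis unfolding I_def J_def .
qed

lemma source_measurable:
  assumes "L2 u" "L2 g" "0 < r" shows "source r u g \<in> borel_measurable borel"
proof -
  have L: "bcs \<chi>' \<Longrightarrow> L2 v \<Longrightarrow> (\<lambda>z. \<chi>' z * v z) \<in> borel_measurable borel" for \<chi>' v :: "(real ^ ('m + 'n)) \<times> real \<Rightarrow> complex"
    by (rule borel_measurable_times[OF bcs_measurable L2_measurable])
  have c: "(\<lambda>z::(real ^ ('m + 'n)) \<times> real. complex_of_real (fst z $ Inl l)) \<in> borel_measurable borel" for l
    by (intro borel_measurable_continuous_onI continuous_intros)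
  show ?thesis unfolding source_def[abs_def] V_def
    by (intro borel_measurable_diff borel_measurable_sum borel_measurable_times borel_measurable_const c fourier_measurable L
        bcs_\<theta> bcs_kolmogorov test_fun_\<theta> bcs_pdiff_\<theta> e_Basis assms)
qed

text \<open>An inequality between L2 classes, valid almost everywhere for any measurable time that
  depends on eta only; \<open>regularity\<close> uses it for both choices of time.\<close>

lemma subsolution_fourier:
  assumes U: "fourier.ext u U" and G: "fourier.ext g G"
    and eq: "eq_distrib (\<lambda>\<phi>. transport_Y (block_matrix B1) (regular u) \<phi> - complex_of_real \<sigma> * laplacian0 (regular u) \<phi>) (regular g)"
    and T: "T \<in> borel_measurable borel" "\<And>h. 0 \<le> T h"
  shows "AE z in lborel. subsolution U G T z"
proof (rule subsolution_limit[where V="\<lambda>n. V (shrink n) u" and f="\<lambda>n. source (shrink n) u g"])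
  note u = fourier.extD(1)[OF U] and g = fourier.extD(1)[OF G]
  show "U \<in> borel_measurable borel" "G \<in> borel_measurable borel"
    using fourier.extD(2)[OF U] fourier.extD(2)[OF G] by (auto simp: L2_iff)
  show "V (shrink n) u \<in> borel_measurable borel" for n
    unfolding V_def by (intro fourier_measurable borel_measurable_times[OF bcs_measurable L2_measurable] bcs_\<theta> shrink u)
  show "source (shrink n) u g \<in> borel_measurable borel" for n by (intro source_measurable u g shrink)
  show "subsolution (V (shrink n) u) (source (shrink n) u g) T z" for n z
    by (rule subsolution_cutoff[OF u g shrink(1) eq T(2)])
qed (use T V_tendsto[OF U] source_tendsto[OF fourier.extD(1)[OF U] G] in auto)

end

section \<open>The regularity estimate\<close>

text \<open>The two terms balance at \<epsilon> = (b/d)^(1/3), where they are 4 and 8 times the same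
  product, whence 12. If b or d is 0, a limit of \<epsilon> to 0 or to infinity forces a = 0
  instead.\<close>

lemma optimize_interpolation:
  fixes a b d k :: real
  assumes nn: "0 \<le> a" "0 \<le> b" "0 \<le> d" "0 \<le> k"
    and le: "\<And>\<epsilon>. 0 < \<epsilon> \<Longrightarrow> a\<^sup>2 \<le> k * (4 / \<epsilon> ^ 4 * b\<^sup>2 + 8 * \<epsilon>\<^sup>2 * d\<^sup>2)"
  shows "a \<le> sqrt (12 * k) * b powr (1/3) * d powr (2/3)"
proof -
  define r where "r n = 1 / real (Suc n)" for n
  have r: "0 < r n" for n by (simp add: r_def)
  have r0: "r \<longlonglongrightarrow> 0" unfolding r_def by (rule LIMSEQ_Suc[OF lim_1_over_n])
  consider "b = 0" | "d = 0" | "0 < b" "0 < d" using nn by linarith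
  then show ?thesis
  proof cases
    case 1
    have "(\<lambda>n. k * (8 * (r n)\<^sup>2 * d\<^sup>2)) \<longlonglongrightarrow> k * (8 * 0\<^sup>2 * d\<^sup>2)" by (intro tendsto_intros r0)
    moreover have "a\<^sup>2 \<le> k * (8 * (r n)\<^sup>2 * d\<^sup>2)" for n using le[OF r, of n] 1 by simp
    ultimately have "a\<^sup>2 \<le> k * (8 * 0\<^sup>2 * d\<^sup>2)" by (intro LIMSEQ_le_const) blast+
    then show ?thesis using 1 by simp
  next
    case 2
    have "a\<^sup>2 \<le> k * (4 * (r n) ^ 4 * b\<^sup>2)" for n
      using le[of "1 / r n"] r[of n] 2 by (simp add: power_divide)
    moreover have "(\<lambda>n. k * (4 * (r n) ^ 4 * b\<^sup>2)) \<longlonglongrightarrow> k * (4 * 0 ^ 4 * b\<^sup>2)" by (intro tendsto_intros r0)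
    ultimately have "a\<^sup>2 \<le> k * (4 * 0 ^ 4 * b\<^sup>2)" by (intro LIMSEQ_le_const) blast+
    then show ?thesis using 2 by simp
  next
    case 3
    \<comment> \<open>Cube roots as variables make the optimal \<epsilon> the quotient p / q and
      turn the balance into an identity between rational functions.\<close>
    define p where "p = b powr (1/3)"
    define q where "q = d powr (1/3)"
    have pq: "0 < p" "0 < q" using 3 by (auto simp: p_def q_def)
    have cube: "(x powr (1/3)) ^ 3 = x" if "0 < x" for x :: real
    proof -
      have "(x powr (1/3)) ^ 3 = (x powr (1/3)) powr real 3"
        using that by (intro powr_realpow[symmetric]) simp
      then show ?thesis using that by (simp add: powr_powr)
    qed
    have b: "b = p ^ 3" and d: "d = q ^ 3" using 3 by (simp_all add: p_def q_def cube)
    have q2: "d powr (2/3) = q\<^sup>2"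
      using 3 by (simp add: q_def power2_eq_square flip: powr_add)
    have "a\<^sup>2 \<le> k * (4 / (p / q) ^ 4 * (p ^ 3)\<^sup>2 + 8 * (p / q)\<^sup>2 * (q ^ 3)\<^sup>2)"
      using le[of "p / q"] pq unfolding b d by simp
    also have "4 / (p / q) ^ 4 * (p ^ 3)\<^sup>2 + 8 * (p / q)\<^sup>2 * (q ^ 3)\<^sup>2 = 12 * (p * q\<^sup>2)\<^sup>2"
      using pq by (simp add: field_simps eval_nat_numeral)
    finally have "a\<^sup>2 \<le> (sqrt (12 * k) * p * q\<^sup>2)\<^sup>2"
      using nn(4) by (simp add: power_mult_distrib mult_ac)
    then have "a \<le> sqrt (12 * k) * p * q\<^sup>2"
      by (rule power2_le_imp_le) (use pq nn(4) in simp)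
    then show ?thesis by (simp add: q2 p_def)
  qed
qed

section \<open>Back to fractional derivatives and distributions\<close>

lemma (in splitting) DIM_splitting: "DIM('z) = DIM('x) + DIM('y)"
proof -
  have "card (\<iota> ` Basis) = card (Basis :: ('x \<times> 'y) set)"
    by (rule card_image) (rule inj_on_subset[OF inj_\<iota>], simp)
  then show ?thesis unfolding \<iota>_Basis by simp
qed

text \<open>Finiteness on the full transform is carried to the partial one by
  \<open>nsq_weight\<close>, and \<open>ext_surj\<close> then produces the derivative itself. The
  power of 2 pi has the full dimension as exponent whichever block is transformed, so it cancels in
  the final inequality.\<close>

lemma (in splitting) fractional_power_exists:
  assumes w: "partial.ext u w" and W: "fourier.ext u W" and m: "m \<in> borel_measurable borel"
    and L: "L2 (\<lambda>z. complex_of_real (m (fst (\<pi> z))) * W z)"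
  shows "\<exists>v. partial.ext v (\<lambda>z. complex_of_real (m (fst (\<pi> z))) * w z) \<and>
    nsq (\<lambda>z. complex_of_real (m (fst (\<pi> z))) * W z) = ennreal ((2*pi) ^ DIM('z) * (L2norm v)\<^sup>2)"
proof -
  note [measurable] = m
  let ?w = "\<lambda>z. complex_of_real (m (fst (\<pi> z))) * w z"
  have [measurable]: "w \<in> borel_measurable borel" using partial.extD(2)[OF w] by (simp add: L2_iff)
  note eq = nsq_weight[OF w W m]
  have "nsq ?w < top"
    using L eq by (auto simp: L2_iff ennreal_mult_less_top)
  then have wL: "L2 ?w" by (simp add: L2_iff)
  obtain v where v: "partial.ext v ?w" using partial.ext_surj[OF wL] by blast
  have "(L2norm ?w)\<^sup>2 = (2*pi) ^ DIM('x) * (L2norm v)\<^sup>2"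
    using partial.ext_norm[OF v] by (simp add: power_mult_distrib)
  then have "nsq ?w = ennreal ((2*pi) ^ DIM('x) * (L2norm v)\<^sup>2)"
    using nsq_L2norm[OF wL] by simp
  then have "nsq (\<lambda>z. complex_of_real (m (fst (\<pi> z))) * W z) = ennreal ((2*pi) ^ DIM('y) * ((2*pi) ^ DIM('x) * (L2norm v)\<^sup>2))"
    unfolding eq by (subst ennreal_mult) auto
  also have "(2*pi) ^ DIM('y) * ((2*pi) ^ DIM('x) * (L2norm v)\<^sup>2) = (2*pi) ^ DIM('z) * (L2norm v)\<^sup>2"
    unfolding DIM_splitting by (simp add: power_add)
  finally show ?thesis using v by blast
qed

lemma ext_L2_transform:
  "s0.partial.ext u w \<Longrightarrow> L2_transform fourier0 u w"
  "s1.partial.ext u w \<Longrightarrow> L2_transform fourier1 u w"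
  by (auto simp: L2_transform_def s0.partial.ext_def s1.partial.ext_def regular_def
      fourier0_partial fourier1_partial test_fun_bcs)

text \<open>The pairing of \<open>u\<close> with the Laplacian of \<phi> is rewritten by
  \<open>ext_inverse\<close> as a pairing with \<open>w\<close>, where the derivatives become
  -|xi_0|^2; moving this weight to \<open>w\<close> and inverting back gives
  \<open>v\<close>.\<close>

lemma laplacian_eq:
  fixes u v w :: "(real ^ ('m::finite + 'n::finite)) \<times> real \<Rightarrow> complex"
  assumes w: "s0.partial.ext u w" and v: "s0.partial.ext v (\<lambda>z. complex_of_real (norm (blk0 (fst z)) ^ 2) * w z)"
  shows "eq_distrib (laplacian0 (regular u)) (regular (\<lambda>z. - v z))"
  unfolding eq_distrib_def
proof (intro allI impI)
  fix \<phi> :: "(real ^ ('m + 'n)) \<times> real \<Rightarrow> complex" assume \<phi>: "test_fun \<phi>"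
  let ?\<psi> = "\<lambda>l. pdiff (e0 l) (pdiff (e0 l) \<phi>)"
  have \<psi>: "test_fun (?\<psi> l)" for l by (intro test_fun_pdiff \<phi> e_Basis)
  define c where "c = complex_of_real ((2*pi) ^ DIM(real ^ 'm))"
  have c: "c \<noteq> 0" by (simp add: c_def)
  \<comment> \<open>The inverse transform of a test function up to the factor \<open>c\<close>, in
    the form in which \<open>ext_inverse\<close> provides it.\<close>
  let ?P = "\<lambda>h z. cnj (s0.partial (\<lambda>z. cnj (h z)) z)"
  have P: "?P (?\<psi> l) z = - complex_of_real ((fst z $ Inl l)\<^sup>2) * ?P \<phi> z" for l z
  proof -
    have e: "e0 l = \<iota>0 (axis l 1, 0 :: (real ^ 'n) \<times> real)" by (simp add: \<iota>0_def join_axis)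
    have c1: "(\<lambda>z. cnj (?\<psi> l z)) = pdiff (e0 l) (pdiff (e0 l) (\<lambda>z. cnj (\<phi> z)))"
      by (simp add: smooth_cnj(2) test_fun_smooth \<phi> smooth_pdiff e_Basis)
    have c2: "s0.partial (pdiff (e0 l) (pdiff (e0 l) (\<lambda>z. cnj (\<phi> z)))) z =
        - complex_of_real ((fst (\<pi>0 z) \<bullet> axis l 1)\<^sup>2) * s0.partial (\<lambda>z. cnj (\<phi> z)) z"
      unfolding e by (rule s0.partial_pdiff2[OF test_fun_cnj[OF \<phi>]]) (auto simp: Basis_vec_real)
    show ?thesis unfolding c1 c2 by (simp add: \<pi>0_def inner_axis)
  qed
  have int: "integrable lborel (\<lambda>z. w z * ?P h z)" if "bcs h" for h
    by (intro L2_integrable_mult s0.partial.extD(2)[OF w] L2_cnj s0.L2_partial bcs_cnj that)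
  have "laplacian0 (regular u) \<phi> = (\<Sum>l\<in>UNIV. LINT z|lborel. u z * ?\<psi> l z)"
    by (simp add: laplacian0_def dpartial_def regular_def)
  also have "\<dots> = (\<Sum>l\<in>UNIV. (LINT z|lborel. w z * ?P (?\<psi> l) z) / c)"
    unfolding c_def by (intro sum.cong refl s0.partial.ext_inverse[OF w] test_fun_bcs \<psi>)
  also have "\<dots> = (LINT z|lborel. (\<Sum>l\<in>UNIV. w z * ?P (?\<psi> l) z)) / c"
    by (subst Bochner_Integration.integral_sum) (auto intro!: int test_fun_bcs \<psi> simp: sum_divide_distrib)
  also have "(LINT z|lborel. (\<Sum>l\<in>UNIV. w z * ?P (?\<psi> l) z)) = (LINT z|lborel. - ((complex_of_real (norm (blk0 (fst z)) ^ 2) * w z) * ?P \<phi> z))"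
  proof (intro Bochner_Integration.integral_cong refl)
    fix z :: "(real ^ ('m + 'n)) \<times> real"
    have n: "complex_of_real (norm (blk0 (fst z)) ^ 2) = (\<Sum>l\<in>UNIV. complex_of_real ((fst z $ Inl l)\<^sup>2))"
      unfolding power2_norm_eq_inner by (simp add: inner_vec_def power2_eq_square)
    show "(\<Sum>l\<in>UNIV. w z * ?P (?\<psi> l) z) = - ((complex_of_real (norm (blk0 (fst z)) ^ 2) * w z) * ?P \<phi> z)"
      unfolding P n by (simp add: sum_distrib_left sum_distrib_right sum_negf mult_ac)
  qed
  also have "\<dots> / c = - ((LINT z|lborel. (complex_of_real (norm (blk0 (fst z)) ^ 2) * w z) * ?P \<phi> z) / c)"
    by simp
  also have "(LINT z|lborel. (complex_of_real (norm (blk0 (fst z)) ^ 2) * w z) * ?P \<phi> z) / c = (LINT z|lborel. v z * \<phi> z)"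
    unfolding c_def by (rule s0.partial.ext_inverse[OF v test_fun_bcs[OF \<phi>], symmetric])
  finally show "laplacian0 (regular u) \<phi> = regular (\<lambda>z. - v z) \<phi>"
    by (simp add: regular_def)
qed

text \<open>\<kappa> comes as an argument and the bound is spelled out in terms of it, so that the
  constant can be fixed before \<sigma>, \<open>g\<close> and \<open>u\<close>.\<close>

lemma (in kolmogorov_equation) regularity:
  assumes g: "L2 g" and u: "L2 u" and \<kappa>: "0 < \<kappa>" "\<And>b. \<kappa> * norm b \<le> norm (b v* B1)"
    and eq: "eq_distrib (\<lambda>\<phi>. transport_Y (block_matrix B1) (regular u) \<phi> - complex_of_real \<sigma> * laplacian0 (regular u) \<phi>) (regular g)"
  shows "distrib_in_L2 (transport_Y (block_matrix B1) (regular u)) \<and> distrib_in_L2 (laplacian0 (regular u)) \<and>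
    (\<exists>v0 v1. has_D0 2 u v0 \<and> has_D1 (2/3) u v1 \<and>
      L2norm v1 \<le> sqrt (12 * (1 / \<kappa> powr (2/3))\<^sup>2) * L2norm v0 powr (1/3) * L2norm g powr (2/3))"
proof -
  obtain U where U: "fourier.ext u U" using fourier.ext_exists[OF u] by blast
  obtain G where G: "fourier.ext g G" using fourier.ext_exists[OF g] by blast
  have UL: "L2 U" and GL: "L2 G" using fourier.extD(2)[OF U] fourier.extD(2)[OF G] by auto
  have [measurable]: "U \<in> borel_measurable borel" "G \<in> borel_measurable borel" using UL GL by (auto simp: L2_iff)
  \<comment> \<open>The only use of the critical time: it makes the first term on the right of
    \<open>interp\<close> finite.\<close>
  have W: "L2 (\<lambda>z. complex_of_real ((norm (X z))\<^sup>2) * U z)"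
    by (rule elliptic_estimate[OF UL GL subsolution_fourier[OF U G eq crit_time_measurable crit_time_nonneg]])
  have interp: "nsq (\<lambda>z. complex_of_real (norm (H z) powr (2/3)) * U z) \<le>
    ennreal (4 / \<epsilon> ^ 4) * nsq (\<lambda>z. complex_of_real ((norm (X z))\<^sup>2) * U z) + ennreal (8 * \<epsilon>\<^sup>2) * nsq G" if "0 < \<epsilon>" for \<epsilon>
    by (rule interpolation_estimate[OF _ _ that subsolution_fourier[OF U G eq]]) (use that in auto)
  obtain w0 where w0: "s0.partial.ext u w0" using s0.partial.ext_exists[OF u] by blast
  obtain w1 where w1: "s1.partial.ext u w1" using s1.partial.ext_exists[OF u] by blast
  \<comment> \<open>The Plancherel factor common to all three norms; it is divided out before
    \<epsilon> is optimised.\<close>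
  define D where "D = (2*pi) ^ DIM((real ^ ('m + 'n)) \<times> real)"
  have D: "0 < D" by (simp add: D_def)
  have "\<exists>v. s0.partial.ext v (\<lambda>z. complex_of_real (norm (fst (\<pi>0 z)) ^ 2) * w0 z) \<and>
    nsq (\<lambda>z. complex_of_real (norm (fst (\<pi>0 z)) ^ 2) * U z) = ennreal (D * (L2norm v)\<^sup>2)"
    unfolding D_def by (rule s0.fractional_power_exists[OF w0 U]) (use W in \<open>auto simp: X_def\<close>)
  then obtain v0 where v0: "s0.partial.ext v0 (\<lambda>z. complex_of_real (norm (blk0 (fst z)) ^ 2) * w0 z)"
    and n0: "nsq (\<lambda>z. complex_of_real (norm (X z) ^ 2) * U z) = ennreal (D * (L2norm v0)\<^sup>2)"
    by (auto simp: X_def \<pi>0_def)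
  have nG: "nsq G = ennreal (D * (L2norm g)\<^sup>2)"
    using fourier.ext_norm[OF G] by (simp add: nsq_L2norm GL power_mult_distrib D_def)
  define k where "k = (1 / \<kappa> powr (2/3))\<^sup>2"
  \<comment> \<open>|eta| \<ge> \<kappa> |xi_1| passes from the weight |eta|^(2/3) to the weight
    |xi_1|^(2/3) that defines the derivative.\<close>
  have comp: "nsq (\<lambda>z. complex_of_real (norm (fst (\<pi>1 z)) powr (2/3)) * U z) \<le>
     ennreal k * nsq (\<lambda>z. complex_of_real (norm (H z) powr (2/3)) * U z)"
  proof -
    have "nsq (\<lambda>z. complex_of_real (norm (fst (\<pi>1 z)) powr (2/3)) * U z) \<le>
       (\<integral>\<^sup>+z. ennreal k * ennreal ((norm (complex_of_real (norm (H z) powr (2/3)) * U z))\<^sup>2) \<partial>lborel)"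
      unfolding nsq_def
    proof (rule nn_integral_mono)
      fix z :: "(real ^ ('m + 'n)) \<times> real"
      have "\<kappa> powr (2/3) * norm (blk1 (fst z)) powr (2/3) = (\<kappa> * norm (blk1 (fst z))) powr (2/3)"
        using \<kappa>(1) by (simp add: powr_mult)
      also have "\<dots> \<le> norm (H z) powr (2/3)"
        unfolding H_eq using \<kappa> by (intro powr_mono2) auto
      finally have "norm (blk1 (fst z)) powr (2/3) \<le> 1 / \<kappa> powr (2/3) * norm (H z) powr (2/3)"
        using \<kappa>(1) by (simp add: field_simps)
      then have "norm (blk1 (fst z)) powr (2/3) * norm (U z) \<le> 1 / \<kappa> powr (2/3) * norm (H z) powr (2/3) * norm (U z)"
        by (rule mult_right_mono) simp
      then have "(norm (blk1 (fst z)) powr (2/3) * norm (U z))\<^sup>2 \<le> (1 / \<kappa> powr (2/3) * (norm (H z) powr (2/3) * norm (U z)))\<^sup>2"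
        by (intro power_mono) (simp_all add: mult.assoc)
      then have "(norm (blk1 (fst z)) powr (2/3) * norm (U z))\<^sup>2 \<le> k * (norm (H z) powr (2/3) * norm (U z))\<^sup>2"
        unfolding k_def by (simp only: power_mult_distrib)
      then have "ennreal ((norm (blk1 (fst z)) powr (2/3) * norm (U z))\<^sup>2) \<le> ennreal (k * (norm (H z) powr (2/3) * norm (U z))\<^sup>2)"
        by (rule ennreal_leI)
      also have "\<dots> = ennreal k * ennreal ((norm (H z) powr (2/3) * norm (U z))\<^sup>2)"
        by (rule ennreal_mult) (simp_all add: k_def)
      finally show "ennreal ((norm (complex_of_real (norm (fst (\<pi>1 z)) powr (2/3)) * U z))\<^sup>2) \<le>
         ennreal k * ennreal ((norm (complex_of_real (norm (H z) powr (2/3)) * U z))\<^sup>2)"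
        by (simp add: \<pi>1_def norm_mult)
    qed
    also have "\<dots> = ennreal k * nsq (\<lambda>z. complex_of_real (norm (H z) powr (2/3)) * U z)"
      unfolding nsq_def by (rule nn_integral_cmult) measurable
    finally show ?thesis .
  qed
  have bound: "nsq (\<lambda>z. complex_of_real (norm (fst (\<pi>1 z)) powr (2/3)) * U z) \<le>
     ennreal (k * (4 / \<epsilon> ^ 4 * (D * (L2norm v0)\<^sup>2) + 8 * \<epsilon>\<^sup>2 * (D * (L2norm g)\<^sup>2)))" if e: "0 < \<epsilon>" for \<epsilon>
  proof -
    have "nsq (\<lambda>z. complex_of_real (norm (fst (\<pi>1 z)) powr (2/3)) * U z) \<le>
      ennreal k * (ennreal (4 / \<epsilon> ^ 4) * ennreal (D * (L2norm v0)\<^sup>2) + ennreal (8 * \<epsilon>\<^sup>2) * ennreal (D * (L2norm g)\<^sup>2))"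
      using comp interp[OF e] unfolding n0 nG by (meson mult_left_mono order_trans zero_le)
    also have "\<dots> = ennreal (k * (4 / \<epsilon> ^ 4 * (D * (L2norm v0)\<^sup>2) + 8 * \<epsilon>\<^sup>2 * (D * (L2norm g)\<^sup>2)))"
    proof -
      have "ennreal k * (ennreal a * ennreal b + ennreal c * ennreal d) = ennreal (k * (a * b + c * d))"
        if "0 \<le> a" "0 \<le> b" "0 \<le> c" "0 \<le> d" for a b c d
        using that by (simp add: ennreal_mult k_def)
      then show ?thesis using D by simp
    qed
    finally show ?thesis .
  qed
  \<comment> \<open>A single \<epsilon> shows finiteness and hence the existence of
    \<open>v1\<close>; after that its norm is bounded for every \<epsilon>.\<close>
  have L1: "L2 (\<lambda>z. complex_of_real (norm (fst (\<pi>1 z)) powr (2/3)) * U z)"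
    unfolding L2_iff using bound[of 1] by (auto intro: le_less_trans)
  have "\<exists>v. s1.partial.ext v (\<lambda>z. complex_of_real (norm (fst (\<pi>1 z)) powr (2/3)) * w1 z) \<and>
    nsq (\<lambda>z. complex_of_real (norm (fst (\<pi>1 z)) powr (2/3)) * U z) = ennreal (D * (L2norm v)\<^sup>2)"
    unfolding D_def by (rule s1.fractional_power_exists[OF w1 U _ L1]) measurable
  then obtain v1 where v1: "s1.partial.ext v1 (\<lambda>z. complex_of_real (norm (blk1 (fst z)) powr (2/3)) * w1 z)"
    and n1: "nsq (\<lambda>z. complex_of_real (norm (fst (\<pi>1 z)) powr (2/3)) * U z) = ennreal (D * (L2norm v1)\<^sup>2)"
    by (auto simp: \<pi>1_def)
  have norm: "L2norm v1 \<le> sqrt (12 * k) * L2norm v0 powr (1/3) * L2norm g powr (2/3)"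
  proof (rule optimize_interpolation)
    fix \<epsilon> :: real assume e: "0 < \<epsilon>"
    have "D * (L2norm v1)\<^sup>2 \<le> k * (4 / \<epsilon> ^ 4 * (D * (L2norm v0)\<^sup>2) + 8 * \<epsilon>\<^sup>2 * (D * (L2norm g)\<^sup>2))"
      using bound[OF e] D unfolding n1 by (subst (asm) ennreal_le_iff) (auto simp: k_def)
    also have "\<dots> = D * (k * (4 / \<epsilon> ^ 4 * (L2norm v0)\<^sup>2 + 8 * \<epsilon>\<^sup>2 * (L2norm g)\<^sup>2))"
      by (simp add: algebra_simps)
    finally show "(L2norm v1)\<^sup>2 \<le> k * (4 / \<epsilon> ^ 4 * (L2norm v0)\<^sup>2 + 8 * \<epsilon>\<^sup>2 * (L2norm g)\<^sup>2)"
      using D by simp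
  qed (simp_all add: k_def)
  \<comment> \<open>\<open>has_D0\<close> has a real exponent and the estimates a square; both are 0
    at the origin.\<close>
  have powr2: "norm x powr 2 = norm x ^ 2" for x :: "real ^ 'm"
    by (rule powr_numeral) simp
  have D0: "has_D0 2 u v0"
    unfolding has_D0_def powr2 by (rule exI, rule conjI, rule ext_L2_transform(1)[OF w0], rule ext_L2_transform(1)[OF v0])
  have D1: "has_D1 (2/3) u v1"
    unfolding has_D1_def by (rule exI, rule conjI, rule ext_L2_transform(2)[OF w1], rule ext_L2_transform(2)[OF v1])
  have v0L: "L2 v0" by (rule s0.partial.extD(1)[OF v0])
  have lap: "eq_distrib (laplacian0 (regular u)) (regular (\<lambda>z. - v0 z))"
    by (rule laplacian_eq[OF w0 v0])
  \<comment> \<open>Once the Laplacian is known to be a function in L2, the equation itself gives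
    the same for Y u.\<close>
  have "eq_distrib (transport_Y (block_matrix B1) (regular u)) (regular (\<lambda>z. g z - of_real \<sigma> * v0 z))"
    unfolding eq_distrib_def
  proof (intro allI impI)
    fix \<phi> :: "(real ^ ('m + 'n)) \<times> real \<Rightarrow> complex" assume \<phi>: "test_fun \<phi>"
    have i: "integrable lborel (\<lambda>z. g z * \<phi> z)" "integrable lborel (\<lambda>z. v0 z * \<phi> z)"
      by (intro L2_integrable_mult g v0L bcs_L2 test_fun_bcs \<phi>)+
    have "transport_Y (block_matrix B1) (regular u) \<phi> = regular g \<phi> + of_real \<sigma> * laplacian0 (regular u) \<phi>"
      using eq \<phi> unfolding eq_distrib_def by (metis diff_eq_eq)
    also have "laplacian0 (regular u) \<phi> = regular (\<lambda>z. - v0 z) \<phi>"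
      using lap \<phi> unfolding eq_distrib_def by blast
    also have "regular g \<phi> + of_real \<sigma> * regular (\<lambda>z. - v0 z) \<phi> = regular (\<lambda>z. g z - of_real \<sigma> * v0 z) \<phi>"
      using i by (simp add: regular_def left_diff_distrib mult.assoc)
    finally show "transport_Y (block_matrix B1) (regular u) \<phi> = regular (\<lambda>z. g z - of_real \<sigma> * v0 z) \<phi>" .
  qed
  then have "distrib_in_L2 (transport_Y (block_matrix B1) (regular u))"
    unfolding distrib_in_L2_def using L2_diff[OF g L2_cmult[OF v0L]] by blast
  moreover have "distrib_in_L2 (laplacian0 (regular u))"
    unfolding distrib_in_L2_def using lap L2_minus[OF v0L] by blast
  ultimately show ?thesis using D0 D1 norm unfolding k_def by blast
qed

theorem theorem1p3:
  fixes B :: "real ^ ('m::finite + 'n::finite) ^ ('m + 'n)"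
    and B1 :: "real ^ 'm ^ 'n"
  assumes "CARD('n) \<le> CARD('m)"
    and "B = block_matrix B1"
    and "rank B1 = CARD('n)"
  shows "\<exists>C::real. \<forall>(\<sigma>::real) (g :: (real ^ ('m + 'n)) \<times> real \<Rightarrow> complex)
                         (u :: (real ^ ('m + 'n)) \<times> real \<Rightarrow> complex).
     0 < \<sigma> \<longrightarrow> \<sigma> \<noteq> 1 \<longrightarrow> L2 g \<longrightarrow> L2 u \<longrightarrow>
     eq_distrib
       (\<lambda>\<phi>. transport_Y B (regular u) \<phi> - complex_of_real \<sigma> * laplacian0 (regular u) \<phi>)
       (regular g) \<longrightarrow>
     distrib_in_L2 (transport_Y B (regular u)) \<and>
     distrib_in_L2 (laplacian0 (regular u)) \<and>
     (\<exists>v0 v1. has_D0 2 u v0 \<and> has_D1 (2/3) u v1 \<and>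
        L2norm v1 \<le> C * L2norm v0 powr (1/3) * L2norm g powr (2/3))"
proof -
  \<comment> \<open>Chosen from \<open>B1\<close> alone, before \<sigma>, \<open>g\<close> and
    \<open>u\<close> are introduced: this makes C depend on B only.\<close>
  obtain \<kappa> where \<kappa>: "0 < \<kappa>" "\<And>b. \<kappa> * norm b \<le> norm (b v* B1)"
    using transpose_bounded_below[OF assms(3)] by blast
  have "kolmogorov_equation B1 \<sigma>" if "0 < \<sigma>" for \<sigma> :: real
    using assms(3) that by unfold_locales
  then show ?thesis
    unfolding assms(2)
    by (intro exI[of _ "sqrt (12 * (1 / \<kappa> powr (2/3))\<^sup>2)"] allI impI kolmogorov_equation.regularity[OF _ _ _ \<kappa>])
qed

end
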